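(* Let $\{W_\gamma:\gamma\in T^*\}$ be a cascade generator, let $Q_n(t)=\prod_{j=0}^nW_{t|j}$ be the corresponding dependent cascade, and let $Q_n(t)=Q_n'(t)+Q_n''(t)$ be its Kahane decomposition relative to $\lambda$. Then the Kahane decomposition is given by a weight decomposition: for suitable versions of the conditional expectations, the family $\mathbf F=\{F_\gamma:\gamma\in T^*\}$ defined by $$F_{t|n}=\frac{Q_n'(t)}{Q_n(t)},\qquad t\in T,\ n\ge0$$ (with $F_{t|n}=0$ where $Q_n(t)=0$) is a weight decomposition, and for each $t\in T$ and $n\ge0$, almost surely, $Q_{\mathbf F,n}(t)=Q_n'(t)$ and $Q_{\mathbf F^c,n}(t)=Q_n''(t)$, where $\mathbf F^c=\{1-F_\gamma:\gamma\in T^*\}$.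
   Context: Tree. Fix an integer $b\ge2$. $T=\{0,\dots,b-1\}^{\mathbb N}$ with the product topology (a compact metric space); $\lambda$ is the normalized Haar measure on $T$ (the product of uniform measures). $T^*$ is the set of all finite words over $\{0,\dots,b-1\}$, including the empty word $\emptyset$ (the root). $|\gamma|$ is the length of $\gamma\in T^*$. For $t\in T$, $t|n=(t_1,\dots,t_n)$, $t|0=\emptyset$; for $\gamma\in T^*$ and $j\le|\gamma|$, $\gamma|j$ is the prefix of length $j$. $\Delta_\gamma=\{t\in T:t|{|\gamma|}=\gamma\}$. Cascade generator. Given a probability measure $p_0(dx)$ on $[0,\infty)$ with finite positive mean and transition probability kernels $q_n(dx|x_0,\dots,x_{n-1})$, $n\ge1$, on $[0,\infty)$, each of mean one, let $\Omega=[0,\infty)^{T^*}$ with product $\sigma$-field $\mathcal F$, let $W_\gamma(\omega)=\omega_\gamma$ and $\mathcal F_n=\sigma\{W_\gamma:|\gamma|\le n\}$, and let $P$ be the probability on $(\Omega,\mathcal F)$ such that: $W_\emptyset$ has law $p_0$; for every $t\in T$ and $n\ge0$ the conditional law of $W_{t|n+1}$ given $\mathcal F_n$ is $q_{n+1}(dx|W_{t|0},\dots,W_{t|n})$; and the variables $W_\gamma$, $|\gamma|=n+1$, are conditionally independent given $\mathcal F_n$. Positive $T$-martingale. A sequence $\{Q_n(t)\}$ of nonnegative functions on $T\times\Omega$ such that for every $t\in T$, $\{Q_n(t)\}_n$ is a martingale with respect to $(\mathcal F_n)$ under $P$, and for $P$-a.e. $\omega$ the functions $Q_n(\cdot,\omega)$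 are Borel. $Q_n\lambda$ is the random measure $Q_n(t)\lambda(dt)$, and $Q_\infty\lambda$ is its a.s. weak limit as $n\to\infty$ (it exists by martingale convergence). For the dependent cascade, $\lambda_\infty:=Q_\infty\lambda$. Kahane decomposition (relative to $\lambda$). The decomposition $Q_n=Q_n'+Q_n''$ into positive $T$-martingales such that $E[Q'_\infty\lambda(A)\,|\,\mathcal F_n]=Q'_n\lambda(A)$ a.s. for all $n$ and all Borel $A\subseteq T$, and $Q''_\infty\lambda=0$ a.s.; for the cascade it is given by $$Q_n'(t)=\frac{E[\lambda_\infty(\Delta_{t|n})\,|\,\mathcal F_n]}{\lambda(\Delta_{t|n})},\qquad Q_n''(t)=Q_n(t)-Q_n'(t).$$ Weight system and weight decomposition. A weight system is a family $\mathbf F=\{F_\gamma:\gamma\in T^*\}$ of functions $F_\gamma:\Omega\to[0,\infty)$, $F_\gamma$ measurable with respect to $\sigma\{W_{\gamma|j}:0\le j\le|\gamma|\}$, such that $Q_{\mathbf F,n}(t)=\big(\prod_{j=0}^nW_{t|j}\big)F_{t|n}$ is a positive $T$-martingale. It is a weight decomposition if $\mathbf F^c=\{1-F_\gamma:\gamma\in T^*\}$ is also a weight system. *)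

theory Defs
  imports "HOL-Probability.Probability"
begin

section \<open>The tree and its boundary\<close>

definition tree_words :: "nat \<Rightarrow> nat list set" where
  "tree_words b = lists {..<b}"

definition tree_boundary :: "nat \<Rightarrow> (nat \<Rightarrow> nat) set" where
  "tree_boundary b = {t. \<forall>i. t i < b}"

text \<open>
  Coordinates are indexed from 0, so the prefix of length \<open>n\<close> is \<open>t 0, \<dots>, t (n - 1)\<close>.
  The prefix of length \<open>j\<close> of a finite word \<open>\<gamma>\<close> is \<open>take j \<gamma>\<close>.
\<close>

definition prefix_of :: "(nat \<Rightarrow> nat) \<Rightarrow> nat \<Rightarrow> nat list" where
  "prefix_of t n = map t [0..<n]"

definition cylinder :: "nat \<Rightarrow> nat list \<Rightarrow> (nat \<Rightarrow> nat) set" where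
  "cylinder b \<gamma> = {t \<in> tree_boundary b. prefix_of t (length \<gamma>) = \<gamma>}"

definition tree_measure :: "nat \<Rightarrow> (nat \<Rightarrow> nat) measure" where
  "tree_measure b = PiM UNIV (\<lambda>_. uniform_count_measure {..<b})"

lemma space_tree_measure: "space (tree_measure b) = tree_boundary b"
  by (auto simp: tree_measure_def tree_boundary_def space_PiM space_uniform_count_measure PiE_def Pi_def)

text \<open>
  Topological notions on the boundary refer to the product topology on \<^typ>\<open>nat \<Rightarrow> nat\<close>
  (with \<^typ>\<open>nat\<close> discrete), restricted to \<^term>\<open>tree_boundary b\<close>. Its Borel sets are exactly the
  sets of \<^term>\<open>tree_measure b\<close>:
\<close>

lemma sets_tree_measure: "sets (tree_measure b) = sets (restrict_space borel (tree_boundary b))"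
proof (rule antisym)
  have [measurable]: "(\<lambda>t::nat\<Rightarrow>nat. t i) \<in> borel \<rightarrow>\<^sub>M count_space UNIV" for i
  proof -
    have "(\<lambda>t::nat\<Rightarrow>nat. t i) \<in> borel \<rightarrow>\<^sub>M borel"
      by (intro borel_measurable_continuous_onI continuous_on_product_coordinates)
    moreover have "y \<in> sets borel" for y :: "nat set"
      by (intro borel_open Topological_Spaces.discrete_topology_class.open_discrete)
    ultimately show ?thesis
      by (simp add: measurable_def)
  qed
  have id1: "(\<lambda>t. t) \<in> restrict_space borel (tree_boundary b) \<rightarrow>\<^sub>M tree_measure b"
    unfolding tree_measure_def
  proof (rule measurable_PiM_single')
    show "(\<lambda>t. t i) \<in> restrict_space borel (tree_boundary b) \<rightarrow>\<^sub>M uniform_count_measure {..<b}" for i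
    proof -
      have "(\<lambda>t. t i) \<in> restrict_space borel (tree_boundary b) \<rightarrow>\<^sub>M restrict_space (count_space UNIV) {..<b}"
        by (rule measurable_restrict_space3) (auto simp: tree_boundary_def)
      moreover have "sets (uniform_count_measure {..<b}) = sets (restrict_space (count_space UNIV) {..<b})"
        by (auto simp: sets_uniform_count_measure sets_restrict_space)
      ultimately show ?thesis
        using measurable_cong_sets by blast
    qed
  qed (auto simp: space_restrict_space tree_boundary_def space_uniform_count_measure)
  show "sets (tree_measure b) \<subseteq> sets (restrict_space borel (tree_boundary b))"
  proof
    fix A assume A: "A \<in> sets (tree_measure b)"
    have "A \<subseteq> tree_boundary b"
      using sets.sets_into_space[OF A] by (simp add: space_tree_measure)
    then have "A \<inter> tree_boundary b = A" by blast
    with measurable_sets[OF id1 A] show "A \<in> sets (restrict_space borel (tree_boundary b))"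
      by (simp add: space_restrict_space)
  qed
  have id2: "(\<lambda>t. t) \<in> tree_measure b \<rightarrow>\<^sub>M PiM UNIV (\<lambda>_. borel :: nat measure)"
    unfolding tree_measure_def
  proof (rule measurable_PiM_single')
    fix i :: nat
    have "(\<lambda>t::nat\<Rightarrow>nat. t i) \<in> PiM UNIV (\<lambda>_. uniform_count_measure {..<b}) \<rightarrow>\<^sub>M uniform_count_measure {..<b}"
      by (rule measurable_component_singleton) simp
    moreover have "(\<lambda>k. k) \<in> uniform_count_measure {..<b} \<rightarrow>\<^sub>M (borel :: nat measure)"
      by (auto simp: measurable_def sets_uniform_count_measure space_uniform_count_measure)
    ultimately show "(\<lambda>t::nat\<Rightarrow>nat. t i) \<in> PiM UNIV (\<lambda>_. uniform_count_measure {..<b}) \<rightarrow>\<^sub>M (borel :: nat measure)"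
      by (rule measurable_compose)
  qed auto
  show "sets (restrict_space borel (tree_boundary b)) \<subseteq> sets (tree_measure b)"
  proof
    fix A assume "A \<in> sets (restrict_space borel (tree_boundary b))"
    then obtain B :: "(nat \<Rightarrow> nat) set" where B: "B \<in> sets borel" "A = tree_boundary b \<inter> B"
      by (auto simp: sets_restrict_space)
    have "(\<lambda>t. t) -` B \<inter> space (tree_measure b) \<in> sets (tree_measure b)"
      by (rule measurable_sets[OF id2]) (simp only: sets_PiM_equal_borel B(1))
    with B(2) show "A \<in> sets (tree_measure b)"
      by (simp add: space_tree_measure Int_commute)
  qed
qed

text \<open>Weak convergence of finite Borel measures on the boundary; by compactness every
  continuous function is bounded.\<close>

definition weakly_converges :: "nat \<Rightarrow> (nat \<Rightarrow> (nat \<Rightarrow> nat) measure) \<Rightarrow> (nat \<Rightarrow> nat) measure \<Rightarrow> bool" where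
  "weakly_converges b \<mu> \<nu> \<longleftrightarrow>
     (\<forall>n. finite_measure (\<mu> n) \<and> sets (\<mu> n) = sets (tree_measure b)) \<and>
     finite_measure \<nu> \<and> sets \<nu> = sets (tree_measure b) \<and>
     (\<forall>f :: (nat \<Rightarrow> nat) \<Rightarrow> real. continuous_on (tree_boundary b) f \<longrightarrow>
        (\<lambda>n. \<integral>t. f t \<partial>\<mu> n) \<longlonglongrightarrow> (\<integral>t. f t \<partial>\<nu>))"

section \<open>The probability space and its sub-sigma-fields\<close>

abbreviation nonneg_borel :: "real measure" where
  "nonneg_borel \<equiv> restrict_space borel {0..}"

text \<open>The variable \<open>W\<^sub>\<gamma>\<close> is the coordinate map \<open>\<lambda>\<omega>. \<omega> \<gamma>\<close>.\<close>

definition cascade_space :: "nat \<Rightarrow> (nat list \<Rightarrow> real) measure" where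
  "cascade_space b = PiM (tree_words b) (\<lambda>_. nonneg_borel)"

definition coord_algebra :: "nat \<Rightarrow> nat list set \<Rightarrow> (nat list \<Rightarrow> real) measure" where
  "coord_algebra b K = sigma (space (cascade_space b))
     {{\<omega> \<in> space (cascade_space b). \<omega> \<gamma> \<in> A} | \<gamma> A. \<gamma> \<in> K \<and> A \<in> sets borel}"

definition cascade_filtration :: "nat \<Rightarrow> nat \<Rightarrow> (nat list \<Rightarrow> real) measure" where
  "cascade_filtration b n = coord_algebra b {\<gamma> \<in> tree_words b. length \<gamma> \<le> n}"

definition path_algebra :: "nat \<Rightarrow> nat list \<Rightarrow> (nat list \<Rightarrow> real) measure" where
  "path_algebra b \<gamma> = coord_algebra b {take j \<gamma> | j. j \<le> length \<gamma>}"

text \<open>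
  The kernel \<open>q n\<close> takes the tuple \<open>(x\<^sub>0, \<dots>, x\<^bsub>n-1\<^esub>)\<close>, encoded as an element of the product
  over \<open>{..<n}\<close>; only \<open>n \<ge> 1\<close> matters. Conditional independence of the finitely many variables
  of generation \<open>n + 1\<close> is the product formula for events; subfamilies are covered by
  taking \<open>A \<gamma>\<close> to be the whole half-line.
\<close>

locale cascade_generator =
  fixes b :: nat
    and p0 :: "real measure"
    and q :: "nat \<Rightarrow> (nat \<Rightarrow> real) \<Rightarrow> real measure"
    and P :: "(nat list \<Rightarrow> real) measure"
  assumes prob_p0: "prob_space p0"
    and sets_p0: "sets p0 = sets nonneg_borel"
    and integrable_p0: "integrable p0 (\<lambda>x. x)"
    and mean_p0: "0 < (\<integral>x. x \<partial>p0)"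
    and kernel: "\<And>n. 1 \<le> n \<Longrightarrow> q n \<in> PiM {..<n} (\<lambda>_. nonneg_borel) \<rightarrow>\<^sub>M prob_algebra nonneg_borel"
    and kernel_mean: "\<And>n x. 1 \<le> n \<Longrightarrow> x \<in> space (PiM {..<n} (\<lambda>_. nonneg_borel)) \<Longrightarrow>
      has_bochner_integral (q n x) (\<lambda>y. y) 1"
    and prob_P: "prob_space P"
    and sets_P: "sets P = sets (cascade_space b)"
    and law_root: "distr P nonneg_borel (\<lambda>\<omega>. \<omega> []) = p0"
    and cond_law: "\<And>t n A. t \<in> tree_boundary b \<Longrightarrow> A \<in> sets nonneg_borel \<Longrightarrow>
      AE \<omega> in P. real_cond_exp P (cascade_filtration b n)
          (\<lambda>\<omega>. indicator A (\<omega> (prefix_of t (Suc n)))) \<omega>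
        = measure (q (Suc n) (\<lambda>j\<in>{..<Suc n}. \<omega> (prefix_of t j))) A"
    and cond_indep: "\<And>n A. (\<And>\<gamma>. A \<gamma> \<in> sets nonneg_borel) \<Longrightarrow>
      AE \<omega> in P. real_cond_exp P (cascade_filtration b n)
          (\<lambda>\<omega>. \<Prod>\<gamma> | \<gamma> \<in> tree_words b \<and> length \<gamma> = Suc n. indicator (A \<gamma>) (\<omega> \<gamma>)) \<omega>
        = (\<Prod>\<gamma> | \<gamma> \<in> tree_words b \<and> length \<gamma> = Suc n.
             real_cond_exp P (cascade_filtration b n) (\<lambda>\<omega>. indicator (A \<gamma>) (\<omega> \<gamma>)) \<omega>)"

text \<open>\<open>Y\<close> is a version of the conditional expectation of \<open>X\<close> given \<open>G\<close>.\<close>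

definition cond_exp_version :: "'a measure \<Rightarrow> 'a measure \<Rightarrow> ('a \<Rightarrow> real) \<Rightarrow> ('a \<Rightarrow> real) \<Rightarrow> bool" where
  "cond_exp_version P G X Y \<longleftrightarrow>
     integrable P X \<and> Y \<in> borel_measurable G \<and> (AE \<omega> in P. real_cond_exp P G X \<omega> = Y \<omega>)"

section \<open>Positive martingales indexed by the boundary\<close>

type_synonym tree_process = "nat \<Rightarrow> (nat \<Rightarrow> nat) \<Rightarrow> (nat list \<Rightarrow> real) \<Rightarrow> real"

definition positive_T_martingale :: "nat \<Rightarrow> (nat list \<Rightarrow> real) measure \<Rightarrow> tree_process \<Rightarrow> bool" where
  "positive_T_martingale b P Q \<longleftrightarrow>
     (\<forall>n. \<forall>t\<in>tree_boundary b. \<forall>\<omega>\<in>space P. 0 \<le> Q n t \<omega>) \<and>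
     (\<forall>t\<in>tree_boundary b. \<forall>n.
        Q n t \<in> borel_measurable (cascade_filtration b n) \<and> integrable P (Q n t) \<and>
        (AE \<omega> in P. real_cond_exp P (cascade_filtration b n) (Q (Suc n) t) \<omega> = Q n t \<omega>)) \<and>
     (AE \<omega> in P. \<forall>n. (\<lambda>t. Q n t \<omega>) \<in> borel_measurable (tree_measure b))"

definition process_measure :: "nat \<Rightarrow> tree_process \<Rightarrow> nat \<Rightarrow> (nat list \<Rightarrow> real) \<Rightarrow> (nat \<Rightarrow> nat) measure" where
  "process_measure b Q n \<omega> = density (tree_measure b) (\<lambda>t. ennreal (Q n t \<omega>))"

text \<open>\<open>\<Lambda>\<close> is (a version of) the almost sure weak limit of the random measures \<open>Q\<^sub>n \<lambda>\<close>. It is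
  required to be a random measure, since an arbitrary modification on a null set need not be
  measurable in \<open>\<omega>\<close>.\<close>

definition random_measure :: "nat \<Rightarrow> (nat list \<Rightarrow> real) measure \<Rightarrow>
    ((nat list \<Rightarrow> real) \<Rightarrow> (nat \<Rightarrow> nat) measure) \<Rightarrow> bool" where
  "random_measure b P \<Lambda> \<longleftrightarrow>
     (\<forall>\<omega>\<in>space P. finite_measure (\<Lambda> \<omega>) \<and> sets (\<Lambda> \<omega>) = sets (tree_measure b)) \<and>
     (\<forall>A\<in>sets (tree_measure b). (\<lambda>\<omega>. measure (\<Lambda> \<omega>) A) \<in> borel_measurable P)"

definition limit_measure :: "nat \<Rightarrow> (nat list \<Rightarrow> real) measure \<Rightarrow> tree_process \<Rightarrow>
    ((nat list \<Rightarrow> real) \<Rightarrow> (nat \<Rightarrow> nat) measure) \<Rightarrow> bool" where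
  "limit_measure b P Q \<Lambda> \<longleftrightarrow> random_measure b P \<Lambda> \<and>
     (AE \<omega> in P. weakly_converges b (\<lambda>n. process_measure b Q n \<omega>) (\<Lambda> \<omega>))"

definition kahane_decomposition :: "nat \<Rightarrow> (nat list \<Rightarrow> real) measure \<Rightarrow>
    tree_process \<Rightarrow> tree_process \<Rightarrow> tree_process \<Rightarrow> bool" where
  "kahane_decomposition b P Q Q' Q'' \<longleftrightarrow>
     positive_T_martingale b P Q' \<and> positive_T_martingale b P Q'' \<and>
     (\<forall>n. \<forall>t\<in>tree_boundary b. \<forall>\<omega>\<in>space P. Q n t \<omega> = Q' n t \<omega> + Q'' n t \<omega>) \<and>
     (\<exists>\<Lambda>'. limit_measure b P Q' \<Lambda>' \<and>
        (\<forall>A\<in>sets (tree_measure b). integrable P (\<lambda>\<omega>. measure (\<Lambda>' \<omega>) A) \<and>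
           (\<forall>n. AE \<omega> in P. real_cond_exp P (cascade_filtration b n) (\<lambda>\<omega>. measure (\<Lambda>' \<omega>) A) \<omega>
              = measure (process_measure b Q' n \<omega>) A))) \<and>
     limit_measure b P Q'' (\<lambda>_. null_measure (tree_measure b))"

section \<open>The cascade and weight systems\<close>

definition cascade :: tree_process where
  "cascade n t \<omega> = (\<Prod>j\<le>n. \<omega> (prefix_of t j))"

definition weighted_cascade :: "(nat list \<Rightarrow> (nat list \<Rightarrow> real) \<Rightarrow> real) \<Rightarrow> tree_process" where
  "weighted_cascade F n t \<omega> = (\<Prod>j\<le>n. \<omega> (prefix_of t j)) * F (prefix_of t n) \<omega>"

definition weight_system :: "nat \<Rightarrow> (nat list \<Rightarrow> real) measure \<Rightarrow>
    (nat list \<Rightarrow> (nat list \<Rightarrow> real) \<Rightarrow> real) \<Rightarrow> bool" where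
  "weight_system b P F \<longleftrightarrow>
     (\<forall>\<gamma>\<in>tree_words b. (\<forall>\<omega>\<in>space P. 0 \<le> F \<gamma> \<omega>) \<and> F \<gamma> \<in> borel_measurable (path_algebra b \<gamma>)) \<and>
     positive_T_martingale b P (weighted_cascade F)"

definition complement_weights :: "(nat list \<Rightarrow> (nat list \<Rightarrow> real) \<Rightarrow> real) \<Rightarrow>
    nat list \<Rightarrow> (nat list \<Rightarrow> real) \<Rightarrow> real" where
  "complement_weights F \<gamma> \<omega> = 1 - F \<gamma> \<omega>"

definition weight_decomposition :: "nat \<Rightarrow> (nat list \<Rightarrow> real) measure \<Rightarrow>
    (nat list \<Rightarrow> (nat list \<Rightarrow> real) \<Rightarrow> real) \<Rightarrow> bool" where
  "weight_decomposition b P F \<longleftrightarrow> weight_system b P F \<and> weight_system b P (complement_weights F)"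

text \<open>The two parts of the Kahane decomposition of the cascade, where \<open>Y \<gamma>\<close> is a
  version of the conditional expectation of \<open>\<lambda>\<^sub>\<infinity>(\<Delta>\<^sub>\<gamma>)\<close> given generation \<open>|\<gamma>|\<close>.\<close>

definition kahane_regular :: "nat \<Rightarrow> (nat list \<Rightarrow> (nat list \<Rightarrow> real) \<Rightarrow> real) \<Rightarrow> tree_process" where
  "kahane_regular b Y n t \<omega> =
     Y (prefix_of t n) \<omega> / measure (tree_measure b) (cylinder b (prefix_of t n))"

definition kahane_singular :: "nat \<Rightarrow> (nat list \<Rightarrow> (nat list \<Rightarrow> real) \<Rightarrow> real) \<Rightarrow> tree_process" where
  "kahane_singular b Y n t \<omega> = cascade n t \<omega> - kahane_regular b Y n t \<omega>"

end

theory Submission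
  imports Defs
begin

text \<open>
  Fix a word \<open>\<gamma>\<close> of length \<open>n\<close> and let \<open>Q\<^sub>\<gamma>\<close> be the product of the weights along \<open>\<gamma>\<close>. The
  quotient of the regular part by the cascade at \<open>\<gamma>\<close> is \<open>b\<^sup>n E[\<lambda>\<^sub>\<infinity>(\<Delta>\<^sub>\<gamma>) | \<F>\<^sub>n] / Q\<^sub>\<gamma>\<close>. For it to be a
  weight, the conditional expectation has to depend on the weights along \<open>\<gamma>\<close> only and to lie
  between \<open>0\<close> and \<open>Q\<^sub>\<gamma> / b\<^sup>n\<close>.

  The first property is a Markov property of the cascade (\<open>markov_property\<close>): the kernels that
  produce the weights below \<open>\<gamma>\<close> see only their own line of descent, so, given \<open>\<F>\<^sub>n\<close>, the law of
  the weights below \<open>\<gamma>\<close> depends on the path to \<open>\<gamma>\<close> alone. It applies to the masses that the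
  cascade gives to \<open>\<Delta>\<^sub>\<gamma>\<close> at finite levels. These converge to \<open>\<lambda>\<^sub>\<infinity>(\<Delta>\<^sub>\<gamma>)\<close> almost surely, in general
  not in mean, so they are truncated before the limit is taken
  (\<open>real_cond_exp_eq_truncation_limit\<close>). The second property is Fatou's lemma, because each
  finite-level mass has conditional expectation exactly \<open>Q\<^sub>\<gamma> / b\<^sup>n\<close>.

  That the regular part is a martingale along every fixed boundary point means that the
  children of \<open>\<gamma>\<close> have equal conditional expected masses, each \<open>1/b\<close> of that of \<open>\<gamma>\<close>. This is a
  symmetry: exchanging the subtrees below two siblings preserves \<open>P\<close> on every \<open>\<F>\<^sub>m\<close>
  (\<open>relabel_invariance\<close>) and moves no weight of generation at most \<open>n\<close>. Iterating it computes
  \<open>E[\<lambda>\<^sub>\<infinity>(A) | \<F>\<^sub>n]\<close> for every cylinder \<open>A\<close> of length at least \<open>n\<close>, and a Dynkin argument extends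
  the result to all Borel sets.

  Finally, summing over the descendants of \<open>\<gamma>\<close> in generation \<open>m\<close> shows that the regular part
  gives \<open>\<Delta>\<^sub>\<gamma>\<close> the mass \<open>E[\<lambda>\<^sub>\<infinity>(\<Delta>\<^sub>\<gamma>) | \<F>\<^sub>m]\<close>, which tends to \<open>\<lambda>\<^sub>\<infinity>(\<Delta>\<^sub>\<gamma>)\<close> by Levy's upward theorem
  (\<open>levy_upward\<close>). On the compact boundary convergence on all cylinders is weak convergence, so
  \<open>\<lambda>\<^sub>\<infinity>\<close> is the limit measure of the regular part and the singular part has limit zero.

  Choosing the version of the conditional expectation as a path-measurable one, clipped to the
  interval from \<open>0\<close> to \<open>Q\<^sub>\<gamma> / b\<^sup>n\<close>, makes all pointwise requirements hold everywhere.
\<close>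

section \<open>Conditional expectations and mean convergence\<close>

context prob_space
begin

lemma sigma_finite_subalgebraI: "subalgebra M F \<Longrightarrow> sigma_finite_subalgebra M F"
  by (intro finite_measure_subalgebra_is_sigma_finite finite_measure_subalgebra.intro
      finite_measure_subalgebra_axioms.intro finite_measure_axioms)

lemma real_cond_exp_abs_le:
  assumes F: "subalgebra M F" and X: "integrable M X"
  shows "AE x in M. \<bar>real_cond_exp M F X x\<bar> \<le> real_cond_exp M F (\<lambda>x. \<bar>X x\<bar>) x"
proof -
  interpret F: sigma_finite_subalgebra M F by (rule sigma_finite_subalgebraI[OF F])
  have "AE x in M. real_cond_exp M F X x \<le> real_cond_exp M F (\<lambda>x. \<bar>X x\<bar>) x"
    using X by (intro F.real_cond_exp_mono) auto
  moreover have "AE x in M. real_cond_exp M F (\<lambda>x. -1 * X x) x \<le> real_cond_exp M F (\<lambda>x. \<bar>X x\<bar>) x"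
    using X by (intro F.real_cond_exp_mono) auto
  moreover have "AE x in M. real_cond_exp M F (\<lambda>x. -1 * X x) x = -1 * real_cond_exp M F X x"
    using X by (intro F.real_cond_exp_cmult)
  ultimately show ?thesis by eventually_elim auto
qed

lemma real_cond_exp_L1_contraction:
  assumes F: "subalgebra M F" and X: "integrable M X" and Y: "integrable M Y"
  shows "(\<integral>x. \<bar>real_cond_exp M F X x - real_cond_exp M F Y x\<bar> \<partial>M) \<le> (\<integral>x. \<bar>X x - Y x\<bar> \<partial>M)"
proof -
  interpret F: sigma_finite_subalgebra M F by (rule sigma_finite_subalgebraI[OF F])
  have "AE x in M. \<bar>real_cond_exp M F X x - real_cond_exp M F Y x\<bar>
      \<le> real_cond_exp M F (\<lambda>x. \<bar>X x - Y x\<bar>) x"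
    using F.real_cond_exp_diff[OF X Y] real_cond_exp_abs_le[OF F Bochner_Integration.integrable_diff[OF X Y]]
    by eventually_elim simp
  then have "(\<integral>x. \<bar>real_cond_exp M F X x - real_cond_exp M F Y x\<bar> \<partial>M)
      \<le> (\<integral>x. real_cond_exp M F (\<lambda>x. \<bar>X x - Y x\<bar>) x \<partial>M)"
    using X Y by (intro integral_mono_AE) (auto intro!: F.real_cond_exp_int)
  also have "\<dots> = (\<integral>x. \<bar>X x - Y x\<bar> \<partial>M)"
    using X Y by (intro F.real_cond_exp_int) auto
  finally show ?thesis .
qed

text \<open>
  Conditional expectation contracts the \<open>L\<^sup>1\<close> norm, so an identity between two conditional
  expectations survives mean convergence of the arguments. Taking \<open>X = X'\<close> gives closedness of the
  property that two \<open>\<sigma>\<close>-algebras predict \<open>X\<close> equally well; taking \<open>F = G\<close>, of the property that two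
  variables have the same prediction.
\<close>

lemma real_cond_exp_eq_L1_limit:
  assumes F: "subalgebra M F" and G: "subalgebra M G"
    and X: "\<And>i. integrable M (X i)" "integrable M Y" "(\<lambda>i. \<integral>x. \<bar>X i x - Y x\<bar> \<partial>M) \<longlonglongrightarrow> 0"
    and X': "\<And>i. integrable M (X' i)" "integrable M Y'" "(\<lambda>i. \<integral>x. \<bar>X' i x - Y' x\<bar> \<partial>M) \<longlonglongrightarrow> 0"
    and eq: "\<And>i::nat. AE x in M. real_cond_exp M F (X i) x = real_cond_exp M G (X' i) x"
  shows "AE x in M. real_cond_exp M F Y x = real_cond_exp M G Y' x"
proof -
  interpret F: sigma_finite_subalgebra M F by (rule sigma_finite_subalgebraI[OF F])
  interpret G: sigma_finite_subalgebra M G by (rule sigma_finite_subalgebraI[OF G])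
  let ?D = "\<lambda>x. \<bar>real_cond_exp M F Y x - real_cond_exp M G Y' x\<bar>"
  note [simp] = F.real_cond_exp_int(1) G.real_cond_exp_int(1) X(1,2) X'(1,2)
  have le: "(\<integral>x. ?D x \<partial>M) \<le> (\<integral>x. \<bar>X i x - Y x\<bar> \<partial>M) + (\<integral>x. \<bar>X' i x - Y' x\<bar> \<partial>M)" for i
  proof -
    have "(\<integral>x. ?D x \<partial>M) \<le> (\<integral>x. \<bar>real_cond_exp M F (X i) x - real_cond_exp M F Y x\<bar>
        + \<bar>real_cond_exp M G (X' i) x - real_cond_exp M G Y' x\<bar> \<partial>M)"
      using eq[of i] by (intro integral_mono_AE) (auto elim!: eventually_mono)
    also have "\<dots> = (\<integral>x. \<bar>real_cond_exp M F (X i) x - real_cond_exp M F Y x\<bar> \<partial>M)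
        + (\<integral>x. \<bar>real_cond_exp M G (X' i) x - real_cond_exp M G Y' x\<bar> \<partial>M)"
      by (intro Bochner_Integration.integral_add) auto
    also have "\<dots> \<le> (\<integral>x. \<bar>X i x - Y x\<bar> \<partial>M) + (\<integral>x. \<bar>X' i x - Y' x\<bar> \<partial>M)"
      by (intro add_mono real_cond_exp_L1_contraction F G) auto
    finally show ?thesis .
  qed
  have "(\<lambda>i. (\<integral>x. \<bar>X i x - Y x\<bar> \<partial>M) + (\<integral>x. \<bar>X' i x - Y' x\<bar> \<partial>M)) \<longlonglongrightarrow> 0 + 0"
    by (intro tendsto_add X(3) X'(3))
  then have "(\<integral>x. ?D x \<partial>M) \<le> 0"
    using le by (intro LIMSEQ_le_const) auto
  moreover have "0 \<le> (\<integral>x. ?D x \<partial>M)" by simp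
  ultimately have "(\<integral>x. ?D x \<partial>M) = 0" by linarith
  then have "AE x in M. ?D x = 0"
    by (subst (asm) integral_nonneg_eq_0_iff_AE) auto
  then show ?thesis by eventually_elim simp
qed

lemma dominated_L1_convergence:
  fixes X :: "nat \<Rightarrow> 'a \<Rightarrow> real"
  assumes [measurable]: "\<And>i. X i \<in> borel_measurable M" "Y \<in> borel_measurable M"
    and w: "integrable M w"
    and lim: "AE x in M. (\<lambda>i. X i x) \<longlonglongrightarrow> Y x" and le: "\<And>i. AE x in M. \<bar>X i x\<bar> \<le> w x"
  shows "integrable M Y" "(\<lambda>i. \<integral>x. \<bar>X i x - Y x\<bar> \<partial>M) \<longlonglongrightarrow> 0"
proof -
  show Y: "integrable M Y"
    by (rule integrable_dominated_convergence[of Y M X w]) (use assms in auto)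
  have "(\<lambda>i. \<integral>x. \<bar>X i x - Y x\<bar> \<partial>M) \<longlonglongrightarrow> (\<integral>x. 0 \<partial>M)"
  proof (rule integral_dominated_convergence[where w = "\<lambda>x. w x + \<bar>Y x\<bar>"])
    show "AE x in M. (\<lambda>i. \<bar>X i x - Y x\<bar>) \<longlonglongrightarrow> 0"
      using lim by eventually_elim (metis LIM_zero tendsto_rabs_zero)
    show "AE x in M. norm \<bar>X i x - Y x\<bar> \<le> w x + \<bar>Y x\<bar>" for i
      using le[of i] by eventually_elim auto
  qed (use w Y in auto)
  then show "(\<lambda>i. \<integral>x. \<bar>X i x - Y x\<bar> \<partial>M) \<longlonglongrightarrow> 0" by simp
qed

lemma truncated_L1_convergence:
  fixes X :: "nat \<Rightarrow> 'a \<Rightarrow> real"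
  assumes "\<And>i. X i \<in> borel_measurable M" "Y \<in> borel_measurable M"
    and lim: "AE x in M. (\<lambda>i. X i x) \<longlonglongrightarrow> Y x" and nonneg: "\<And>i. AE x in M. 0 \<le> X i x"
  shows "(\<lambda>i. \<integral>x. \<bar>min (real k) (X i x) - min (real k) (Y x)\<bar> \<partial>M) \<longlonglongrightarrow> 0"
    and "\<And>i. integrable M (\<lambda>x. min (real k) (X i x))"
    and "integrable M (\<lambda>x. min (real k) (Y x))"
proof -
  note [measurable] = assms(1,2)
  have le: "AE x in M. \<bar>min (real k) (X i x)\<bar> \<le> real k" for i
    using nonneg[of i] by eventually_elim auto
  then show "integrable M (\<lambda>x. min (real k) (X i x))" for i
    by (intro integrable_const_bound[where B = "real k"]) auto
  have "AE x in M. (\<lambda>i. min (real k) (X i x)) \<longlonglongrightarrow> min (real k) (Y x)"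
    using lim by eventually_elim (intro tendsto_min tendsto_const)
  from dominated_L1_convergence[OF _ _ _ this le]
  show "(\<lambda>i. \<integral>x. \<bar>min (real k) (X i x) - min (real k) (Y x)\<bar> \<partial>M) \<longlonglongrightarrow> 0"
    and "integrable M (\<lambda>x. min (real k) (Y x))" by auto
qed

lemma truncation_L1_convergence:
  assumes "integrable M Y" "AE x in M. 0 \<le> Y x"
  shows "(\<lambda>k. \<integral>x. \<bar>min (real k) (Y x) - Y x\<bar> \<partial>M) \<longlonglongrightarrow> 0"
proof (rule dominated_L1_convergence(2)[where w = Y])
  show "AE x in M. (\<lambda>k. min (real k) (Y x)) \<longlonglongrightarrow> Y x"
  proof (intro AE_I2 tendsto_eventually)
    fix x
    obtain k0 :: nat where "Y x \<le> real k0" using real_arch_simple by blast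
    then show "\<forall>\<^sub>F k in sequentially. min (real k) (Y x) = Y x"
      by (intro eventually_sequentiallyI[of k0]) auto
  qed
  show "AE x in M. \<bar>min (real i) (Y x)\<bar> \<le> Y x" for i
    using assms(2) by eventually_elim auto
qed (use assms in auto)

text \<open>
  Almost sure convergence alone does not let conditional expectations pass to the limit. It does
  so for the truncations at a fixed level, by dominated convergence, and afterwards the truncation
  level can be removed because the limit is integrable.
\<close>

lemma real_cond_exp_eq_truncation_limit:
  fixes X X' :: "nat \<Rightarrow> 'a \<Rightarrow> real"
  assumes F: "subalgebra M F" and G: "subalgebra M G"
    and X: "\<And>i. X i \<in> borel_measurable M" "integrable M Y" "AE x in M. (\<lambda>i. X i x) \<longlonglongrightarrow> Y x"
      "\<And>i. AE x in M. 0 \<le> X i x"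
    and X': "\<And>i. X' i \<in> borel_measurable M" "integrable M Y'" "AE x in M. (\<lambda>i. X' i x) \<longlonglongrightarrow> Y' x"
      "\<And>i. AE x in M. 0 \<le> X' i x"
    and eq: "\<And>k i. AE x in M. real_cond_exp M F (\<lambda>x. min (real k) (X i x)) x
      = real_cond_exp M G (\<lambda>x. min (real k) (X' i x)) x"
  shows "AE x in M. real_cond_exp M F Y x = real_cond_exp M G Y' x"
proof -
  have pos: "AE x in M. 0 \<le> Y x" if "AE x in M. (\<lambda>i. X i x) \<longlonglongrightarrow> Y x" "\<And>i. AE x in M. 0 \<le> X i x"
    for X :: "nat \<Rightarrow> 'a \<Rightarrow> real" and Y
  proof -
    from that(2) have "AE x in M. \<forall>i. 0 \<le> X i x" by (simp add: AE_all_countable)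
    with that(1) show ?thesis by eventually_elim (rule LIMSEQ_le_const, auto)
  qed
  note tr = truncated_L1_convergence[OF X(1) borel_measurable_integrable[OF X(2)] X(3,4)]
  note tr' = truncated_L1_convergence[OF X'(1) borel_measurable_integrable[OF X'(2)] X'(3,4)]
  have "AE x in M. real_cond_exp M F (\<lambda>x. min (real k) (Y x)) x
      = real_cond_exp M G (\<lambda>x. min (real k) (Y' x)) x" for k
    by (rule real_cond_exp_eq_L1_limit[OF F G tr(2,3,1) tr'(2,3,1) eq])
  then show ?thesis
    by (rule real_cond_exp_eq_L1_limit[OF F G tr(3) X(2) truncation_L1_convergence[OF X(2) pos[OF X(3,4)]]
        tr'(3) X'(2) truncation_L1_convergence[OF X'(2) pos[OF X'(3,4)]]])
qed

lemma L1_approximation_by_truncations: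
  fixes X :: "nat \<Rightarrow> 'a \<Rightarrow> real"
  assumes X: "\<And>i. X i \<in> borel_measurable M" "integrable M Y" "AE x in M. (\<lambda>i. X i x) \<longlonglongrightarrow> Y x"
      "\<And>i. AE x in M. 0 \<le> X i x" and e: "0 < e"
  obtains k i where "(\<integral>x. \<bar>min (real k) (X i x) - Y x\<bar> \<partial>M) < e"
    "integrable M (\<lambda>x. min (real k) (X i x))"
proof -
  note tr = truncated_L1_convergence[OF X(1) borel_measurable_integrable[OF X(2)] X(3,4)]
  from X(4) have "AE x in M. \<forall>i. 0 \<le> X i x" by (simp add: AE_all_countable)
  with X(3) have "AE x in M. 0 \<le> Y x" by eventually_elim (rule LIMSEQ_le_const, auto)
  from order_tendstoD(2)[OF truncation_L1_convergence[OF X(2) this], of "e/2"] e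
  obtain k where k: "(\<integral>x. \<bar>min (real k) (Y x) - Y x\<bar> \<partial>M) < e/2"
    by (auto simp: eventually_sequentially)
  from order_tendstoD(2)[OF tr(1)[of k], of "e/2"] e
  obtain i where i: "(\<integral>x. \<bar>min (real k) (X i x) - min (real k) (Y x)\<bar> \<partial>M) < e/2"
    by (auto simp: eventually_sequentially)
  have "(\<integral>x. \<bar>min (real k) (X i x) - Y x\<bar> \<partial>M)
      \<le> (\<integral>x. \<bar>min (real k) (X i x) - min (real k) (Y x)\<bar> + \<bar>min (real k) (Y x) - Y x\<bar> \<partial>M)"
    using tr(2,3) X(2) by (intro integral_mono) auto
  also have "\<dots> = (\<integral>x. \<bar>min (real k) (X i x) - min (real k) (Y x)\<bar> \<partial>M)
      + (\<integral>x. \<bar>min (real k) (Y x) - Y x\<bar> \<partial>M)"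
    using tr(2,3) X(2) by (intro Bochner_Integration.integral_add) auto
  finally show ?thesis using k i tr(2) by (intro that[of k i]) auto
qed

text \<open>
  The variables with this property form a vector space closed under dominated limits, so the
  indicators suffice.
\<close>

lemma real_cond_exp_eq_from_events:
  assumes F: "subalgebra M F" and G: "subalgebra M G" and H: "subalgebra M H"
    and ev: "\<And>C. C \<in> sets H \<Longrightarrow> AE x in M. real_cond_exp M F (indicator C) x = real_cond_exp M G (indicator C) x"
    and X: "X \<in> borel_measurable H" "integrable M X"
  shows "AE x in M. real_cond_exp M F X x = real_cond_exp M G X x"
proof -
  interpret F: sigma_finite_subalgebra M F by (rule sigma_finite_subalgebraI[OF F])
  interpret G: sigma_finite_subalgebra M G by (rule sigma_finite_subalgebraI[OF G])
  note int = integrable_from_subalg[OF H]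
  have "integrable (restr_to_subalg M H) X" by (rule integrable_in_subalg[OF H X])
  then show ?thesis
  proof (induct rule: integrable_induct)
    case (base A c)
    then have A: "A \<in> sets H" by (simp add: sets_restr_to_subalg[OF H])
    then have A': "integrable M (indicator A :: _ \<Rightarrow> real)"
      using H by (auto simp: subalgebra_def less_top[symmetric])
    from F.real_cond_exp_cmult[OF A', of c] G.real_cond_exp_cmult[OF A', of c] ev[OF A]
    show ?case by eventually_elim (simp add: mult.commute)
  next
    case (add f g)
    from F.real_cond_exp_add[OF add(1,3)[THEN int]] G.real_cond_exp_add[OF add(1,3)[THEN int]] add(2,4)
    show ?case by eventually_elim simp
  next
    case (lim f s)
    have m: "s i \<in> borel_measurable M" for i using int[OF lim(1)] by auto
    have conv: "(\<lambda>i. \<integral>x. \<bar>s i x - f x\<bar> \<partial>M) \<longlonglongrightarrow> 0"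
      by (rule dominated_L1_convergence(2)[where w = "\<lambda>x. 2 * norm (f x)"])
        (use lim(3,4) int[OF lim(5)] m in \<open>auto simp: space_restr_to_subalg intro!: AE_I2\<close>)
    show ?case
      by (rule real_cond_exp_eq_L1_limit[OF F G int[OF lim(1)] int[OF lim(5)] conv
            int[OF lim(1)] int[OF lim(5)] conv lim(2)])
  qed
qed

text \<open>
  If a prediction from the finer \<open>\<sigma>\<close>-algebra happens to be measurable for the coarser one, the tower
  property makes it the prediction from the coarser one.
\<close>

lemma real_cond_exp_eq_submeasurable:
  assumes F: "subalgebra M F" and G: "subalgebra F G" and X: "integrable M X"
    and H: "H \<in> borel_measurable G" "integrable M H"
    and eq: "AE x in M. real_cond_exp M F X x = H x"
  shows "AE x in M. real_cond_exp M F X x = real_cond_exp M G X x"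
proof -
  have MG: "subalgebra M G" using F G by (auto simp: subalgebra_def)
  interpret F: sigma_finite_subalgebra M F by (rule sigma_finite_subalgebraI[OF F])
  interpret G: sigma_finite_subalgebra M G by (rule sigma_finite_subalgebraI[OF MG])
  have "AE x in M. real_cond_exp M G (real_cond_exp M F X) x = real_cond_exp M G H x"
    using eq H(2) by (intro G.real_cond_exp_cong) auto
  with eq G.real_cond_exp_nested_subalg[OF F G X] G.real_cond_exp_F_meas[OF H(2,1)]
  show ?thesis by eventually_elim simp
qed

section \<open>Levy's upward theorem\<close>

text \<open>
  Doob's inequality: decompose according to the first time the level \<open>c\<close> is exceeded. On each
  piece the conditional expectation may be replaced by \<open>U\<close> itself, and the pieces are disjoint.
\<close>

lemma maximal_inequality:
  fixes F :: "nat \<Rightarrow> 'a measure"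
  assumes F: "\<And>n. subalgebra M (F n)" and mono: "\<And>m n. m \<le> n \<Longrightarrow> sets (F m) \<subseteq> sets (F n)"
    and U: "integrable M U" "\<And>x. x \<in> space M \<Longrightarrow> 0 \<le> U x" and c: "0 < c"
  shows "measure M {x \<in> space M. \<exists>n. c < real_cond_exp M (F n) U x} \<le> (\<integral>x. U x \<partial>M) / c"
proof -
  let ?E = "\<lambda>n. real_cond_exp M (F n) U"
  define B where "B n = {x \<in> space M. c < ?E n x \<and> (\<forall>j<n. \<not> c < ?E j x)}" for n
  have sp: "space (F n) = space M" for n using F by (auto simp: subalgebra_def)
  have gt: "{x \<in> space M. c < ?E j x} \<in> sets (F n)" if "j \<le> n" for j n
  proof -
    have "{x \<in> space (F j). c < ?E j x} \<in> sets (F j)" by measurable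
    with mono[OF that] show ?thesis by (auto simp: sp)
  qed
  have B: "B n \<in> sets (F n)" for n
  proof -
    have "B n = {x \<in> space M. c < ?E n x} - (\<Union>j<n. {x \<in> space M. c < ?E j x})"
      by (auto simp: B_def)
    also have "\<dots> \<in> sets (F n)" by (intro sets.Diff sets.finite_UN gt) auto
    finally show ?thesis .
  qed
  then have BM [measurable]: "B n \<in> sets M" for n using F by (auto simp: subalgebra_def)
  have disj: "disjoint_family B"
    unfolding disjoint_family_on_def B_def by (auto, metis linorder_neqE_nat)
  have Un: "(\<Union>n. B n) = {x \<in> space M. \<exists>n. c < ?E n x}"
  proof safe
    fix x n assume x: "x \<in> space M" "c < ?E n x"
    then have "x \<in> B (LEAST n. c < ?E n x)"
      unfolding B_def by (auto intro: LeastI dest: not_less_Least)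
    then show "x \<in> (\<Union>n. B n)" by blast
  qed (auto simp: B_def)
  have each: "c * measure M (B n) \<le> (\<integral>x. indicator (B n) x * U x \<partial>M)" for n
  proof -
    interpret F: sigma_finite_subalgebra M "F n" by (rule sigma_finite_subalgebraI[OF F])
    have "c * measure M (B n) = (\<integral>x. indicator (B n) x * c \<partial>M)" by simp
    also have "\<dots> \<le> (\<integral>x. indicator (B n) x * ?E n x \<partial>M)"
    proof (rule integral_mono)
      show "integrable M (\<lambda>x. indicator (B n) x * ?E n x)"
        using F.real_cond_exp_int(1)[OF U(1)] BM[of n]
        by (intro integrable_mult_indicator[where 'b=real, simplified])
      show "integrable M (\<lambda>x. indicator (B n) x * c)"
        using BM[of n] by (auto simp: less_top[symmetric])
      show "indicator (B n) x * c \<le> indicator (B n) x * ?E n x" for x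
        by (auto simp: B_def indicator_def)
    qed
    also have "\<dots> = (\<integral>x. indicator (B n) x * U x \<partial>M)"
      using F.real_cond_exp_intA[OF U(1) B[of n]] by (simp add: set_lebesgue_integral_def)
    finally show ?thesis .
  qed
  have sums: "(\<lambda>n. measure M (B n)) sums measure M (\<Union>n. B n)"
    by (intro measure_UNION disj) auto
  have "(\<Sum>n<N. measure M (B n)) \<le> (\<integral>x. U x \<partial>M) / c" for N
  proof -
    have "c * (\<Sum>n<N. measure M (B n)) \<le> (\<Sum>n<N. \<integral>x. indicator (B n) x * U x \<partial>M)"
      unfolding sum_distrib_left by (intro sum_mono each)
    also have "\<dots> = (\<integral>x. (\<Sum>n<N. indicator (B n) x) * U x \<partial>M)"
      unfolding sum_distrib_right
      by (intro Bochner_Integration.integral_sum[symmetric] integrable_mult_indicator[where 'b=real, simplified] BM U)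
    also have "\<dots> = (\<integral>x. indicator (\<Union>n<N. B n) x * U x \<partial>M)"
      by (subst indicator_UN_disjoint) (use disj in \<open>auto simp: disjoint_family_on_def\<close>)
    also have "\<dots> \<le> (\<integral>x. U x \<partial>M)"
      using U by (intro integral_mono integrable_mult_indicator[where 'b=real, simplified])
        (auto simp: indicator_def)
    finally show ?thesis using c by (simp add: field_simps)
  qed
  then show ?thesis
    using LIMSEQ_le_const2[OF sums[unfolded sums_def]] by (auto simp: Un)
qed

text \<open>
  An \<open>L\<^sup>1\<close> approximation \<open>Z\<close> of \<open>X\<close> that is measurable at a finite stage is eventually reproduced
  exactly by conditioning, and the maximal inequality bounds the probability that the error
  \<open>\<bar>Z - X\<bar>\<close> ever becomes large after conditioning. Assuming such approximations, rather than
  measurability of \<open>X\<close> for the generated \<open>\<sigma>\<close>-algebra, fits variables that are only almost sure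
  limits of adapted ones.
\<close>

lemma levy_upward:
  fixes F :: "nat \<Rightarrow> 'a measure" and X :: "'a \<Rightarrow> real"
  assumes F: "\<And>n. subalgebra M (F n)" and mono: "\<And>m n. m \<le> n \<Longrightarrow> sets (F m) \<subseteq> sets (F n)"
    and X: "integrable M X"
    and approx: "\<And>e. 0 < e \<Longrightarrow> \<exists>m Z. Z \<in> borel_measurable (F m) \<and> integrable M Z \<and> (\<integral>x. \<bar>Z x - X x\<bar> \<partial>M) < e"
  shows "AE x in M. (\<lambda>n. real_cond_exp M (F n) X x) \<longlonglongrightarrow> X x"
proof -
  let ?E = "\<lambda>n. real_cond_exp M (F n)"
  have [measurable]: "X \<in> borel_measurable M" using X by auto
  have key: "AE x in M. \<exists>N. \<forall>n\<ge>N. \<bar>?E n X x - X x\<bar> \<le> 2 * c" if c: "0 < c" for c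
  proof -
    define D where "D = {x \<in> space M. \<not> (\<exists>N. \<forall>n\<ge>N. \<bar>?E n X x - X x\<bar> \<le> 2 * c)}"
    have [measurable]: "D \<in> sets M" unfolding D_def by measurable
    \<comment> \<open>the two halves of the error, \<open>E[U | F n]\<close> and \<open>U\<close>, each exceed \<open>c\<close> with probability at most \<open>e / c\<close>\<close>
    have small: "measure M D \<le> 2 * e / c" if e: "0 < e" for e
    proof -
      obtain m Z where Z: "Z \<in> borel_measurable (F m)" "integrable M Z"
        and Ze: "(\<integral>x. \<bar>Z x - X x\<bar> \<partial>M) < e" using approx[OF e] by blast
      define U where "U = (\<lambda>x. \<bar>Z x - X x\<bar>)"
      have U: "integrable M U" unfolding U_def using X Z by auto
      then have [measurable]: "U \<in> borel_measurable M" by auto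
      have bound: "AE x in M. \<bar>?E n X x - X x\<bar> \<le> ?E n U x + U x" if n: "m \<le> n" for n
      proof -
        interpret F: sigma_finite_subalgebra M "F n" by (rule sigma_finite_subalgebraI[OF F])
        have "Z \<in> borel_measurable (F n)"
          using Z(1) mono[OF n] F[of m] F[of n]
          by (auto simp: subalgebra_def intro: measurable_from_subalg[of "F n" "F m"])
        from F.real_cond_exp_F_meas[OF Z(2) this] F.real_cond_exp_diff[OF Z(2) X]
          real_cond_exp_abs_le[OF F Bochner_Integration.integrable_diff[OF Z(2) X], of n]
        show ?thesis unfolding U_def by eventually_elim linarith
      qed
      then have "AE x in M. \<forall>n. m \<le> n \<longrightarrow> \<bar>?E n X x - X x\<bar> \<le> ?E n U x + U x"
        by (simp add: AE_all_countable)
      then have "AE x in M. x \<in> D \<longrightarrow> x \<in> {x \<in> space M. \<exists>n. c < ?E n U x} \<union> {x \<in> space M. c \<le> U x}"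
      proof eventually_elim
        case (elim x)
        show ?case
        proof (rule impI, rule ccontr)
          assume x: "x \<in> D" "x \<notin> {x \<in> space M. \<exists>n. c < ?E n U x} \<union> {x \<in> space M. c \<le> U x}"
          then have "\<bar>?E n X x - X x\<bar> \<le> 2 * c" if "m \<le> n" for n
            using elim[rule_format, OF that] by (auto simp: D_def not_less not_le dest!: spec[of _ n])
          with x(1) show False by (auto simp: D_def)
        qed
      qed
      then have "measure M D \<le> measure M ({x \<in> space M. \<exists>n. c < ?E n U x} \<union> {x \<in> space M. c \<le> U x})"
        by (rule finite_measure_mono_AE) measurable
      also have "\<dots> \<le> measure M {x \<in> space M. \<exists>n. c < ?E n U x} + measure M {x \<in> space M. c \<le> U x}"
        by (rule measure_Un_le) measurable
      also have "\<dots> \<le> (\<integral>x. U x \<partial>M) / c + (\<integral>x. U x \<partial>M) / c"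
      proof (rule add_mono)
        show "measure M {x \<in> space M. \<exists>n. c < ?E n U x} \<le> (\<integral>x. U x \<partial>M) / c"
          by (rule maximal_inequality[OF F mono U _ c]) (auto simp: U_def)
        show "measure M {x \<in> space M. c \<le> U x} \<le> (\<integral>x. U x \<partial>M) / c"
          by (rule integral_Markov_inequality_measure[OF U, of "{}"]) (use c in \<open>auto simp: U_def\<close>)
      qed
      also have "\<dots> \<le> 2 * e / c"
        using Ze c by (simp add: U_def field_simps)
      finally show ?thesis .
    qed
    have "measure M D \<le> 0"
    proof (rule field_le_epsilon)
      fix e :: real assume "0 < e"
      with small[of "c * e / 2"] c show "measure M D \<le> 0 + e" by simp
    qed
    then have "D \<in> null_sets M" by (simp add: emeasure_eq_measure null_sets_def measure_le_0_iff)
    then show ?thesis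
      by (rule AE_I') (auto simp: D_def)
  qed
  have "AE x in M. \<forall>k. \<exists>N. \<forall>n\<ge>N. \<bar>?E n X x - X x\<bar> \<le> 2 * inverse (real (Suc k))"
    unfolding AE_all_countable using key by auto
  then show ?thesis
  proof eventually_elim
    case (elim x)
    show ?case
    proof (rule LIMSEQ_I)
      fix r :: real assume "0 < r"
      then obtain k where k: "inverse (real (Suc k)) < r / 2" using reals_Archimedean[of "r/2"] by auto
      from elim obtain N where "\<forall>n\<ge>N. \<bar>?E n X x - X x\<bar> \<le> 2 * inverse (real (Suc k))" by blast
      with k show "\<exists>N. \<forall>n\<ge>N. norm (?E n X x - X x) < r" by fastforce
    qed
  qed
qed

end

section \<open>Conditional expectations of random measures\<close>

definition integrable_random_measure :: "'a measure \<Rightarrow> 'b measure \<Rightarrow> ('a \<Rightarrow> 'b measure) \<Rightarrow> bool" where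
  "integrable_random_measure M N \<mu> \<longleftrightarrow>
     (\<forall>\<omega>\<in>space M. finite_measure (\<mu> \<omega>) \<and> sets (\<mu> \<omega>) = sets N) \<and>
     (\<forall>A\<in>sets N. (\<lambda>\<omega>. measure (\<mu> \<omega>) A) \<in> borel_measurable M) \<and>
     integrable M (\<lambda>\<omega>. measure (\<mu> \<omega>) (space N))"

lemma integrable_random_measureD:
  assumes "integrable_random_measure M N \<mu>"
  shows "\<omega> \<in> space M \<Longrightarrow> finite_measure (\<mu> \<omega>)" "\<omega> \<in> space M \<Longrightarrow> sets (\<mu> \<omega>) = sets N"
    "\<omega> \<in> space M \<Longrightarrow> space (\<mu> \<omega>) = space N"
    "A \<in> sets N \<Longrightarrow> (\<lambda>\<omega>. measure (\<mu> \<omega>) A) \<in> borel_measurable M"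
    "integrable M (\<lambda>\<omega>. measure (\<mu> \<omega>) (space N))"
  using assms by (auto simp: integrable_random_measure_def dest: sets_eq_imp_space_eq)

lemma random_measure_le_total:
  assumes "integrable_random_measure M N \<mu>" "\<omega> \<in> space M" "A \<in> sets N"
  shows "measure (\<mu> \<omega>) A \<le> measure (\<mu> \<omega>) (space N)"
  using integrable_random_measureD[OF assms(1)] assms(2,3)
  by (intro finite_measure.finite_measure_mono) (auto dest: sets.sets_into_space)

lemma integrable_random_measure_event:
  assumes "integrable_random_measure M N \<mu>" "A \<in> sets N"
  shows "integrable M (\<lambda>\<omega>. measure (\<mu> \<omega>) A)"
  by (rule Bochner_Integration.integrable_bound[OF integrable_random_measureD(5)[OF assms(1)]])
    (use integrable_random_measureD(4)[OF assms] random_measure_le_total[OF assms(1) _ assms(2)] in \<open>auto intro!: AE_I2\<close>)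

context prob_space
begin

lemma random_measure_cond_exp_compl:
  assumes F: "subalgebra M F" and \<mu>: "integrable_random_measure M N \<mu>" and A: "A \<in> sets N"
  shows "AE \<omega> in M. real_cond_exp M F (\<lambda>\<omega>. measure (\<mu> \<omega>) (space N - A)) \<omega>
    = real_cond_exp M F (\<lambda>\<omega>. measure (\<mu> \<omega>) (space N)) \<omega> - real_cond_exp M F (\<lambda>\<omega>. measure (\<mu> \<omega>) A) \<omega>"
proof -
  interpret F: sigma_finite_subalgebra M F by (rule sigma_finite_subalgebraI[OF F])
  note D = integrable_random_measureD[OF \<mu>]
  have "measure (\<mu> \<omega>) (space N - A) = measure (\<mu> \<omega>) (space N) - measure (\<mu> \<omega>) A" if "\<omega> \<in> space M" for \<omega>
    using finite_measure.finite_measure_compl[OF D(1)[OF that], of A] D(2,3)[OF that] A by simp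
  then have "AE \<omega> in M. real_cond_exp M F (\<lambda>\<omega>. measure (\<mu> \<omega>) (space N - A)) \<omega>
      = real_cond_exp M F (\<lambda>\<omega>. measure (\<mu> \<omega>) (space N) - measure (\<mu> \<omega>) A) \<omega>"
    using A D(4)[OF sets.top] D(4)[OF A] D(4)[OF sets.compl_sets[OF A]]
    by (intro F.real_cond_exp_cong AE_I2 borel_measurable_diff) auto
  with F.real_cond_exp_diff[OF D(5) integrable_random_measure_event[OF \<mu> A]]
  show ?thesis by eventually_elim simp
qed

lemma random_measure_L1_union:
  assumes \<mu>: "integrable_random_measure M N \<mu>" and X: "range X \<subseteq> sets N" "disjoint_family X"
  shows "(\<lambda>n. \<integral>\<omega>. \<bar>(\<Sum>i<n. measure (\<mu> \<omega>) (X i)) - measure (\<mu> \<omega>) (\<Union>i. X i)\<bar> \<partial>M) \<longlonglongrightarrow> 0"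
proof (rule dominated_L1_convergence(2)[where w = "\<lambda>\<omega>. measure (\<mu> \<omega>) (space N)"])
  note D = integrable_random_measureD[OF \<mu>]
  have XN: "X i \<in> sets N" for i using X(1) by auto
  show "(\<lambda>\<omega>. \<Sum>i<n. measure (\<mu> \<omega>) (X i)) \<in> borel_measurable M" for n
    by (intro borel_measurable_sum D(4) XN)
  show "(\<lambda>\<omega>. measure (\<mu> \<omega>) (\<Union>i. X i)) \<in> borel_measurable M"
    by (intro D(4) sets.countable_UN X(1))
  show "AE \<omega> in M. (\<lambda>n. \<Sum>i<n. measure (\<mu> \<omega>) (X i)) \<longlonglongrightarrow> measure (\<mu> \<omega>) (\<Union>i. X i)"
  proof (rule AE_I2)
    fix \<omega> assume w: "\<omega> \<in> space M"
    have "range X \<subseteq> sets (\<mu> \<omega>)" using X(1) D(2)[OF w] by simp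
    from finite_measure.finite_measure_UNION[OF D(1)[OF w] this X(2)]
    show "(\<lambda>n. \<Sum>i<n. measure (\<mu> \<omega>) (X i)) \<longlonglongrightarrow> measure (\<mu> \<omega>) (\<Union>i. X i)" by (simp add: sums_def)
  qed
  show "AE \<omega> in M. \<bar>\<Sum>i<n. measure (\<mu> \<omega>) (X i)\<bar> \<le> measure (\<mu> \<omega>) (space N)" for n
  proof (rule AE_I2)
    fix \<omega> assume w: "\<omega> \<in> space M"
    have "(\<Sum>i<n. measure (\<mu> \<omega>) (X i)) = measure (\<mu> \<omega>) (\<Union>i<n. X i)"
      using X XN D(2)[OF w]
      by (intro finite_measure.finite_measure_finite_Union[OF D(1)[OF w], symmetric]) (auto simp: disjoint_family_on_def)
    also have "\<dots> \<le> measure (\<mu> \<omega>) (space N)"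
      using XN by (intro random_measure_le_total[OF \<mu> w]) auto
    finally show "\<bar>\<Sum>i<n. measure (\<mu> \<omega>) (X i)\<bar> \<le> measure (\<mu> \<omega>) (space N)" by (simp add: sum_nonneg)
  qed
qed (rule integrable_random_measureD(5)[OF \<mu>])

text \<open>
  Two random measures have the same conditional expectation on every event as soon as they do on
  a generating \<open>\<pi>\<close>-system and on the whole space. The whole space is required separately because
  it need not belong to the \<open>\<pi>\<close>-system.
\<close>

lemma random_measure_cond_exp_eqI:
  assumes F: "subalgebra M F"
    and \<mu>: "integrable_random_measure M N \<mu>" and \<nu>: "integrable_random_measure M N \<nu>"
    and E: "Int_stable E" "E \<subseteq> Pow (space N)" "sets N = sigma_sets (space N) E"
    and eq: "\<And>A. A \<in> insert (space N) E \<Longrightarrow> AE \<omega> in M. real_cond_exp M F (\<lambda>\<omega>. measure (\<mu> \<omega>) A) \<omega>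
      = real_cond_exp M F (\<lambda>\<omega>. measure (\<nu> \<omega>) A) \<omega>"
    and A: "A \<in> sets N"
  shows "AE \<omega> in M. real_cond_exp M F (\<lambda>\<omega>. measure (\<mu> \<omega>) A) \<omega> = real_cond_exp M F (\<lambda>\<omega>. measure (\<nu> \<omega>) A) \<omega>"
proof -
  interpret F: sigma_finite_subalgebra M F by (rule sigma_finite_subalgebraI[OF F])
  from A have "A \<in> sigma_sets (space N) E" by (simp add: E(3)[symmetric])
  from E(1,2) this show ?thesis
  proof (induction rule: sigma_sets_induct_disjoint)
    case (basic A) then show ?case by (intro eq) auto
  next
    case empty show ?case by simp
  next
    case (compl A)
    then have A: "A \<in> sets N" by (simp add: E(3))
    have "AE \<omega> in M. real_cond_exp M F (\<lambda>\<omega>. measure (\<mu> \<omega>) (space N)) \<omega>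
      = real_cond_exp M F (\<lambda>\<omega>. measure (\<nu> \<omega>) (space N)) \<omega>" by (rule eq) simp
    with random_measure_cond_exp_compl[OF F \<mu> A] random_measure_cond_exp_compl[OF F \<nu> A] compl(2)
    show ?case by eventually_elim simp
  next
    case (union X)
    have X: "range X \<subseteq> sets N" "disjoint_family X" using union(1,2) by (auto simp: E(3))
    have XN: "X i \<in> sets N" for i using X(1) by auto
    note i\<mu> = integrable_random_measure_event[OF \<mu> XN] and i\<nu> = integrable_random_measure_event[OF \<nu> XN]
    have "AE \<omega> in M. \<forall>i. real_cond_exp M F (\<lambda>\<omega>. measure (\<mu> \<omega>) (X i)) \<omega> = real_cond_exp M F (\<lambda>\<omega>. measure (\<nu> \<omega>) (X i)) \<omega>"
      unfolding AE_all_countable using union(3) by auto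
    then have "AE \<omega> in M. real_cond_exp M F (\<lambda>\<omega>. \<Sum>i<n. measure (\<mu> \<omega>) (X i)) \<omega>
        = real_cond_exp M F (\<lambda>\<omega>. \<Sum>i<n. measure (\<nu> \<omega>) (X i)) \<omega>" for n
      using F.real_cond_exp_sum[of "\<lambda>i \<omega>. measure (\<mu> \<omega>) (X i)" "{..<n}", OF i\<mu>]
        F.real_cond_exp_sum[of "\<lambda>i \<omega>. measure (\<nu> \<omega>) (X i)" "{..<n}", OF i\<nu>]
      by eventually_elim simp
    then show ?case
      by (rule real_cond_exp_eq_L1_limit[OF F F
            Bochner_Integration.integrable_sum[OF i\<mu>] integrable_random_measure_event[OF \<mu> sets.countable_UN[OF X(1)]]
            random_measure_L1_union[OF \<mu> X]
            Bochner_Integration.integrable_sum[OF i\<nu>] integrable_random_measure_event[OF \<nu> sets.countable_UN[OF X(1)]]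
            random_measure_L1_union[OF \<nu> X]])
  qed
qed

end

section \<open>Words, cylinders and the uniform measure\<close>

definition generation :: "nat \<Rightarrow> nat \<Rightarrow> nat list set" where
  "generation b n = {\<gamma> \<in> tree_words b. length \<gamma> = n}"

lemma generation_subset: "generation b n \<subseteq> tree_words b"
  by (auto simp: generation_def)

lemma length_generation: "\<gamma> \<in> generation b n \<Longrightarrow> length \<gamma> = n"
  by (simp add: generation_def)

lemma generation_alt: "generation b n = {\<gamma>. set \<gamma> \<subseteq> {..<b} \<and> length \<gamma> = n}"
  by (auto simp: generation_def tree_words_def lists_eq_set)

lemma finite_generation [simp, intro]: "finite (generation b n)"
  unfolding generation_alt by (rule finite_lists_length_eq) simp

lemma card_generation: "card (generation b n) = b ^ n"
  unfolding generation_alt by (subst card_lists_length_eq) auto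

lemma take_tree_words: "\<gamma> \<in> tree_words b \<Longrightarrow> take j \<gamma> \<in> tree_words b"
  by (auto simp: tree_words_def lists_eq_set dest: in_set_takeD)

lemma append_tree_words: "\<gamma> @ \<eta> \<in> tree_words b \<longleftrightarrow> \<gamma> \<in> tree_words b \<and> \<eta> \<in> tree_words b"
  by (auto simp: tree_words_def)

lemma length_prefix_of [simp]: "length (prefix_of t n) = n"
  by (simp add: prefix_of_def)

lemma take_prefix_of: "j \<le> n \<Longrightarrow> take j (prefix_of t n) = prefix_of t j"
  by (simp add: prefix_of_def take_map)

lemma prefix_of_in_tree_words: "t \<in> tree_boundary b \<Longrightarrow> prefix_of t n \<in> tree_words b"
  by (auto simp: prefix_of_def tree_words_def tree_boundary_def)

lemma prefix_of_in_generation: "t \<in> tree_boundary b \<Longrightarrow> prefix_of t n \<in> generation b n"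
  by (simp add: generation_def prefix_of_in_tree_words)

lemma boundary_point_exists:
  assumes "0 < b" "\<gamma> \<in> tree_words b"
  shows "\<exists>t\<in>tree_boundary b. prefix_of t (length \<gamma>) = \<gamma>"
proof
  \<comment> \<open>the letter \<open>0\<close> exists because the alphabet is nonempty\<close>
  let ?t = "\<lambda>i. if i < length \<gamma> then \<gamma> ! i else 0"
  show "?t \<in> tree_boundary b"
    using assms by (auto simp: tree_boundary_def tree_words_def in_lists_conv_set)
  show "prefix_of ?t (length \<gamma>) = \<gamma>"
    by (auto simp: prefix_of_def intro!: nth_equalityI)
qed

lemma mem_cylinder_iff: "t \<in> cylinder b \<gamma> \<longleftrightarrow> t \<in> tree_boundary b \<and> (\<forall>i<length \<gamma>. t i = \<gamma> ! i)"
proof -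
  have "map t [0..<length \<gamma>] = \<gamma> \<longleftrightarrow> (\<forall>i<length \<gamma>. t i = \<gamma> ! i)"
    by (subst list_eq_iff_nth_eq) simp
  then show ?thesis by (simp add: cylinder_def prefix_of_def)
qed

lemma cylinder_append_subset: "cylinder b (\<gamma> @ \<eta>) \<subseteq> cylinder b \<gamma>"
proof
  fix t assume t: "t \<in> cylinder b (\<gamma> @ \<eta>)"
  then have "t i = \<gamma> ! i" if "i < length \<gamma>" for i
    using that by (auto simp: mem_cylinder_iff nth_append dest!: spec[of _ i])
  with t show "t \<in> cylinder b \<gamma>" by (simp add: mem_cylinder_iff)
qed

lemma cylinder_Int_same_generation:
  "\<gamma> \<in> generation b n \<Longrightarrow> \<delta> \<in> generation b n \<Longrightarrow> \<gamma> \<noteq> \<delta> \<Longrightarrow> cylinder b \<gamma> \<inter> cylinder b \<delta> = {}"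
  by (auto simp: cylinder_def generation_def)

lemma cylinder_Int_append:
  assumes "\<gamma> \<in> tree_words b" "\<delta> \<in> generation b (length \<gamma> + k)"
  shows "cylinder b \<gamma> \<inter> cylinder b \<delta> = (if take (length \<gamma>) \<delta> = \<gamma> then cylinder b \<delta> else {})"
proof -
  have "prefix_of t (length \<gamma>) = take (length \<gamma>) \<delta>" if "t \<in> cylinder b \<delta>" for t
    using that assms take_prefix_of[of "length \<gamma>" "length \<delta>" t] by (auto simp: cylinder_def generation_def)
  then show ?thesis by (auto simp: cylinder_def)
qed

lemma generation_descendants:
  assumes "\<gamma> \<in> tree_words b"
  shows "{\<delta> \<in> generation b (length \<gamma> + k). take (length \<gamma>) \<delta> = \<gamma>} = (\<lambda>\<eta>. \<gamma> @ \<eta>) ` generation b k"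
proof safe
  fix \<delta> assume d: "\<delta> \<in> generation b (length \<gamma> + k)" "take (length \<gamma>) \<delta> = \<gamma>"
  then have "\<delta> = \<gamma> @ drop (length \<gamma>) \<delta>" by (metis append_take_drop_id)
  moreover from this d have "drop (length \<gamma>) \<delta> \<in> generation b k"
    by (auto simp: generation_def) (metis append_tree_words)
  ultimately show "\<delta> \<in> (@) \<gamma> ` generation b k" by (rule image_eqI)
qed (use assms in \<open>auto simp: generation_def append_tree_words\<close>)

lemma sets_cylinder [measurable]: "cylinder b \<gamma> \<in> sets (tree_measure b)"
proof -
  have [measurable]: "(\<lambda>t. t i) \<in> tree_measure b \<rightarrow>\<^sub>M uniform_count_measure {..<b}" for i
    unfolding tree_measure_def by (rule measurable_component_singleton) simp
  have [measurable]: "Measurable.pred (uniform_count_measure {..<b}) (\<lambda>k. k = c)" for c :: nat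
    by (auto simp: measurable_def sets_uniform_count_measure space_uniform_count_measure)
  have [measurable]: "Measurable.pred (tree_measure b) (\<lambda>t. t i = c)" for i c by measurable
  have "cylinder b \<gamma> = {t \<in> space (tree_measure b). \<forall>i<length \<gamma>. t i = \<gamma> ! i}"
    by (auto simp: mem_cylinder_iff space_tree_measure)
  also have "\<dots> \<in> sets (tree_measure b)" by measurable
  finally show ?thesis .
qed

lemma measure_cylinder:
  assumes "0 < b" and g: "\<gamma> \<in> tree_words b"
  shows "measure (tree_measure b) (cylinder b \<gamma>) = 1 / real b ^ length \<gamma>"
proof -
  interpret product_prob_space "\<lambda>_. uniform_count_measure {..<b}" UNIV
    using assms by (intro product_prob_spaceI prob_space_uniform_count_measure) auto
  let ?X = "\<lambda>i. {\<gamma> ! i}"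
  have X: "?X i \<subseteq> {..<b}" if "i < length \<gamma>" for i
    using g that by (auto simp: tree_words_def in_lists_conv_set)
  have "cylinder b \<gamma> = prod_emb UNIV (\<lambda>_. uniform_count_measure {..<b}) {..<length \<gamma>} (Pi\<^sub>E {..<length \<gamma>} ?X)"
    by (auto simp: mem_cylinder_iff prod_emb_def tree_boundary_def space_uniform_count_measure
        space_PiM PiE_iff)
  then have "measure (tree_measure b) (cylinder b \<gamma>)
      = (\<Prod>i<length \<gamma>. measure (uniform_count_measure {..<b}) (?X i))"
    unfolding tree_measure_def using X
    by (simp only:) (rule measure_PiM_emb, auto simp: sets_uniform_count_measure)
  also have "\<dots> = (\<Prod>i<length \<gamma>. 1 / real b)"
    using X by (intro prod.cong) (auto simp: measure_uniform_count_measure)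
  finally show ?thesis by (simp add: power_one_over)
qed

lemma prob_space_tree_measure: "0 < b \<Longrightarrow> prob_space (tree_measure b)"
  unfolding tree_measure_def by (intro prob_space_PiM prob_space_uniform_count_measure) auto

lemma sum_cylinder_split:
  fixes \<mu> :: "(nat \<Rightarrow> nat) measure"
  assumes "finite_measure \<mu>" and s: "sets \<mu> = sets (tree_measure b)" and g: "\<gamma> \<in> tree_words b"
  shows "measure \<mu> (cylinder b \<gamma>) = (\<Sum>\<eta>\<in>generation b k. measure \<mu> (cylinder b (\<gamma> @ \<eta>)))"
proof -
  interpret finite_measure \<mu> by fact
  have "cylinder b \<gamma> = (\<Union>\<eta>\<in>generation b k. cylinder b (\<gamma> @ \<eta>))"
  proof safe
    fix t assume t: "t \<in> cylinder b \<gamma>"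
    have "take (length \<gamma>) (prefix_of t (length \<gamma> + k)) = \<gamma>"
      using t by (simp add: take_prefix_of cylinder_def)
    moreover have "prefix_of t (length \<gamma> + k) \<in> generation b (length \<gamma> + k)"
      using t by (auto simp: cylinder_def intro: prefix_of_in_generation)
    ultimately obtain \<eta> where "prefix_of t (length \<gamma> + k) = \<gamma> @ \<eta>" "\<eta> \<in> generation b k"
      using generation_descendants[OF g, of k] by blast
    with t show "t \<in> (\<Union>\<eta>\<in>generation b k. cylinder b (\<gamma> @ \<eta>))"
      by (auto simp: cylinder_def length_generation intro!: bexI[of _ \<eta>])
  qed (use cylinder_append_subset in blast)
  moreover have "disjoint_family_on (\<lambda>\<eta>. cylinder b (\<gamma> @ \<eta>)) (generation b k)"
    using g by (auto simp: disjoint_family_on_def cylinder_def generation_def)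
  ultimately show ?thesis
    by (simp add: finite_measure_finite_Union s image_subset_iff)
qed

text \<open>
  The lower bound \<open>N\<close> on the length is free because every cylinder is a finite union of longer
  ones. Conditioning on generation \<open>N\<close> is easiest to describe on cylinders of length at least \<open>N\<close>.
\<close>

lemma sigma_sets_cylinder:
  "sets (tree_measure b) = sigma_sets (tree_boundary b) (insert {} {cylinder b \<gamma> | \<gamma>. \<gamma> \<in> tree_words b \<and> N \<le> length \<gamma>})"
    (is "_ = sigma_sets ?T ?C")
proof
  have C: "?C \<subseteq> sets (tree_measure b)" by auto
  then show "sigma_sets ?T ?C \<subseteq> sets (tree_measure b)"
    using sets.sigma_sets_subset[of ?C "tree_measure b"] by (simp add: space_tree_measure)
  have CT: "?C \<subseteq> Pow ?T" by (auto simp: cylinder_def)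
  interpret S: sigma_algebra ?T "sigma_sets ?T ?C" by (rule sigma_algebra_sigma_sets[OF CT])
  have sp: "space (sigma ?T ?C) = ?T" "sets (sigma ?T ?C) = sigma_sets ?T ?C"
    using CT by (simp_all add: space_measure_of sets_measure_of)
  have "(\<lambda>t. t) \<in> sigma ?T ?C \<rightarrow>\<^sub>M tree_measure b"
    unfolding tree_measure_def
  proof (rule measurable_PiM_single')
    fix i
    show "(\<lambda>t. t i) \<in> sigma ?T ?C \<rightarrow>\<^sub>M uniform_count_measure {..<b}"
    proof (rule measurableI)
      fix A assume "A \<in> sets (uniform_count_measure {..<b})"
      define n where "n = max N (Suc i)"
      have "(\<lambda>t. t i) -` A \<inter> space (sigma ?T ?C) = (\<Union>\<gamma>\<in>{\<gamma> \<in> generation b n. \<gamma> ! i \<in> A}. cylinder b \<gamma>)"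
      proof safe
        fix t assume "t i \<in> A" "t \<in> space (sigma ?T ?C)"
        then have t: "t \<in> tree_boundary b" "t i \<in> A" by (auto simp: sp)
        then show "t \<in> (\<Union>\<gamma>\<in>{\<gamma> \<in> generation b n. \<gamma> ! i \<in> A}. cylinder b \<gamma>)"
          using prefix_of_in_generation[OF t(1), of n]
          by (intro UN_I[of "prefix_of t n"]) (auto simp: cylinder_def prefix_of_def n_def)
      qed (auto simp: sp mem_cylinder_iff generation_def n_def)
      also have "\<dots> \<in> sigma_sets ?T ?C"
      proof (rule S.finite_UN)
        show "finite {\<gamma> \<in> generation b n. \<gamma> ! i \<in> A}" by simp
      qed (auto simp: generation_def n_def intro!: sigma_sets.Basic)
      finally show "(\<lambda>t. t i) -` A \<inter> space (sigma ?T ?C) \<in> sets (sigma ?T ?C)" by (simp only: sp)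
    qed (simp add: space_uniform_count_measure sp, simp add: tree_boundary_def)
  qed (unfold sp space_uniform_count_measure, auto simp: tree_boundary_def)
  note id = this
  show "sets (tree_measure b) \<subseteq> sigma_sets ?T ?C"
  proof
    fix A assume A: "A \<in> sets (tree_measure b)"
    then have "A \<inter> ?T = A" using sets.sets_into_space[OF A] by (auto simp: space_tree_measure)
    with measurable_sets[OF id A] show "A \<in> sigma_sets ?T ?C" by (simp add: sp)
  qed
qed

lemma cylinder_Int_cylinder:
  "cylinder b \<gamma> \<inter> cylinder b \<delta> \<in> {{}, cylinder b \<gamma>, cylinder b \<delta>}"
proof -
  have "cylinder b \<gamma> \<inter> cylinder b \<delta> \<in> {{}, cylinder b \<delta>}" if "length \<gamma> \<le> length \<delta>" for \<gamma> \<delta>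
  proof -
    have "prefix_of t (length \<gamma>) = take (length \<gamma>) \<delta>" if "t \<in> cylinder b \<delta>" for t
      using that \<open>length \<gamma> \<le> length \<delta>\<close> take_prefix_of[of "length \<gamma>" "length \<delta>" t] by (auto simp: cylinder_def)
    then show ?thesis by (cases "take (length \<gamma>) \<delta> = \<gamma>") (auto simp: cylinder_def)
  qed
  from this[of \<gamma> \<delta>] this[of \<delta> \<gamma>] show ?thesis by (cases "length \<gamma> \<le> length \<delta>") (auto simp: Int_commute)
qed

lemma Int_stable_cylinder:
  "Int_stable (insert {} {cylinder b \<gamma> | \<gamma>. \<gamma> \<in> tree_words b \<and> N \<le> length \<gamma>})"
proof (rule Int_stableI)
  let ?C = "insert {} {cylinder b \<gamma> | \<gamma>. \<gamma> \<in> tree_words b \<and> N \<le> length \<gamma>}"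
  fix A B assume AB: "A \<in> ?C" "B \<in> ?C"
  have "A \<inter> B \<in> {{}, A, B}"
  proof (cases "A = {} \<or> B = {}")
    case False
    with AB obtain \<gamma> \<delta> where "A = cylinder b \<gamma>" "B = cylinder b \<delta>" by blast
    then show ?thesis using cylinder_Int_cylinder by metis
  qed auto
  with AB show "A \<inter> B \<in> ?C" by (elim insertE) auto
qed

lemma prefix_dependent_measurable:
  fixes g :: "nat list \<Rightarrow> real"
  shows "(\<lambda>t. g (prefix_of t n)) \<in> borel_measurable (tree_measure b)"
proof -
  have "(\<lambda>t. \<Sum>\<gamma>\<in>generation b n. g \<gamma> * indicator (cylinder b \<gamma>) t) \<in> borel_measurable (tree_measure b)"
    by measurable
  moreover have "(\<Sum>\<gamma>\<in>generation b n. g \<gamma> * indicator (cylinder b \<gamma>) t) = g (prefix_of t n)"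
    if "t \<in> space (tree_measure b)" for t
  proof -
    from that have t: "t \<in> tree_boundary b" by (simp add: space_tree_measure)
    have "(\<Sum>\<gamma>\<in>generation b n. g \<gamma> * indicator (cylinder b \<gamma>) t)
        = (\<Sum>\<gamma>\<in>generation b n. if \<gamma> = prefix_of t n then g \<gamma> else 0)"
      using t by (intro sum.cong) (auto simp: cylinder_def indicator_def generation_def)
    then show ?thesis using prefix_of_in_generation[OF t, of n] by simp
  qed
  ultimately show ?thesis by (subst measurable_cong[symmetric]) auto
qed

text \<open>
  A process that depends on \<open>t\<close> only through its prefix of length \<open>n\<close> has a density that is constant
  on the cylinders of generation \<open>n\<close>.
\<close>

lemma measure_process_measure:
  assumes b: "0 < b" and Q: "\<And>t. t \<in> tree_boundary b \<Longrightarrow> Q n t \<omega> = g (prefix_of t n)"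
    and g: "\<And>\<gamma>. \<gamma> \<in> generation b n \<Longrightarrow> 0 \<le> g \<gamma>" and A: "A \<in> sets (tree_measure b)"
  shows "finite_measure (process_measure b Q n \<omega>)"
    and "measure (process_measure b Q n \<omega>) A
      = (\<Sum>\<gamma>\<in>generation b n. g \<gamma> * measure (tree_measure b) (A \<inter> cylinder b \<gamma>))"
proof -
  interpret prob_space "tree_measure b" by (rule prob_space_tree_measure[OF b])
  have Qm [measurable]: "(\<lambda>t. Q n t \<omega>) \<in> borel_measurable (tree_measure b)"
    using prefix_dependent_measurable[of g n b]
    by (subst measurable_cong[where g = "\<lambda>t. g (prefix_of t n)"]) (auto simp: Q space_tree_measure)
  have main: "emeasure (process_measure b Q n \<omega>) A
      = ennreal (\<Sum>\<gamma>\<in>generation b n. g \<gamma> * measure (tree_measure b) (A \<inter> cylinder b \<gamma>))"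
    if [measurable]: "A \<in> sets (tree_measure b)" for A
  proof -
    have "emeasure (process_measure b Q n \<omega>) A = (\<integral>\<^sup>+t. ennreal (Q n t \<omega>) * indicator A t \<partial>tree_measure b)"
      unfolding process_measure_def by (rule emeasure_density) measurable
    also have "\<dots> = (\<integral>\<^sup>+t. (\<Sum>\<gamma>\<in>generation b n. ennreal (g \<gamma>) * indicator (A \<inter> cylinder b \<gamma>) t) \<partial>tree_measure b)"
    proof (rule nn_integral_cong)
      fix t assume "t \<in> space (tree_measure b)"
      then have t: "t \<in> tree_boundary b" by (simp add: space_tree_measure)
      have "(\<Sum>\<gamma>\<in>generation b n. ennreal (g \<gamma>) * indicator (A \<inter> cylinder b \<gamma>) t)
          = (\<Sum>\<gamma>\<in>generation b n. if \<gamma> = prefix_of t n then ennreal (g \<gamma>) * indicator A t else 0)"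
        using t by (intro sum.cong) (auto simp: cylinder_def indicator_def generation_def)
      then show "ennreal (Q n t \<omega>) * indicator A t
          = (\<Sum>\<gamma>\<in>generation b n. ennreal (g \<gamma>) * indicator (A \<inter> cylinder b \<gamma>) t)"
        using prefix_of_in_generation[OF t, of n] by (simp add: Q[OF t])
    qed
    also have "\<dots> = (\<Sum>\<gamma>\<in>generation b n. ennreal (g \<gamma>) * emeasure (tree_measure b) (A \<inter> cylinder b \<gamma>))"
      by (subst nn_integral_sum) (auto simp: nn_integral_cmult_indicator)
    also have "\<dots> = (\<Sum>\<gamma>\<in>generation b n. ennreal (g \<gamma> * measure (tree_measure b) (A \<inter> cylinder b \<gamma>)))"
      by (intro sum.cong) (auto simp: emeasure_eq_measure ennreal_mult g)
    also have "\<dots> = ennreal (\<Sum>\<gamma>\<in>generation b n. g \<gamma> * measure (tree_measure b) (A \<inter> cylinder b \<gamma>))"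
      by (intro sum_ennreal) (auto simp: g)
    finally show ?thesis .
  qed
  have sp: "space (process_measure b Q n \<omega>) = tree_boundary b"
    by (simp add: process_measure_def space_tree_measure)
  show "finite_measure (process_measure b Q n \<omega>)"
    by (rule finite_measureI) (use main[of "tree_boundary b"] sets.top[of "tree_measure b"]
      in \<open>simp add: sp space_tree_measure\<close>)
  show "measure (process_measure b Q n \<omega>) A
      = (\<Sum>\<gamma>\<in>generation b n. g \<gamma> * measure (tree_measure b) (A \<inter> cylinder b \<gamma>))"
    unfolding measure_def[of "process_measure b Q n \<omega>"] main[OF A]
    by (intro enn2real_ennreal sum_nonneg) (auto simp: g)
qed

lemma measure_process_measure_cylinder:
  assumes b: "0 < b" and Q: "\<And>t. t \<in> tree_boundary b \<Longrightarrow> Q (length \<gamma> + k) t \<omega> = g (prefix_of t (length \<gamma> + k))"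
    and g: "\<And>\<delta>. \<delta> \<in> generation b (length \<gamma> + k) \<Longrightarrow> 0 \<le> g \<delta>" and w: "\<gamma> \<in> tree_words b"
  shows "measure (process_measure b Q (length \<gamma> + k) \<omega>) (cylinder b \<gamma>)
      = (\<Sum>\<eta>\<in>generation b k. g (\<gamma> @ \<eta>) * measure (tree_measure b) (cylinder b (\<gamma> @ \<eta>)))"
proof -
  have "measure (process_measure b Q (length \<gamma> + k) \<omega>) (cylinder b \<gamma>)
      = (\<Sum>\<delta>\<in>generation b (length \<gamma> + k). g \<delta> * measure (tree_measure b) (cylinder b \<gamma> \<inter> cylinder b \<delta>))"
    by (rule measure_process_measure(2)[where g = g]) (auto simp: b Q g)
  also have "\<dots> = (\<Sum>\<delta>\<in>{\<delta> \<in> generation b (length \<gamma> + k). take (length \<gamma>) \<delta> = \<gamma>}.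
      g \<delta> * measure (tree_measure b) (cylinder b \<delta>))"
    by (rule sum.mono_neutral_cong_right) (auto simp: cylinder_Int_append[OF w] split: if_splits)
  also have "\<dots> = (\<Sum>\<eta>\<in>generation b k. g (\<gamma> @ \<eta>) * measure (tree_measure b) (cylinder b (\<gamma> @ \<eta>)))"
    unfolding generation_descendants[OF w] by (subst sum.reindex) (auto simp: inj_on_def)
  finally show ?thesis .
qed

section \<open>Weak convergence on the boundary\<close>

lemma compact_tree_boundary: "compact (tree_boundary b)"
proof -
  have "tree_boundary b = Pi\<^sub>E UNIV (\<lambda>_. {..<b})"
    by (auto simp: tree_boundary_def)
  moreover have "compactin (product_topology (\<lambda>_. euclidean :: nat topology) (UNIV :: nat set)) (Pi\<^sub>E UNIV (\<lambda>_. {..<b}))"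
    unfolding compactin_PiE by (auto intro: finite_imp_compact)
  ultimately show ?thesis by (simp add: euclidean_product_topology)
qed

lemma open_coordinate_cylinder: "open {s :: nat \<Rightarrow> nat. \<forall>i<n. s i = u i}"
proof -
  have "open ((\<lambda>s :: nat \<Rightarrow> nat. s i) -` {u i})" for i
    by (rule open_vimage[OF Topological_Spaces.discrete_topology_class.open_discrete continuous_on_product_coordinates])
  then have "open (\<Inter>i\<in>{..<n}. (\<lambda>s :: nat \<Rightarrow> nat. s i) -` {u i})" by (intro open_INT) auto
  also have "(\<Inter>i\<in>{..<n}. (\<lambda>s :: nat \<Rightarrow> nat. s i) -` {u i}) = {s. \<forall>i<n. s i = u i}" by auto
  finally show ?thesis .
qed

text \<open>
  A basic open set of the product topology restricts finitely many coordinates, hence is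
  controlled by an initial segment of them.
\<close>

lemma open_contains_coordinate_cylinder:
  assumes "open U" "t \<in> U"
  obtains n where "{s :: nat \<Rightarrow> nat. \<forall>i<n. s i = t i} \<subseteq> U"
proof -
  have "openin (product_topology (\<lambda>_. euclidean :: nat topology) UNIV) U"
    using assms(1) by (simp add: open_fun_def)
  from product_topology_open_contains_basis[OF this assms(2)]
  obtain X where X: "t \<in> Pi\<^sub>E UNIV X" "finite {i. X i \<noteq> topspace (euclidean :: nat topology)}"
    "Pi\<^sub>E UNIV X \<subseteq> U"
    by blast
  from finite_nat_set_iff_bounded[THEN iffD1, OF X(2)]
  obtain n where n: "\<And>i. X i \<noteq> UNIV \<Longrightarrow> i < n" by auto
  have "{s. \<forall>i<n. s i = t i} \<subseteq> Pi\<^sub>E UNIV X"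
  proof
    fix s assume s: "s \<in> {s. \<forall>i<n. s i = t i}"
    have "s i \<in> X i" for i
    proof (cases "X i = UNIV")
      case False
      with n s have "s i = t i" by auto
      with X(1) show ?thesis by auto
    qed auto
    then show "s \<in> Pi\<^sub>E UNIV X" by auto
  qed
  with X(3) show ?thesis by (intro that[of n]) auto
qed

text \<open>
  Uniform continuity on the compact boundary, phrased with cylinders in place of a metric: a
  finite subcover by cylinders of small oscillation has a maximal length, and prefixes of that
  length decide membership in all of them.
\<close>

lemma continuous_oscillation_on_cylinders:
  fixes f :: "(nat \<Rightarrow> nat) \<Rightarrow> real"
  assumes f: "continuous_on (tree_boundary b) f" and e: "0 < e"
  obtains n where "\<And>s t. s \<in> tree_boundary b \<Longrightarrow> t \<in> tree_boundary b \<Longrightarrow>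
    prefix_of s n = prefix_of t n \<Longrightarrow> \<bar>f s - f t\<bar> < e"
proof -
  let ?T = "tree_boundary b"
  let ?U = "\<lambda>(t, n). {s :: nat \<Rightarrow> nat. \<forall>i<n. s i = t i}"
  define C where "C = {(t, n) | t n. t \<in> ?T \<and> (\<forall>s\<in>?T. (\<forall>i<n. s i = t i) \<longrightarrow> \<bar>f s - f t\<bar> < e / 2)}"
  have "?T \<subseteq> (\<Union>c\<in>C. ?U c)"
  proof
    fix t assume t: "t \<in> ?T"
    have "open (ball (f t) (e/2))" by simp
    with f obtain V where V: "open V" "V \<inter> ?T = f -` ball (f t) (e/2) \<inter> ?T"
      unfolding continuous_on_open_invariant by blast
    have "t \<in> f -` ball (f t) (e/2) \<inter> ?T" using t e by simp
    with V have "t \<in> V" by blast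
    from open_contains_coordinate_cylinder[OF V(1) this]
    obtain n where n: "{s. \<forall>i<n. s i = t i} \<subseteq> V" by blast
    have "\<bar>f s - f t\<bar> < e / 2" if "s \<in> ?T" "\<forall>i<n. s i = t i" for s
    proof -
      have "s \<in> f -` ball (f t) (e/2)" using n V(2) that by blast
      then show ?thesis by (simp add: dist_real_def abs_minus_commute)
    qed
    with t have "(t, n) \<in> C" by (auto simp: C_def)
    then show "t \<in> (\<Union>c\<in>C. ?U c)" by (intro UN_I[of "(t, n)"]) auto
  qed
  then obtain C' where C': "C' \<subseteq> C" "finite C'" "?T \<subseteq> (\<Union>c\<in>C'. ?U c)"
    by (rule compactE_image[OF compact_tree_boundary, rotated])
      (auto simp: C_def open_coordinate_cylinder)
  from finite_nat_set_iff_bounded_le[THEN iffD1, of "snd ` C'"] C'(2)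
  obtain n where n: "\<And>c. c \<in> C' \<Longrightarrow> snd c \<le> n" by auto
  show ?thesis
  proof (rule that[of n])
    fix s t assume st: "s \<in> ?T" "t \<in> ?T" "prefix_of s n = prefix_of t n"
    have eq: "s i = t i" if "i < n" for i
      using arg_cong[OF st(3), of "\<lambda>xs. xs ! i"] that by (simp add: prefix_of_def)
    from st(1) C'(3) obtain u m where um: "(u, m) \<in> C'" "\<forall>i<m. s i = u i" by force
    with n[OF um(1)] eq have "\<forall>i<m. t i = u i" by (metis less_le_trans snd_conv)
    with um C'(1) st(1,2) have "\<bar>f s - f u\<bar> < e / 2" "\<bar>f t - f u\<bar> < e / 2" by (auto simp: C_def)
    then show "\<bar>f s - f t\<bar> < e" by linarith
  qed
qed

text \<open>
  Cylinders are both open and closed, so their indicators are continuous.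
\<close>

lemma weakly_converges_imp_cylinder:
  assumes w: "weakly_converges b \<mu> \<nu>"
  shows "(\<lambda>n. measure (\<mu> n) (cylinder b \<gamma>)) \<longlonglongrightarrow> measure \<nu> (cylinder b \<gamma>)"
proof -
  let ?f = "\<lambda>t :: nat \<Rightarrow> nat. \<Prod>i<length \<gamma>. (if t i = \<gamma> ! i then 1 else 0 :: real)"
  have "continuous_on UNIV (\<lambda>t :: nat \<Rightarrow> nat. (\<lambda>k. if k = \<gamma> ! i then 1 else 0 :: real) (t i))" for i
    by (rule continuous_on_compose2[OF Topological_Spaces.continuous_on_discrete continuous_on_product_coordinates]) auto
  then have "continuous_on UNIV ?f" by (intro continuous_on_prod) auto
  then have "continuous_on (tree_boundary b) ?f" by (rule continuous_on_subset) auto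
  moreover have "(\<integral>t. ?f t \<partial>M) = measure M (cylinder b \<gamma>)" if M: "sets M = sets (tree_measure b)" for M
  proof -
    have "(\<integral>t. ?f t \<partial>M) = (\<integral>t. indicator (cylinder b \<gamma>) t \<partial>M)"
    proof (rule Bochner_Integration.integral_cong)
      fix t assume "t \<in> space M"
      then have "t \<in> tree_boundary b" using sets_eq_imp_space_eq[OF M] by (simp add: space_tree_measure)
      then show "?f t = indicator (cylinder b \<gamma>) t"
        by (auto simp: indicator_def mem_cylinder_iff intro!: prod.neutral)
    qed simp
    then show ?thesis using M by (simp add: sets_cylinder)
  qed
  ultimately show ?thesis using w unfolding weakly_converges_def by fastforce
qed

text \<open>
  A continuous function is uniformly close to one that is constant on the cylinders of a fixed
  generation, and integrals of the latter are finite combinations of masses of cylinders. The mass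
  of the empty word bounds the total masses.
\<close>

lemma weakly_convergesI:
  assumes b: "0 < b" and \<mu>: "\<And>n. finite_measure (\<mu> n)" "\<And>n. sets (\<mu> n) = sets (tree_measure b)"
    and \<nu>: "finite_measure \<nu>" "sets \<nu> = sets (tree_measure b)"
    and lim: "\<And>\<gamma>. \<gamma> \<in> tree_words b \<Longrightarrow> (\<lambda>n. measure (\<mu> n) (cylinder b \<gamma>)) \<longlonglongrightarrow> measure \<nu> (cylinder b \<gamma>)"
  shows "weakly_converges b \<mu> \<nu>"
  unfolding weakly_converges_def
proof (intro conjI allI impI \<mu> \<nu>)
  fix f :: "(nat \<Rightarrow> nat) \<Rightarrow> real" assume f: "continuous_on (tree_boundary b) f"
  have fm: "f \<in> borel_measurable (tree_measure b)"
    using borel_measurable_continuous_on_restrict[OF f] measurable_cong_sets[OF sets_tree_measure refl] by blast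
  obtain x where x: "\<And>\<gamma>. \<gamma> \<in> tree_words b \<Longrightarrow> x \<gamma> \<in> tree_boundary b \<and> prefix_of (x \<gamma>) (length \<gamma>) = \<gamma>"
    using boundary_point_exists[OF b] by metis
  define S where "S n M = (\<Sum>\<gamma>\<in>generation b n. f (x \<gamma>) * measure M (cylinder b \<gamma>))" for n and M :: "(nat \<Rightarrow> nat) measure"
  \<comment> \<open>\<open>S n M\<close> is the integral of the step function that takes on each cylinder the value of \<open>f\<close> at a chosen point\<close>
  have step: "\<bar>(\<integral>t. f t \<partial>M) - S n M\<bar> \<le> e * measure M (cylinder b [])"
    if M: "finite_measure M" "sets M = sets (tree_measure b)" and e: "0 < e"
      and n: "\<And>s t. s \<in> tree_boundary b \<Longrightarrow> t \<in> tree_boundary b \<Longrightarrow> prefix_of s n = prefix_of t n \<Longrightarrow> \<bar>f s - f t\<bar> < e"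
    for M n e
  proof -
    interpret finite_measure M by fact
    have sp: "space M = tree_boundary b" using sets_eq_imp_space_eq[OF M(2)] by (simp add: space_tree_measure)
    have [simp]: "cylinder b [] = tree_boundary b" by (auto simp: mem_cylinder_iff)
    have cyl [measurable]: "cylinder b \<gamma> \<in> sets M" for \<gamma> by (simp add: M(2) sets_cylinder)
    have prefm: "(\<lambda>t. f (x (prefix_of t n))) \<in> borel_measurable M"
      using prefix_dependent_measurable[of "\<lambda>\<gamma>. f (x \<gamma>)" n b] measurable_cong_sets[OF M(2) refl] by blast
    have fM [measurable]: "f \<in> borel_measurable M" using fm measurable_cong_sets[OF M(2) refl] by blast
    have repr: "f (x (prefix_of t n)) = (\<Sum>\<gamma>\<in>generation b n. f (x \<gamma>) * indicator (cylinder b \<gamma>) t)"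
      if t: "t \<in> tree_boundary b" for t
    proof -
      have "(\<Sum>\<gamma>\<in>generation b n. f (x \<gamma>) * indicator (cylinder b \<gamma>) t)
          = (\<Sum>\<gamma>\<in>generation b n. if \<gamma> = prefix_of t n then f (x \<gamma>) else 0)"
        using t by (intro sum.cong) (auto simp: cylinder_def indicator_def generation_def)
      then show ?thesis using prefix_of_in_generation[OF t, of n] by simp
    qed
    have ig: "integrable M (\<lambda>t. f (x (prefix_of t n)))"
      by (subst Bochner_Integration.integrable_cong[OF refl repr])
        (auto simp: sp less_top[symmetric] intro!: Bochner_Integration.integrable_sum integrable_mult_right
          integrable_real_indicator simp del: sum_mult_indicator)
    have close: "\<bar>f t - f (x (prefix_of t n))\<bar> < e" if t: "t \<in> tree_boundary b" for t
      using x[OF prefix_of_in_tree_words[OF t, of n]] t by (intro n) auto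
    have "integrable M (\<lambda>t. f t - f (x (prefix_of t n)))"
      by (rule integrable_const_bound[where B = e])
        (use close prefm in \<open>auto simp: sp intro!: AE_I2 less_imp_le\<close>)
    from Bochner_Integration.integrable_add[OF this ig] have "integrable M f" by simp
    have "S n M = (\<integral>t. f (x (prefix_of t n)) \<partial>M)"
      by (subst Bochner_Integration.integral_cong[OF refl repr], simp add: sp,
        subst Bochner_Integration.integral_sum)
        (auto simp: S_def less_top[symmetric] intro!: integrable_mult_right integrable_real_indicator)
    then have "(\<integral>t. f t \<partial>M) - S n M = (\<integral>t. f t - f (x (prefix_of t n)) \<partial>M)"
      using \<open>integrable M f\<close> ig by simp
    also have "\<bar>\<dots>\<bar> \<le> (\<integral>t. \<bar>f t - f (x (prefix_of t n))\<bar> \<partial>M)" by (rule integral_abs_bound)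
    also have "\<dots> \<le> (\<integral>t. e \<partial>M)"
      using \<open>integrable M f\<close> ig close by (intro integral_mono) (auto simp: sp less_imp_le)
    finally show ?thesis by (simp add: sp mult.commute)
  qed
  show "(\<lambda>n. \<integral>t. f t \<partial>\<mu> n) \<longlonglongrightarrow> (\<integral>t. f t \<partial>\<nu>)"
  proof (rule LIMSEQ_I)
    fix r :: real assume r: "0 < r"
    define m where "m = measure \<nu> (cylinder b [])"
    have m: "0 \<le> m" by (simp add: m_def)
    \<comment> \<open>the total masses are eventually below \<open>m + 1\<close>, which is positive even if the limit vanishes\<close>
    define e where "e = r / (4 * (m + 1))"
    have e: "0 < e" using r m by (simp add: e_def)
    from continuous_oscillation_on_cylinders[OF f e] obtain N where
      N: "\<And>s t. s \<in> tree_boundary b \<Longrightarrow> t \<in> tree_boundary b \<Longrightarrow> prefix_of s N = prefix_of t N \<Longrightarrow> \<bar>f s - f t\<bar> < e"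
      by blast
    have "(\<lambda>n. S N (\<mu> n)) \<longlonglongrightarrow> S N \<nu>"
      unfolding S_def using generation_subset by (intro tendsto_sum tendsto_mult_left lim) auto
    then have "\<forall>\<^sub>F n in sequentially. \<bar>S N (\<mu> n) - S N \<nu>\<bar> < r / 4"
      using r by (auto dest!: tendstoD[where e = "r/4"] simp: dist_real_def)
    moreover have "\<forall>\<^sub>F n in sequentially. measure (\<mu> n) (cylinder b []) < m + 1"
      using lim[of "[]"] by (intro order_tendstoD(2)[of _ m]) (auto simp: m_def tree_words_def)
    ultimately have "\<forall>\<^sub>F n in sequentially. norm ((\<integral>t. f t \<partial>\<mu> n) - (\<integral>t. f t \<partial>\<nu>)) < r"
    proof eventually_elim
      case (elim n)
      have "\<bar>(\<integral>t. f t \<partial>\<mu> n) - S N (\<mu> n)\<bar> \<le> e * measure (\<mu> n) (cylinder b [])"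
        by (rule step[OF \<mu> e N])
      also have "\<dots> \<le> e * (m + 1)" using elim(2) e by (intro mult_left_mono) auto
      also have "\<dots> = r / 4" using m by (simp add: e_def divide_simps)
      finally have 1: "\<bar>(\<integral>t. f t \<partial>\<mu> n) - S N (\<mu> n)\<bar> \<le> r / 4" .
      have "\<bar>(\<integral>t. f t \<partial>\<nu>) - S N \<nu>\<bar> \<le> e * m"
        unfolding m_def by (rule step[OF \<nu> e N])
      also have "\<dots> \<le> e * (m + 1)" using e by (intro mult_left_mono) auto
      also have "\<dots> = r / 4" using m by (simp add: e_def divide_simps)
      finally show ?case using 1 elim(1) r unfolding real_norm_def by linarith
    qed
    then show "\<exists>no. \<forall>n\<ge>no. norm ((\<integral>t. f t \<partial>\<mu> n) - (\<integral>t. f t \<partial>\<nu>)) < r"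
      by (simp add: eventually_sequentially)
  qed
qed

section \<open>The sigma-algebras generated by weights\<close>

lemma space_cascade_space: "space (cascade_space b) = Pi\<^sub>E (tree_words b) (\<lambda>_. {0..})"
  by (simp add: cascade_space_def space_PiM space_restrict_space)

lemma cascade_space_nonneg: "\<omega> \<in> space (cascade_space b) \<Longrightarrow> \<gamma> \<in> tree_words b \<Longrightarrow> 0 \<le> \<omega> \<gamma>"
  by (auto simp: space_cascade_space PiE_iff)

lemma space_coord_algebra [simp]: "space (coord_algebra b K) = space (cascade_space b)"
  by (simp add: coord_algebra_def space_measure_of_conv)

lemma sets_coord_algebra:
  "sets (coord_algebra b K) = sigma_sets (space (cascade_space b))
     {{\<omega> \<in> space (cascade_space b). \<omega> \<gamma> \<in> A} | \<gamma> A. \<gamma> \<in> K \<and> A \<in> sets borel}"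
  unfolding coord_algebra_def by (rule sets_measure_of) auto

lemma coordinate_event: "\<gamma> \<in> K \<Longrightarrow> A \<in> sets borel \<Longrightarrow> {\<omega> \<in> space (cascade_space b). \<omega> \<gamma> \<in> A} \<in> sets (coord_algebra b K)"
  unfolding sets_coord_algebra by (intro sigma_sets.Basic) blast

lemma measurable_coordinate: "\<gamma> \<in> K \<Longrightarrow> (\<lambda>\<omega>. \<omega> \<gamma>) \<in> borel_measurable (coord_algebra b K)"
  using coordinate_event[of \<gamma> K] by (intro measurableI) (auto simp: vimage_def Int_def conj_commute)

lemma measurable_coordinate_nonneg:
  "\<gamma> \<in> K \<Longrightarrow> \<gamma> \<in> tree_words b \<Longrightarrow> (\<lambda>\<omega>. \<omega> \<gamma>) \<in> coord_algebra b K \<rightarrow>\<^sub>M nonneg_borel"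
  by (intro measurable_restrict_space2 measurable_coordinate) (auto intro: cascade_space_nonneg)

lemma sets_coord_algebra_mono: "K \<subseteq> K' \<Longrightarrow> sets (coord_algebra b K) \<subseteq> sets (coord_algebra b K')"
  unfolding sets_coord_algebra by (intro sigma_sets_mono') blast

lemma subalgebra_coord_algebra_mono: "K \<subseteq> K' \<Longrightarrow> subalgebra (coord_algebra b K') (coord_algebra b K)"
  by (simp add: subalgebra_def sets_coord_algebra_mono)

lemma subalgebra_cascade_space:
  assumes "K \<subseteq> tree_words b"
  shows "subalgebra (cascade_space b) (coord_algebra b K)"
proof -
  have "{\<omega> \<in> space (cascade_space b). \<omega> \<gamma> \<in> A} \<in> sets (cascade_space b)"
    if "\<gamma> \<in> K" "A \<in> sets borel" for \<gamma> A
  proof -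
    have "(\<lambda>\<omega>. \<omega> \<gamma>) \<in> cascade_space b \<rightarrow>\<^sub>M nonneg_borel"
      unfolding cascade_space_def using that assms by (intro measurable_component_singleton) auto
    then have "(\<lambda>\<omega>. \<omega> \<gamma>) \<in> borel_measurable (cascade_space b)"
      by (simp add: measurable_restrict_space2_iff)
    from measurable_sets[OF this that(2)] show ?thesis by (simp add: vimage_def Int_def conj_commute)
  qed
  then show ?thesis
    unfolding subalgebra_def sets_coord_algebra
    by (auto intro!: sets.sigma_sets_subset simp del: sets.sigma_sets_subset)
qed

lemma measurable_into_coord_algebra:
  assumes "\<And>\<omega>. \<omega> \<in> space M \<Longrightarrow> T \<omega> \<in> space (cascade_space b)"
    and "\<And>\<gamma>. \<gamma> \<in> K \<Longrightarrow> (\<lambda>\<omega>. T \<omega> \<gamma>) \<in> borel_measurable M"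
  shows "T \<in> M \<rightarrow>\<^sub>M coord_algebra b K"
  unfolding coord_algebra_def
proof (rule measurable_measure_of)
  fix B assume "B \<in> {{\<omega> \<in> space (cascade_space b). \<omega> \<gamma> \<in> A} | \<gamma> A. \<gamma> \<in> K \<and> A \<in> sets borel}"
  then obtain \<gamma> A where B: "B = {\<omega> \<in> space (cascade_space b). \<omega> \<gamma> \<in> A}" "\<gamma> \<in> K" "A \<in> sets borel" by blast
  then have "T -` B \<inter> space M = (\<lambda>\<omega>. T \<omega> \<gamma>) -` A \<inter> space M" using assms(1) by auto
  then show "T -` B \<inter> space M \<in> sets M" using measurable_sets[OF assms(2)] B by simp
qed (use assms(1) in auto)

text \<open>
  An event generated by the weights in \<open>K\<close> cannot distinguish two points that agree on \<open>K\<close>.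
\<close>

lemma coord_algebra_depends_only:
  assumes B: "B \<in> sets (coord_algebra b K)"
    and "\<omega> \<in> space (cascade_space b)" "\<omega>' \<in> space (cascade_space b)" "\<And>\<gamma>. \<gamma> \<in> K \<Longrightarrow> \<omega> \<gamma> = \<omega>' \<gamma>"
  shows "\<omega> \<in> B \<longleftrightarrow> \<omega>' \<in> B"
  using B unfolding sets_coord_algebra
  by (induction rule: sigma_sets.induct) (use assms in auto)

text \<open>
  The rectangles that separate the newest generation from its past. The conditional
  independence of a generation given the past evaluates exactly these events, and the set \<open>K\<close>
  of words serves both for a single line of descent and for the whole tree.
\<close>

definition generation_events :: "nat \<Rightarrow> nat list set \<Rightarrow> nat \<Rightarrow> (nat list \<Rightarrow> real) set set" where
  "generation_events b K n =
    {B \<inter> {\<omega> \<in> space (cascade_space b). \<forall>\<delta>\<in>K \<inter> generation b (Suc n). \<omega> \<delta> \<in> A \<delta>} | B A.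
      B \<in> sets (coord_algebra b {\<gamma> \<in> K. length \<gamma> \<le> n}) \<and> (\<forall>\<delta>. A \<delta> \<in> sets nonneg_borel)}"

lemma sets_nonneg_borelD: "A \<in> sets nonneg_borel \<Longrightarrow> A \<in> sets borel"
  by (subst (asm) sets_restrict_space_iff) auto

lemma atLeast_nonneg_borel: "{0..} \<in> sets nonneg_borel"
  by (subst sets_restrict_space_iff) auto

lemma Int_stable_generation_events: "Int_stable (generation_events b K n)"
proof (rule Int_stableI)
  fix X Y assume "X \<in> generation_events b K n" "Y \<in> generation_events b K n"
  then obtain B A B' A' where
    X: "X = B \<inter> {\<omega> \<in> space (cascade_space b). \<forall>\<delta>\<in>K \<inter> generation b (Suc n). \<omega> \<delta> \<in> A \<delta>}"
      "B \<in> sets (coord_algebra b {\<gamma> \<in> K. length \<gamma> \<le> n})" "\<forall>\<delta>. A \<delta> \<in> sets nonneg_borel"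
    and Y: "Y = B' \<inter> {\<omega> \<in> space (cascade_space b). \<forall>\<delta>\<in>K \<inter> generation b (Suc n). \<omega> \<delta> \<in> A' \<delta>}"
      "B' \<in> sets (coord_algebra b {\<gamma> \<in> K. length \<gamma> \<le> n})" "\<forall>\<delta>. A' \<delta> \<in> sets nonneg_borel"
    unfolding generation_events_def by blast
  have "X \<inter> Y = (B \<inter> B') \<inter> {\<omega> \<in> space (cascade_space b). \<forall>\<delta>\<in>K \<inter> generation b (Suc n). \<omega> \<delta> \<in> A \<delta> \<inter> A' \<delta>}"
    using X(1) Y(1) by auto
  moreover have "B \<inter> B' \<in> sets (coord_algebra b {\<gamma> \<in> K. length \<gamma> \<le> n})" "\<forall>\<delta>. A \<delta> \<inter> A' \<delta> \<in> sets nonneg_borel"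
    using X Y by auto
  ultimately show "X \<inter> Y \<in> generation_events b K n"
    unfolding generation_events_def by (intro CollectI exI[of _ "B \<inter> B'"] exI[of _ "\<lambda>\<delta>. A \<delta> \<inter> A' \<delta>"] conjI)
qed

lemma next_generation_event:
  assumes "\<And>\<delta>. A \<delta> \<in> sets nonneg_borel" "L \<subseteq> K" "finite L"
  shows "{\<omega> \<in> space (cascade_space b). \<forall>\<delta>\<in>L. \<omega> \<delta> \<in> A \<delta>} \<in> sets (coord_algebra b K)"
proof -
  have "{\<omega> \<in> space (coord_algebra b K). \<forall>\<delta>\<in>L. \<omega> \<delta> \<in> A \<delta>} \<in> sets (coord_algebra b K)"
    using assms coordinate_event[of _ K] sets_nonneg_borelD[OF assms(1)]
    by (intro sets.sets_Collect_finite_All) auto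
  then show ?thesis by simp
qed

lemma sets_coord_algebra_generation_events:
  assumes K: "K \<subseteq> tree_words b"
  shows "generation_events b K n \<subseteq> sets (coord_algebra b {\<gamma> \<in> K. length \<gamma> \<le> Suc n})"
    and "sets (coord_algebra b {\<gamma> \<in> K. length \<gamma> \<le> Suc n}) = sigma_sets (space (cascade_space b)) (generation_events b K n)"
    and "space (cascade_space b) \<in> generation_events b K n"
proof -
  let ?\<Omega> = "space (cascade_space b)" and ?G = "generation_events b K n"
  let ?L = "K \<inter> generation b (Suc n)"
  let ?K = "{\<gamma> \<in> K. length \<gamma> \<le> n}" and ?K' = "{\<gamma> \<in> K. length \<gamma> \<le> Suc n}"
  have all: "{\<omega> \<in> ?\<Omega>. \<forall>\<delta>\<in>?L. \<omega> \<delta> \<in> {0..}} = ?\<Omega>"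
    using K by (auto intro: cascade_space_nonneg)
  have sub: "sets (coord_algebra b ?K) \<subseteq> sets (coord_algebra b ?K')"
    by (intro sets_coord_algebra_mono) auto
  show G: "?G \<subseteq> sets (coord_algebra b ?K')"
  proof
    fix X assume "X \<in> ?G"
    then obtain B A where X: "X = B \<inter> {\<omega> \<in> ?\<Omega>. \<forall>\<delta>\<in>?L. \<omega> \<delta> \<in> A \<delta>}"
      "B \<in> sets (coord_algebra b ?K)" "\<forall>\<delta>. A \<delta> \<in> sets nonneg_borel"
      unfolding generation_events_def by blast
    have "{\<omega> \<in> ?\<Omega>. \<forall>\<delta>\<in>?L. \<omega> \<delta> \<in> A \<delta>} \<in> sets (coord_algebra b ?K')"
      using X(3) by (intro next_generation_event) (auto simp: generation_def intro: finite_subset[OF _ finite_generation])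
    with X sub show "X \<in> sets (coord_algebra b ?K')" by auto
  qed
  have old: "B \<in> ?G" if "B \<in> sets (coord_algebra b ?K)" for B
  proof -
    have "B = B \<inter> {\<omega> \<in> ?\<Omega>. \<forall>\<delta>\<in>?L. \<omega> \<delta> \<in> {0..}}"
      unfolding all using sets.sets_into_space[OF that] by auto
    then show ?thesis
      unfolding generation_events_def using that atLeast_nonneg_borel by (intro CollectI exI[of _ B] exI[of _ "\<lambda>_. {0..}"]) auto
  qed
  from old[OF sets.top] show "?\<Omega> \<in> ?G" by simp
  have new: "{\<omega> \<in> ?\<Omega>. \<omega> \<gamma> \<in> A} \<in> ?G" if g: "\<gamma> \<in> ?K'" and A: "A \<in> sets borel" for \<gamma> A
  proof (cases "length \<gamma> \<le> n")
    case True
    with g A show ?thesis by (intro old coordinate_event) auto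
  next
    case False
    with g K have "\<gamma> \<in> ?L" by (auto simp: generation_def)
    let ?A = "\<lambda>\<delta>. if \<delta> = \<gamma> then A \<inter> {0..} else {0..}"
    have "{\<omega> \<in> ?\<Omega>. \<omega> \<gamma> \<in> A} = ?\<Omega> \<inter> {\<omega> \<in> ?\<Omega>. \<forall>\<delta>\<in>?L. \<omega> \<delta> \<in> ?A \<delta>}"
      using \<open>\<gamma> \<in> ?L\<close> K by (auto intro: cascade_space_nonneg split: if_splits)
    moreover have "?A \<delta> \<in> sets nonneg_borel" for \<delta>
      using A by (auto simp: sets_restrict_space_iff)
    moreover have "?\<Omega> \<in> sets (coord_algebra b ?K)" using sets.top[of "coord_algebra b ?K"] by simp
    ultimately show ?thesis
      unfolding generation_events_def by (intro CollectI exI[of _ ?\<Omega>] exI[of _ ?A]) auto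
  qed
  show "sets (coord_algebra b ?K') = sigma_sets ?\<Omega> ?G"
  proof
    show "sets (coord_algebra b ?K') \<subseteq> sigma_sets ?\<Omega> ?G"
      unfolding sets_coord_algebra by (rule sigma_sets_mono) (use new in blast)
    show "sigma_sets ?\<Omega> ?G \<subseteq> sets (coord_algebra b ?K')"
      using sets.sigma_sets_subset[OF G] by simp
  qed
qed

section \<open>The Markov property of the cascade\<close>

text \<open>
  Over a nonempty alphabet every word extends to a boundary point, so the conditional laws, which
  are indexed by boundary points, are available for words.
\<close>

locale nonempty_cascade = cascade_generator +
  assumes two_le: "2 \<le> b"
begin

sublocale prob_space P by (rule prob_P)

abbreviation \<Omega> :: "(nat list \<Rightarrow> real) set" where "\<Omega> \<equiv> space (cascade_space b)"
abbreviation \<F> :: "nat \<Rightarrow> (nat list \<Rightarrow> real) measure" where "\<F> \<equiv> cascade_filtration b"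

lemma b_pos: "0 < b" using two_le by simp

lemma space_P: "space P = \<Omega>"
  by (rule sets_eq_imp_space_eq[OF sets_P])

lemma subalgebra_P_coord: "K \<subseteq> tree_words b \<Longrightarrow> subalgebra P (coord_algebra b K)"
  using subalgebra_cascade_space[of K b] by (simp add: subalgebra_def sets_P space_P)

lemma subalgebra_P_filtration: "subalgebra P (\<F> n)"
  unfolding cascade_filtration_def by (rule subalgebra_P_coord) auto

lemma subalgebra_filtration_coord: "K \<subseteq> tree_words b \<Longrightarrow> subalgebra (\<F> n) (coord_algebra b {\<gamma> \<in> K. length \<gamma> \<le> n})"
  unfolding cascade_filtration_def by (rule subalgebra_coord_algebra_mono) auto

lemma filtration_mono: "m \<le> n \<Longrightarrow> sets (\<F> m) \<subseteq> sets (\<F> n)"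
  unfolding cascade_filtration_def by (rule sets_coord_algebra_mono) auto

lemma subalgebra_filtration_mono: "m \<le> n \<Longrightarrow> subalgebra (\<F> n) (\<F> m)"
  unfolding cascade_filtration_def by (rule subalgebra_coord_algebra_mono) auto

lemma space_filtration [simp]: "space (\<F> n) = \<Omega>"
  by (simp add: cascade_filtration_def)

lemmas measurable_P_of_filtration = measurable_from_subalg[OF subalgebra_P_filtration]

lemma measurable_coordinate_P: "\<gamma> \<in> tree_words b \<Longrightarrow> (\<lambda>\<omega>. \<omega> \<gamma>) \<in> P \<rightarrow>\<^sub>M nonneg_borel"
  by (rule measurable_from_subalg[OF subalgebra_P_coord[of "tree_words b"]])
    (auto intro: measurable_coordinate_nonneg)

text \<open>
  The kernel for the weight at \<open>\<delta>\<close>, evaluated at the weights of the proper prefixes of \<open>\<delta>\<close>.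
\<close>

definition offspring_law :: "nat list \<Rightarrow> (nat list \<Rightarrow> real) \<Rightarrow> real measure" where
  "offspring_law \<delta> \<omega> = q (length \<delta>) (\<lambda>j\<in>{..<length \<delta>}. \<omega> (take j \<delta>))"

lemma measurable_offspring_law:
  assumes d: "\<delta> \<in> tree_words b" "\<delta> \<noteq> []" and K: "\<And>j. j < length \<delta> \<Longrightarrow> take j \<delta> \<in> K"
  shows "offspring_law \<delta> \<in> coord_algebra b K \<rightarrow>\<^sub>M prob_algebra nonneg_borel"
proof -
  have "(\<lambda>\<omega>. \<lambda>j\<in>{..<length \<delta>}. \<omega> (take j \<delta>)) \<in> coord_algebra b K \<rightarrow>\<^sub>M PiM {..<length \<delta>} (\<lambda>_. nonneg_borel)"
    using K d(1) by (intro measurable_restrict measurable_coordinate_nonneg) (auto intro: take_tree_words)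
  moreover have "q (length \<delta>) \<in> PiM {..<length \<delta>} (\<lambda>_. nonneg_borel) \<rightarrow>\<^sub>M prob_algebra nonneg_borel"
    using d(2) by (intro kernel) (cases \<delta>, auto)
  ultimately show ?thesis
    unfolding offspring_law_def by (rule measurable_compose)
qed

lemma measurable_measure_offspring_law:
  assumes "\<delta> \<in> tree_words b" "\<delta> \<noteq> []" "\<And>j. j < length \<delta> \<Longrightarrow> take j \<delta> \<in> K" "A \<in> sets nonneg_borel"
  shows "(\<lambda>\<omega>. measure (offspring_law \<delta> \<omega>) A) \<in> borel_measurable (coord_algebra b K)"
  by (rule measurable_compose[OF measurable_prob_algebraD[OF measurable_offspring_law[OF assms(1-3)]]
        measurable_measure_subprob_algebra[OF assms(4)]])

lemma offspring_law_space:
  assumes "\<delta> \<in> tree_words b" "\<delta> \<noteq> []" "\<omega> \<in> \<Omega>"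
  shows "prob_space (offspring_law \<delta> \<omega>)" "sets (offspring_law \<delta> \<omega>) = sets nonneg_borel"
    "measure (offspring_law \<delta> \<omega>) {0..} = 1"
proof -
  have "offspring_law \<delta> \<omega> \<in> space (prob_algebra nonneg_borel)"
    by (rule measurable_space[OF measurable_offspring_law[of \<delta> "tree_words b"]])
      (use assms in \<open>auto intro: take_tree_words\<close>)
  then show *: "prob_space (offspring_law \<delta> \<omega>)" and s: "sets (offspring_law \<delta> \<omega>) = sets nonneg_borel"
    by (auto simp: space_prob_algebra)
  interpret o: prob_space "offspring_law \<delta> \<omega>" by fact
  have "space (offspring_law \<delta> \<omega>) = {0..}"
    using sets_eq_imp_space_eq[OF s] by (simp add: space_restrict_space)
  with o.prob_space show "measure (offspring_law \<delta> \<omega>) {0..} = 1" by simp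
qed

lemma cond_law_word:
  assumes d: "\<delta> \<in> generation b (Suc n)" and A: "A \<in> sets nonneg_borel"
  shows "AE \<omega> in P. real_cond_exp P (\<F> n) (\<lambda>\<omega>. indicator A (\<omega> \<delta>)) \<omega> = measure (offspring_law \<delta> \<omega>) A"
proof -
  from d have len: "length \<delta> = Suc n" "\<delta> \<in> tree_words b" by (auto simp: generation_def)
  from boundary_point_exists[OF b_pos len(2)] obtain t where t: "t \<in> tree_boundary b" "prefix_of t (Suc n) = \<delta>"
    by (auto simp: len)
  have "(\<lambda>j\<in>{..<Suc n}. \<omega> (prefix_of t j)) = (\<lambda>j\<in>{..<Suc n}. \<omega> (take j \<delta>))" for \<omega> :: "nat list \<Rightarrow> real"
    by (intro restrict_ext) (auto simp: t(2)[symmetric] take_prefix_of)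
  with cond_law[OF t(1) A, of n] t(2) len show ?thesis by (simp add: offspring_law_def)
qed

text \<open>
  The product formula is given for the full generation; a subfamily is obtained by letting the
  other weights range over the whole half-line.
\<close>

lemma conditional_next_generation:
  assumes L: "L \<subseteq> generation b (Suc n)" and A: "\<And>\<delta>. A \<delta> \<in> sets nonneg_borel"
  shows "AE \<omega> in P. real_cond_exp P (\<F> n) (\<lambda>\<omega>. \<Prod>\<delta>\<in>L. indicator (A \<delta>) (\<omega> \<delta>)) \<omega>
      = (\<Prod>\<delta>\<in>L. measure (offspring_law \<delta> \<omega>) (A \<delta>))"
proof -
  interpret F: sigma_finite_subalgebra P "\<F> n" by (rule sigma_finite_subalgebraI[OF subalgebra_P_filtration])
  let ?G = "generation b (Suc n)"
  define A' where "A' \<delta> = (if \<delta> \<in> L then A \<delta> else {0..})" for \<delta>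
  have A': "A' \<delta> \<in> sets nonneg_borel" for \<delta> using A atLeast_nonneg_borel by (simp add: A'_def)
  have G: "{\<gamma>. \<gamma> \<in> tree_words b \<and> length \<gamma> = Suc n} = ?G" by (simp add: generation_def)
  have Gw: "\<delta> \<in> tree_words b" "\<delta> \<noteq> []" if "\<delta> \<in> ?G" for \<delta> using that by (auto simp: generation_def)
  have meas: "(\<lambda>\<omega>. \<Prod>\<delta>\<in>I. indicator (C \<delta>) (\<omega> \<delta>) :: real) \<in> borel_measurable P"
    if "I \<subseteq> ?G" "\<And>\<delta>. C \<delta> \<in> sets nonneg_borel" for I C
    using that Gw by (intro borel_measurable_prod measurable_compose[OF measurable_coordinate_P] borel_measurable_indicator) auto
  have "(\<Prod>\<delta>\<in>?G. indicator (A' \<delta>) (\<omega> \<delta>)) = (\<Prod>\<delta>\<in>L. indicator (A \<delta>) (\<omega> \<delta>) :: real)" if "\<omega> \<in> \<Omega>" for \<omega>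
    using L that Gw by (intro prod.mono_neutral_cong_right) (auto simp: A'_def cascade_space_nonneg)
  then have "AE \<omega> in P. real_cond_exp P (\<F> n) (\<lambda>\<omega>. \<Prod>\<delta>\<in>?G. indicator (A' \<delta>) (\<omega> \<delta>)) \<omega>
      = real_cond_exp P (\<F> n) (\<lambda>\<omega>. \<Prod>\<delta>\<in>L. indicator (A \<delta>) (\<omega> \<delta>)) \<omega>"
    using L A A' by (intro F.real_cond_exp_cong AE_I2 meas) (auto simp: space_P)
  moreover have "AE \<omega> in P. \<forall>\<delta>\<in>?G. real_cond_exp P (\<F> n) (\<lambda>\<omega>. indicator (A' \<delta>) (\<omega> \<delta>)) \<omega>
      = measure (offspring_law \<delta> \<omega>) (A' \<delta>)"
    by (intro AE_finite_allI cond_law_word A') auto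
  moreover note cond_indep[where A = A', OF A', of n, unfolded G]
  moreover have "AE \<omega> in P. (\<Prod>\<delta>\<in>?G. measure (offspring_law \<delta> \<omega>) (A' \<delta>)) = (\<Prod>\<delta>\<in>L. measure (offspring_law \<delta> \<omega>) (A \<delta>))"
    using L Gw by (intro AE_I2 prod.mono_neutral_cong_right) (auto simp: A'_def offspring_law_space space_P)
  ultimately show ?thesis by eventually_elim simp
qed

lemma indicator_next_generation:
  assumes "finite L" "\<omega> \<in> \<Omega>"
  shows "indicator {\<omega> \<in> \<Omega>. \<forall>\<delta>\<in>L. \<omega> \<delta> \<in> A \<delta>} \<omega> = (\<Prod>\<delta>\<in>L. indicator (A \<delta>) (\<omega> \<delta>) :: real)"
  using assms by (auto simp: indicator_def)

text \<open>
  The part of a rectangle that lies in the past is known and factors out.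
\<close>

lemma generation_event_cond_exp:
  assumes B: "B \<in> sets (\<F> n)" and L: "L \<subseteq> generation b (Suc n)" and A: "\<And>\<delta>. A \<delta> \<in> sets nonneg_borel"
  shows "AE \<omega> in P. real_cond_exp P (\<F> n) (indicator (B \<inter> {\<omega> \<in> \<Omega>. \<forall>\<delta>\<in>L. \<omega> \<delta> \<in> A \<delta>})) \<omega>
      = indicator B \<omega> * (\<Prod>\<delta>\<in>L. measure (offspring_law \<delta> \<omega>) (A \<delta>))"
proof -
  interpret F: sigma_finite_subalgebra P "\<F> n" by (rule sigma_finite_subalgebraI[OF subalgebra_P_filtration])
  have finL: "finite L" using L finite_subset by blast
  let ?C = "{\<omega> \<in> \<Omega>. \<forall>\<delta>\<in>L. \<omega> \<delta> \<in> A \<delta>}"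
  let ?f = "\<lambda>\<omega>. \<Prod>\<delta>\<in>L. indicator (A \<delta>) (\<omega> \<delta>) :: real"
  have BP: "B \<in> sets P" using B subalgebra_P_filtration by (auto simp: subalgebra_def)
  have CP: "?C \<in> sets P"
  proof -
    have "?C \<in> sets (coord_algebra b (tree_words b))"
      using L generation_subset by (intro next_generation_event A finL) auto
    with subalgebra_P_coord[of "tree_words b"] show ?thesis by (auto simp: subalgebra_def)
  qed
  have fm: "?f \<in> borel_measurable P"
    using L generation_subset A
    by (intro borel_measurable_prod measurable_compose[OF measurable_coordinate_P] borel_measurable_indicator) auto
  have ind: "indicator (B \<inter> ?C) \<omega> = indicator B \<omega> * ?f \<omega>" if "\<omega> \<in> space P" for \<omega>
    using indicator_next_generation[OF finL, of \<omega> A] that by (simp add: indicator_inter_arith space_P)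
  have "integrable P (indicator (B \<inter> ?C) :: _ \<Rightarrow> real)"
    using BP CP by (auto simp: less_top[symmetric])
  then have int: "integrable P (\<lambda>\<omega>. indicator B \<omega> * ?f \<omega>)"
    by (subst Bochner_Integration.integrable_cong[OF refl ind[symmetric]]) auto
  have "AE \<omega> in P. real_cond_exp P (\<F> n) (indicator (B \<inter> ?C)) \<omega> = real_cond_exp P (\<F> n) (\<lambda>\<omega>. indicator B \<omega> * ?f \<omega>) \<omega>"
    using BP CP fm ind by (intro F.real_cond_exp_cong AE_I2) auto
  moreover have "AE \<omega> in P. real_cond_exp P (\<F> n) (\<lambda>\<omega>. indicator B \<omega> * ?f \<omega>) \<omega>
      = indicator B \<omega> * real_cond_exp P (\<F> n) ?f \<omega>"
    using B by (intro F.real_cond_exp_mult fm int) auto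
  moreover note conditional_next_generation[where A = A, OF L A]
  ultimately show ?thesis by eventually_elim simp
qed

lemma integrable_bounded_generation_term:
  assumes B: "B \<in> sets P" and L: "L \<subseteq> generation b (Suc n)" and A: "\<And>\<delta>. A \<delta> \<in> sets nonneg_borel"
  shows "integrable P (\<lambda>\<omega>. indicator B \<omega> * (\<Prod>\<delta>\<in>L. measure (offspring_law \<delta> \<omega>) (A \<delta>)))"
proof (rule integrable_const_bound[where B = 1])
  have Gw: "\<delta> \<in> tree_words b" "\<delta> \<noteq> []" if "\<delta> \<in> L" for \<delta> using that L by (auto simp: generation_def)
  have "\<bar>indicator B \<omega> * (\<Prod>\<delta>\<in>L. measure (offspring_law \<delta> \<omega>) (A \<delta>))\<bar> \<le> 1" if "\<omega> \<in> \<Omega>" for \<omega>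
  proof -
    have "(\<Prod>\<delta>\<in>L. measure (offspring_law \<delta> \<omega>) (A \<delta>)) \<le> 1"
      by (intro prod_le_1) (use Gw that offspring_law_space(1) in \<open>auto intro: prob_space.prob_le_1\<close>)
    moreover have "0 \<le> (\<Prod>\<delta>\<in>L. measure (offspring_law \<delta> \<omega>) (A \<delta>))" by (intro prod_nonneg) auto
    ultimately show ?thesis by (auto simp: indicator_def)
  qed
  then show "AE \<omega> in P. norm (indicator B \<omega> * (\<Prod>\<delta>\<in>L. measure (offspring_law \<delta> \<omega>) (A \<delta>))) \<le> 1"
    by (intro AE_I2) (simp add: space_P)
  have "(\<lambda>\<omega>. measure (offspring_law \<delta> \<omega>) (A \<delta>)) \<in> borel_measurable P" if "\<delta> \<in> L" for \<delta>
    by (rule measurable_from_subalg[OF subalgebra_P_coord[OF order_refl] measurable_measure_offspring_law])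
      (use Gw[OF that] A in \<open>auto intro: take_tree_words\<close>)
  then show "(\<lambda>\<omega>. indicator B \<omega> * (\<Prod>\<delta>\<in>L. measure (offspring_law \<delta> \<omega>) (A \<delta>))) \<in> borel_measurable P"
    using B by (intro borel_measurable_times borel_measurable_prod borel_measurable_indicator) auto
qed

text \<open>
  For rectangles the conditional probability is an explicit product of kernels. Each kernel
  reads the weights of the proper prefixes of a word in \<open>K\<close>, which lie in \<open>K\<close> because \<open>K\<close> is closed under
  prefixes, so the product is already measurable for the weights of the past in \<open>K\<close>.
\<close>

lemma markov_one_step_event:
  assumes K: "K \<subseteq> tree_words b" "\<And>\<gamma> j. \<gamma> \<in> K \<Longrightarrow> take j \<gamma> \<in> K"
    and C: "C \<in> sets (coord_algebra b {\<gamma> \<in> K. length \<gamma> \<le> Suc n})"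
  shows "AE \<omega> in P. real_cond_exp P (\<F> n) (indicator C) \<omega>
      = real_cond_exp P (coord_algebra b {\<gamma> \<in> K. length \<gamma> \<le> n}) (indicator C) \<omega>"
proof -
  let ?G = "coord_algebra b {\<gamma> \<in> K. length \<gamma> \<le> n}" and ?G' = "coord_algebra b {\<gamma> \<in> K. length \<gamma> \<le> Suc n}"
  have PG: "subalgebra P ?G" and PG': "subalgebra P ?G'" using K(1) by (auto intro!: subalgebra_P_coord)
  interpret F: sigma_finite_subalgebra P "\<F> n" by (rule sigma_finite_subalgebraI[OF subalgebra_P_filtration])
  interpret G: sigma_finite_subalgebra P ?G by (rule sigma_finite_subalgebraI[OF PG])
  note gen = sets_coord_algebra_generation_events[OF K(1), of n]
  have int: "integrable P (indicator X :: _ \<Rightarrow> real)" if "X \<in> sigma_sets \<Omega> (generation_events b K n)" for X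
    using that PG' by (auto simp: gen(2)[symmetric] subalgebra_def less_top[symmetric])
  let ?Q = "\<lambda>X. AE \<omega> in P. real_cond_exp P (\<F> n) (indicator X) \<omega> = real_cond_exp P ?G (indicator X) \<omega>"
  have Gpow: "generation_events b K n \<subseteq> Pow \<Omega>" unfolding generation_events_def by auto
  have "C \<in> sigma_sets \<Omega> (generation_events b K n)" using C by (simp add: gen(2))
  from Int_stable_generation_events Gpow this show ?thesis
  proof (induction rule: sigma_sets_induct_disjoint)
    case (basic X)
    then obtain B A where X: "X = B \<inter> {\<omega> \<in> \<Omega>. \<forall>\<delta>\<in>K \<inter> generation b (Suc n). \<omega> \<delta> \<in> A \<delta>}"
      and B: "B \<in> sets ?G" and A: "\<And>\<delta>. A \<delta> \<in> sets nonneg_borel"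
      unfolding generation_events_def by blast
    let ?L = "K \<inter> generation b (Suc n)"
    let ?H = "\<lambda>\<omega>. indicator B \<omega> * (\<Prod>\<delta>\<in>?L. measure (offspring_law \<delta> \<omega>) (A \<delta>))"
    have BF: "B \<in> sets (\<F> n)" using B subalgebra_filtration_coord[OF K(1), of n] by (auto simp: subalgebra_def)
    have BP: "B \<in> sets P" using B PG by (auto simp: subalgebra_def)
    have "(\<lambda>\<omega>. measure (offspring_law \<delta> \<omega>) (A \<delta>)) \<in> borel_measurable ?G" if "\<delta> \<in> ?L" for \<delta>
      using that K by (intro measurable_measure_offspring_law A) (auto simp: generation_def)
    then have "?H \<in> borel_measurable ?G"
      using B by (intro borel_measurable_times borel_measurable_prod borel_measurable_indicator) auto
    moreover have "integrable P ?H" by (rule integrable_bounded_generation_term[OF BP _ A]) auto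
    moreover have "AE \<omega> in P. real_cond_exp P (\<F> n) (indicator X) \<omega> = ?H \<omega>"
      unfolding X by (rule generation_event_cond_exp[OF BF _ A]) auto
    ultimately show ?case
      using basic int[OF sigma_sets.Basic[OF basic]]
      by (intro real_cond_exp_eq_submeasurable[OF subalgebra_P_filtration subalgebra_filtration_coord[OF K(1)]])
  next
    case empty
    have ind: "indicator {} = (\<lambda>_. 0 :: real)" by auto
    have "AE \<omega> in P. real_cond_exp P (\<F> n) (\<lambda>_. 0) \<omega> = 0" "AE \<omega> in P. real_cond_exp P ?G (\<lambda>_. 0) \<omega> = 0"
      by (intro F.real_cond_exp_F_meas G.real_cond_exp_F_meas; simp)+
    then show ?case unfolding ind by eventually_elim simp
  next
    case (compl X)
    have i1: "integrable P (\<lambda>_. 1 :: real)" by simp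
    note iX = int[OF compl(1)]
    have eq: "AE \<omega> in P. indicator (\<Omega> - X) \<omega> = 1 - (indicator X \<omega> :: real)"
      by (intro AE_I2) (auto simp: indicator_def space_P)
    note m = borel_measurable_integrable[OF int[OF sigma_sets.Compl[OF compl(1)]]]
      borel_measurable_integrable[OF Bochner_Integration.integrable_diff[OF i1 iX]]
    have "AE \<omega> in P. real_cond_exp P (\<F> n) (\<lambda>_. 1) \<omega> = 1" "AE \<omega> in P. real_cond_exp P ?G (\<lambda>_. 1) \<omega> = 1"
      by (intro F.real_cond_exp_F_meas G.real_cond_exp_F_meas; simp)+
    with F.real_cond_exp_cong[OF eq m] G.real_cond_exp_cong[OF eq m]
      F.real_cond_exp_diff[OF i1 iX] G.real_cond_exp_diff[OF i1 iX] compl(2)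
    show ?case by eventually_elim simp
  next
    case (union X)
    have UX: "(\<Union>i. X i) \<in> sigma_sets \<Omega> (generation_events b K n)"
      using union(2) by (intro sigma_sets.Union) auto
    have iX: "integrable P (indicator (X i) :: _ \<Rightarrow> real)" for i using union(2) by (intro int) auto
    let ?S = "\<lambda>N \<omega>. \<Sum>i<N. indicator (X i) \<omega> :: real"
    have iS: "integrable P (?S N)" for N by (intro Bochner_Integration.integrable_sum iX)
    have SN: "?S N \<omega> = indicator (\<Union>i<N. X i) \<omega>" for N \<omega>
      using union(1) by (subst indicator_UN_disjoint) (auto simp: disjoint_family_on_def)
    have conv: "(\<lambda>N. \<integral>\<omega>. \<bar>?S N \<omega> - indicator (\<Union>i. X i) \<omega>\<bar> \<partial>P) \<longlonglongrightarrow> 0"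
    proof (rule dominated_L1_convergence(2)[where w = "\<lambda>_. 1"])
      show "AE \<omega> in P. (\<lambda>N. ?S N \<omega>) \<longlonglongrightarrow> indicator (\<Union>i. X i) \<omega>"
        unfolding SN by (intro AE_I2 LIMSEQ_indicator_UN)
      show "AE \<omega> in P. \<bar>?S N \<omega>\<bar> \<le> 1" for N unfolding SN by (auto simp: indicator_def)
    qed (use iS int[OF UX] in auto)
    have "AE \<omega> in P. \<forall>i. real_cond_exp P (\<F> n) (indicator (X i)) \<omega> = real_cond_exp P ?G (indicator (X i)) \<omega>"
      unfolding AE_all_countable using union(3) by auto
    then have "AE \<omega> in P. real_cond_exp P (\<F> n) (?S N) \<omega> = real_cond_exp P ?G (?S N) \<omega>" for N
      using F.real_cond_exp_sum[of "\<lambda>i. indicator (X i)" "{..<N}", OF iX]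
        G.real_cond_exp_sum[of "\<lambda>i. indicator (X i)" "{..<N}", OF iX]
      by eventually_elim simp
    then show ?case
      by (intro real_cond_exp_eq_L1_limit[OF subalgebra_P_filtration PG iS int[OF UX] conv iS int[OF UX] conv])
  qed
qed

text \<open>
  For a prefix-closed set \<open>K\<close> of words, the past outside \<open>K\<close> carries no information about the future
  inside \<open>K\<close>: peel off one generation at a time with the tower property.
\<close>

lemma markov_property:
  assumes K: "K \<subseteq> tree_words b" "\<And>\<gamma> j. \<gamma> \<in> K \<Longrightarrow> take j \<gamma> \<in> K"
    and X: "X \<in> borel_measurable (coord_algebra b {\<gamma> \<in> K. length \<gamma> \<le> n + k})" "integrable P X"
  shows "AE \<omega> in P. real_cond_exp P (\<F> n) X \<omega> = real_cond_exp P (coord_algebra b {\<gamma> \<in> K. length \<gamma> \<le> n}) X \<omega>"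
  using X
proof (induction k arbitrary: X)
  let ?G = "\<lambda>m. coord_algebra b {\<gamma> \<in> K. length \<gamma> \<le> m}"
  have PG: "subalgebra P (?G m)" for m using K(1) by (auto intro!: subalgebra_P_coord)
  interpret F: sigma_finite_subalgebra P "\<F> n" by (rule sigma_finite_subalgebraI[OF subalgebra_P_filtration])
  interpret G: sigma_finite_subalgebra P "?G n" by (rule sigma_finite_subalgebraI[OF PG])
  {
    case 0
    then have "X \<in> borel_measurable (\<F> n)"
      using measurable_from_subalg[OF subalgebra_filtration_coord[OF K(1)]] by simp
    moreover from 0 have "X \<in> borel_measurable (?G n)" by simp
    ultimately show ?case
      using F.real_cond_exp_F_meas[OF 0(2)] G.real_cond_exp_F_meas[OF 0(2)] by (auto elim: eventually_elim2)
  next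
    case (Suc k)
    have one: "AE \<omega> in P. real_cond_exp P (\<F> (n + k)) X \<omega> = real_cond_exp P (?G (n + k)) X \<omega>"
      by (rule real_cond_exp_eq_from_events[OF subalgebra_P_filtration PG PG[of "Suc (n + k)"]
            markov_one_step_event[OF K]]) (use Suc.prems in auto)
    interpret Fk: sigma_finite_subalgebra P "\<F> (n + k)" by (rule sigma_finite_subalgebraI[OF subalgebra_P_filtration])
    interpret Gk: sigma_finite_subalgebra P "?G (n + k)" by (rule sigma_finite_subalgebraI[OF PG])
    have iG: "integrable P (real_cond_exp P (?G (n + k)) X)" and iF: "integrable P (real_cond_exp P (\<F> (n + k)) X)"
      using Suc.prems by auto
    have sub: "subalgebra (?G (n + k)) (?G n)" by (rule subalgebra_coord_algebra_mono) auto
    note IH = Suc.IH[OF borel_measurable_cond_exp iG]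
    note F.real_cond_exp_cong[OF one borel_measurable_integrable[OF iF] borel_measurable_integrable[OF iG]]
    with IH F.real_cond_exp_nested_subalg[OF subalgebra_P_filtration subalgebra_filtration_mono Suc.prems(2), of "n + k"]
      G.real_cond_exp_nested_subalg[OF PG sub Suc.prems(2)]
    show ?case by (auto elim: eventually_elim2)
  }
qed

end

section \<open>Invariance under swapping sibling subtrees\<close>

text \<open>
  Automorphisms of the rooted tree of order at most two. Being its own inverse, such a map
  transports events and reindexes products without a separate inverse.
\<close>

definition tree_involution :: "nat \<Rightarrow> (nat list \<Rightarrow> nat list) \<Rightarrow> bool" where
  "tree_involution b \<sigma> \<longleftrightarrow> (\<forall>w. \<sigma> (\<sigma> w) = w \<and> length (\<sigma> w) = length w \<and>
     (\<sigma> w \<in> tree_words b \<longleftrightarrow> w \<in> tree_words b) \<and> (\<forall>j. take j (\<sigma> w) = \<sigma> (take j w)))"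

lemma tree_involutionD:
  assumes "tree_involution b \<sigma>"
  shows "\<sigma> (\<sigma> w) = w" "length (\<sigma> w) = length w" "\<sigma> w \<in> tree_words b \<longleftrightarrow> w \<in> tree_words b"
    "take j (\<sigma> w) = \<sigma> (take j w)"
  using assms by (auto simp: tree_involution_def)

text \<open>
  Exchanges the subtrees below the children \<open>i\<close> and \<open>j\<close> of \<open>\<gamma>\<close>.
\<close>

definition swap_subtrees :: "nat list \<Rightarrow> nat \<Rightarrow> nat \<Rightarrow> nat list \<Rightarrow> nat list" where
  "swap_subtrees \<gamma> i j w =
     (if length \<gamma> < length w \<and> take (length \<gamma>) w = \<gamma>
      then w[length \<gamma> := Transposition.transpose i j (w ! length \<gamma>)] else w)"

lemma tree_involution_swap_subtrees:
  assumes ij: "i < b" "j < b"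
  shows "tree_involution b (swap_subtrees \<gamma> i j)"
proof -
  let ?\<sigma> = "swap_subtrees \<gamma> i j"
  have inv: "?\<sigma> (?\<sigma> w) = w" for w by (auto simp: swap_subtrees_def)
  have tr: "Transposition.transpose i j k < b" if "k < b" for k using that ij by (auto simp: Transposition.transpose_def)
  have into: "?\<sigma> w \<in> tree_words b" if "w \<in> tree_words b" for w
    using that tr set_update_subset_insert[of w "length \<gamma>" "Transposition.transpose i j (w ! length \<gamma>)"]
      nth_mem[of "length \<gamma>" w]
    by (auto simp: swap_subtrees_def tree_words_def in_lists_conv_set)
  have "take k (?\<sigma> w) = ?\<sigma> (take k w)" for k w
    by (auto simp: swap_subtrees_def take_update_swap min_def list_update_beyond)
  with inv into show ?thesis
    unfolding tree_involution_def by (metis (no_types, lifting) length_list_update swap_subtrees_def)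
qed

lemma swap_subtrees_short: "length w \<le> length \<gamma> \<Longrightarrow> swap_subtrees \<gamma> i j w = w"
  by (simp add: swap_subtrees_def)

lemma swap_subtrees_child: "swap_subtrees \<gamma> i j (\<gamma> @ j # \<eta>) = \<gamma> @ i # \<eta>"
  by (simp add: swap_subtrees_def)

lemma relabel_in_cascade_space:
  assumes "tree_involution b \<sigma>" "\<omega> \<in> space (cascade_space b)"
  shows "\<omega> \<circ> \<sigma> \<in> space (cascade_space b)"
  using assms by (auto simp: space_cascade_space PiE_iff extensional_def tree_involutionD)

lemma measurable_relabel:
  assumes \<sigma>: "tree_involution b \<sigma>"
  shows "(\<lambda>\<omega>. \<omega> \<circ> \<sigma>) \<in> cascade_filtration b n \<rightarrow>\<^sub>M cascade_filtration b n"
  unfolding cascade_filtration_def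
  by (intro measurable_into_coord_algebra)
    (use \<sigma> in \<open>auto intro!: relabel_in_cascade_space measurable_coordinate simp: tree_involutionD\<close>)

context nonempty_cascade
begin

lemma offspring_law_relabel:
  "tree_involution b \<sigma> \<Longrightarrow> offspring_law (\<sigma> \<delta>) \<omega> = offspring_law \<delta> (\<omega> \<circ> \<sigma>)"
  by (simp add: offspring_law_def tree_involutionD)

text \<open>
  The law of the cascade is built from kernels that depend on a word only through its length and
  the weights along it, so it does not see a relabelling by a tree automorphism. By induction on
  the generation: the probability of a rectangle is the integral of a product of kernels over the
  past, and relabelling permutes the factors of this product.
\<close>

lemma relabel_invariance:
  assumes \<sigma>: "tree_involution b \<sigma>"
  shows "distr (restr_to_subalg P (\<F> n)) (restr_to_subalg P (\<F> n)) (\<lambda>\<omega>. \<omega> \<circ> \<sigma>) = restr_to_subalg P (\<F> n)"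
proof (induction n)
  let ?T = "\<lambda>\<omega> :: nat list \<Rightarrow> real. \<omega> \<circ> \<sigma>"
  let ?M = "\<lambda>n. restr_to_subalg P (\<F> n)"
  have sM: "sets (?M n) = sets (\<F> n)" and spM: "space (?M n) = \<Omega>" for n
    by (simp_all add: sets_restr_to_subalg[OF subalgebra_P_filtration] space_restr_to_subalg space_P)
  have T: "?T \<in> ?M n \<rightarrow>\<^sub>M ?M n" for n
    using measurable_relabel[OF \<sigma>, of n] measurable_cong_sets[OF sM sM] by blast
  {
    case 0
    show ?case
    proof (rule measure_eqI)
      fix B assume "B \<in> sets (distr (?M 0) (?M 0) ?T)"
      then have B: "B \<in> sets (\<F> 0)" by (simp add: sM)
      have "\<sigma> [] = []" using tree_involutionD(2)[OF \<sigma>, of "[]"] by simp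
      then have "?T \<omega> \<in> B \<longleftrightarrow> \<omega> \<in> B" if "\<omega> \<in> \<Omega>" for \<omega>
        by (intro coord_algebra_depends_only[OF B[unfolded cascade_filtration_def]
              relabel_in_cascade_space[OF \<sigma> that] that]) auto
      then have "?T -` B \<inter> space (?M 0) = B"
        using sets.sets_into_space[OF B] by (auto simp: spM)
      then show "emeasure (distr (?M 0) (?M 0) ?T) B = emeasure (?M 0) B"
        using B by (simp add: emeasure_distr[OF T] sM)
    qed simp
  next
    case (Suc n)
    have IH: "(\<integral>\<omega>. f (?T \<omega>) \<partial>P) = (\<integral>\<omega>. f \<omega> \<partial>P)" if f: "f \<in> borel_measurable (\<F> n)" for f :: "_ \<Rightarrow> real"
    proof -
      have "(\<integral>\<omega>. f \<omega> \<partial>P) = (\<integral>\<omega>. f \<omega> \<partial>distr (?M n) (?M n) ?T)"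
        unfolding Suc by (rule integral_subalgebra2[OF subalgebra_P_filtration f, symmetric])
      also have "\<dots> = (\<integral>\<omega>. f (?T \<omega>) \<partial>?M n)"
        by (rule integral_distr[OF T]) (rule measurable_in_subalg[OF subalgebra_P_filtration f])
      also have "\<dots> = (\<integral>\<omega>. f (?T \<omega>) \<partial>P)"
        by (rule integral_subalgebra2[OF subalgebra_P_filtration measurable_compose[OF measurable_relabel[OF \<sigma>] f]])
      finally show ?thesis by simp
    qed
    let ?G = "generation b (Suc n)" and ?E = "generation_events b (tree_words b) n"
    have Gw: "\<delta> \<in> tree_words b" "\<delta> \<noteq> []" if "\<delta> \<in> ?G" for \<delta> using that by (auto simp: generation_def)
    have G_eq: "tree_words b \<inter> ?G = ?G" using generation_subset by auto
    note gen = sets_coord_algebra_generation_events[OF order_refl, of b n, folded cascade_filtration_def]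
    have \<sigma>G: "\<sigma> ` ?G = ?G" "inj_on \<sigma> ?G"
    proof -
      have "\<sigma> \<delta> \<in> ?G" if "\<delta> \<in> ?G" for \<delta> using that by (simp add: generation_def tree_involutionD[OF \<sigma>])
      then show "\<sigma> ` ?G = ?G" using tree_involutionD(1)[OF \<sigma>] by (metis image_eqI subsetI image_subsetI subset_antisym)
      show "inj_on \<sigma> ?G" by (rule inj_on_inverseI[of _ \<sigma>]) (simp add: tree_involutionD(1)[OF \<sigma>])
    qed
    define H where "H B A \<omega> = indicator B \<omega> * (\<Prod>\<delta>\<in>?G. measure (offspring_law \<delta> \<omega>) (A \<delta>))" for B A \<omega>
    \<comment> \<open>integrating out the newest generation reduces a rectangle to a function of the past\<close>
    have P_event: "measure P (B \<inter> {\<omega> \<in> \<Omega>. \<forall>\<delta>\<in>?G. \<omega> \<delta> \<in> A \<delta>}) = (\<integral>\<omega>. H B A \<omega> \<partial>P)"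
      if B: "B \<in> sets (\<F> n)" and A: "\<And>\<delta>. A \<delta> \<in> sets nonneg_borel" for B A
    proof -
      interpret F: sigma_finite_subalgebra P "\<F> n" by (rule sigma_finite_subalgebraI[OF subalgebra_P_filtration])
      let ?X = "B \<inter> {\<omega> \<in> \<Omega>. \<forall>\<delta>\<in>?G. \<omega> \<delta> \<in> A \<delta>}"
      have "?X \<in> ?E" unfolding generation_events_def G_eq using B A
        by (intro CollectI exI[of _ B] exI[of _ A]) (simp add: cascade_filtration_def)
      then have XP: "?X \<in> sets P" using gen(1) subalgebra_P_filtration[of "Suc n"] by (auto simp: subalgebra_def)
      then have "measure P ?X = (\<integral>\<omega>. indicator ?X \<omega> \<partial>P)" by simp
      also have "\<dots> = (\<integral>\<omega>. real_cond_exp P (\<F> n) (indicator ?X) \<omega> \<partial>P)"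
        using XP by (intro F.real_cond_exp_int(2)[symmetric]) (auto simp: less_top[symmetric])
      also have "\<dots> = (\<integral>\<omega>. H B A \<omega> \<partial>P)"
      proof (rule integral_cong_AE)
        have "B \<in> sets P" using B subalgebra_P_filtration by (auto simp: subalgebra_def)
        then show "H B A \<in> borel_measurable P"
          unfolding H_def by (rule borel_measurable_integrable[OF integrable_bounded_generation_term]) (use A in auto)
        show "AE \<omega> in P. real_cond_exp P (\<F> n) (indicator ?X) \<omega> = H B A \<omega>"
          unfolding H_def by (rule generation_event_cond_exp[OF B order_refl A])
      qed simp
      finally show ?thesis .
    qed
    have eq: "measure P (?T -` X \<inter> \<Omega>) = measure P X" if "X \<in> ?E" for X
    proof -
      from that obtain B A where X: "X = B \<inter> {\<omega> \<in> \<Omega>. \<forall>\<delta>\<in>?G. \<omega> \<delta> \<in> A \<delta>}"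
        and B: "B \<in> sets (\<F> n)" and A: "\<And>\<delta>. A \<delta> \<in> sets nonneg_borel"
        unfolding generation_events_def G_eq cascade_filtration_def by blast
      let ?B = "?T -` B \<inter> \<Omega>"
      have TB: "?B \<in> sets (\<F> n)" using measurable_sets[OF measurable_relabel[OF \<sigma>] B] by simp
      have "(\<forall>\<delta>\<in>?G. \<omega> (\<sigma> \<delta>) \<in> A \<delta>) \<longleftrightarrow> (\<forall>\<delta>\<in>?G. \<omega> \<delta> \<in> A (\<sigma> \<delta>))" for \<omega> :: "nat list \<Rightarrow> real"
        using \<sigma>G(1) tree_involutionD(1)[OF \<sigma>] by (metis imageI)
      then have "?T -` X \<inter> \<Omega> = ?B \<inter> {\<omega> \<in> \<Omega>. \<forall>\<delta>\<in>?G. \<omega> \<delta> \<in> A (\<sigma> \<delta>)}"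
        unfolding X using relabel_in_cascade_space[OF \<sigma>] by auto
      then have "measure P (?T -` X \<inter> \<Omega>) = (\<integral>\<omega>. H ?B (\<lambda>\<delta>. A (\<sigma> \<delta>)) \<omega> \<partial>P)"
        using P_event[OF TB, of "\<lambda>\<delta>. A (\<sigma> \<delta>)"] A by simp
      also have "\<dots> = (\<integral>\<omega>. H B A (?T \<omega>) \<partial>P)"
      proof (rule Bochner_Integration.integral_cong)
        fix \<omega> assume "\<omega> \<in> space P"
        have "(\<Prod>\<delta>\<in>?G. measure (offspring_law \<delta> (?T \<omega>)) (A \<delta>))
            = (\<Prod>\<delta>\<in>?G. measure (offspring_law (\<sigma> \<delta>) \<omega>) (A (\<sigma> (\<sigma> \<delta>))))"
          by (simp add: offspring_law_relabel[OF \<sigma>] tree_involutionD[OF \<sigma>])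
        also have "\<dots> = (\<Prod>\<delta>\<in>?G. measure (offspring_law \<delta> \<omega>) (A (\<sigma> \<delta>)))"
          by (rule prod.reindex_cong[OF \<sigma>G(2), symmetric]) (simp_all add: \<sigma>G(1))
        finally show "H ?B (\<lambda>\<delta>. A (\<sigma> \<delta>)) \<omega> = H B A (?T \<omega>)"
          using \<open>\<omega> \<in> space P\<close> by (simp add: H_def indicator_def space_P)
      qed simp
      also have "\<dots> = (\<integral>\<omega>. H B A \<omega> \<partial>P)"
      proof (rule IH)
        have "(\<lambda>\<omega>. measure (offspring_law \<delta> \<omega>) (A \<delta>)) \<in> borel_measurable (\<F> n)" if "\<delta> \<in> ?G" for \<delta>
          unfolding cascade_filtration_def using Gw[OF that] that
          by (intro measurable_measure_offspring_law A) (auto simp: generation_def intro: take_tree_words)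
        then show "H B A \<in> borel_measurable (\<F> n)"
          unfolding H_def using B by (intro borel_measurable_times borel_measurable_prod borel_measurable_indicator) auto
      qed
      also have "\<dots> = measure P X" unfolding X by (rule P_event[OF B A, symmetric])
      finally show ?thesis .
    qed
    show ?case
    proof (rule measure_eqI_generator_eq[of ?E \<Omega> _ _ "\<lambda>_. \<Omega>"])
      show "Int_stable ?E" by (rule Int_stable_generation_events)
      show "?E \<subseteq> Pow \<Omega>" unfolding generation_events_def by auto
      fix X assume X: "X \<in> ?E"
      then have XF: "X \<in> sets (\<F> (Suc n))" using gen(1) by auto
      have TX: "?T -` X \<inter> \<Omega> \<in> sets (\<F> (Suc n))" using measurable_sets[OF measurable_relabel[OF \<sigma>] XF] by simp
      show "emeasure (distr (?M (Suc n)) (?M (Suc n)) ?T) X = emeasure (?M (Suc n)) X"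
        using XF TX eq[OF X] by (simp add: emeasure_distr[OF T] sM spM
            emeasure_restr_to_subalg[OF subalgebra_P_filtration] emeasure_eq_measure)
    next
      have "emeasure (distr (?M (Suc n)) (?M (Suc n)) ?T) \<Omega> = emeasure P \<Omega>"
        using sets.top[of "\<F> (Suc n)"] measurable_sets[OF measurable_relabel[OF \<sigma>] sets.top, of "Suc n"]
          relabel_in_cascade_space[OF \<sigma>]
        by (simp add: emeasure_distr[OF T] sM spM
            emeasure_restr_to_subalg[OF subalgebra_P_filtration] Int_absorb1 subset_iff)
      then show "emeasure (distr (?M (Suc n)) (?M (Suc n)) ?T) \<Omega> \<noteq> \<infinity>" by simp
    qed (use gen(2,3) in \<open>auto simp: sM\<close>)
  }
qed

lemma integral_relabel:
  assumes \<sigma>: "tree_involution b \<sigma>" and f: "f \<in> borel_measurable (\<F> n)" "integrable P f"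
  shows "integrable P (\<lambda>\<omega>. f (\<omega> \<circ> \<sigma>))" "(\<integral>\<omega>. f (\<omega> \<circ> \<sigma>) \<partial>P) = (\<integral>\<omega>. f \<omega> \<partial>P :: real)"
proof -
  let ?M = "restr_to_subalg P (\<F> n)" and ?T = "\<lambda>\<omega> :: nat list \<Rightarrow> real. \<omega> \<circ> \<sigma>"
  have s: "sets ?M = sets (\<F> n)" by (rule sets_restr_to_subalg[OF subalgebra_P_filtration])
  have T: "?T \<in> ?M \<rightarrow>\<^sub>M ?M"
    using measurable_relabel[OF \<sigma>, of n] measurable_cong_sets[OF s s] by blast
  have fT: "(\<lambda>\<omega>. f (?T \<omega>)) \<in> borel_measurable (\<F> n)" by (rule measurable_compose[OF measurable_relabel[OF \<sigma>] f(1)])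
  have fM: "f \<in> borel_measurable ?M" by (rule measurable_in_subalg[OF subalgebra_P_filtration f(1)])
  have "integrable (distr ?M ?M ?T) f"
    unfolding relabel_invariance[OF \<sigma>] by (rule integrable_in_subalg[OF subalgebra_P_filtration f])
  then show "integrable P (\<lambda>\<omega>. f (?T \<omega>))"
    using integrable_distr_eq[OF T fM] by (auto intro: integrable_from_subalg[OF subalgebra_P_filtration])
  have "(\<integral>\<omega>. f \<omega> \<partial>P) = (\<integral>\<omega>. f \<omega> \<partial>distr ?M ?M ?T)"
    unfolding relabel_invariance[OF \<sigma>] by (rule integral_subalgebra2[OF subalgebra_P_filtration f(1), symmetric])
  also have "\<dots> = (\<integral>\<omega>. f (?T \<omega>) \<partial>?M)" by (rule integral_distr[OF T fM])
  also have "\<dots> = (\<integral>\<omega>. f (?T \<omega>) \<partial>P)" by (rule integral_subalgebra2[OF subalgebra_P_filtration fT])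
  finally show "(\<integral>\<omega>. f (\<omega> \<circ> \<sigma>) \<partial>P) = (\<integral>\<omega>. f \<omega> \<partial>P)" by simp
qed

text \<open>
  A relabelling that fixes the first \<open>n\<close> generations also fixes the events of \<open>\<F>\<^sub>n\<close>, so invariance of
  \<open>P\<close> becomes invariance of conditional expectations given \<open>\<F>\<^sub>n\<close>.
\<close>

lemma real_cond_exp_relabel:
  assumes \<sigma>: "tree_involution b \<sigma>" "\<And>w. length w \<le> n \<Longrightarrow> \<sigma> w = w" and nm: "n \<le> m"
    and X: "X \<in> borel_measurable (\<F> m)" "integrable P X"
  shows "AE \<omega> in P. real_cond_exp P (\<F> n) (\<lambda>\<omega>. X (\<omega> \<circ> \<sigma>)) \<omega> = real_cond_exp P (\<F> n) X \<omega>"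
proof -
  interpret F: sigma_finite_subalgebra P "\<F> n" by (rule sigma_finite_subalgebraI[OF subalgebra_P_filtration])
  show ?thesis
  proof (rule F.real_cond_exp_charact)
    fix B assume B: "B \<in> sets (\<F> n)"
    then have Bm: "B \<in> sets (\<F> m)" using filtration_mono[OF nm] by auto
    then have BP: "B \<in> sets P" using subalgebra_P_filtration by (auto simp: subalgebra_def)
    have ind: "indicator B (\<omega> \<circ> \<sigma>) = (indicator B \<omega> :: real)" if "\<omega> \<in> \<Omega>" for \<omega>
      using coord_algebra_depends_only[OF B[unfolded cascade_filtration_def] relabel_in_cascade_space[OF \<sigma>(1) that] that]
      by (simp add: \<sigma>(2) indicator_def)
    have "(\<integral>\<omega>. indicator B \<omega> * X (\<omega> \<circ> \<sigma>) \<partial>P) = (\<integral>\<omega>. indicator B (\<omega> \<circ> \<sigma>) * X (\<omega> \<circ> \<sigma>) \<partial>P)"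
      by (intro Bochner_Integration.integral_cong) (auto simp: ind space_P)
    also have "\<dots> = (\<integral>\<omega>. indicator B \<omega> * X \<omega> \<partial>P)"
      using Bm X BP integrable_mult_indicator[OF BP X(2)]
      by (intro integral_relabel(2)[OF \<sigma>(1), of "\<lambda>\<omega>. indicator B \<omega> * X \<omega>" m]) auto
    finally show "(\<integral>\<omega>\<in>B. X (\<omega> \<circ> \<sigma>) \<partial>P) = (\<integral>\<omega>\<in>B. real_cond_exp P (\<F> n) X \<omega> \<partial>P)"
      using F.real_cond_exp_intA[OF X(2) B] by (simp add: set_lebesgue_integral_def)
  qed (use X integral_relabel(1)[OF \<sigma>(1) X] in auto)
qed

end

section \<open>The cascade martingale\<close>

definition path_product :: "nat list \<Rightarrow> (nat list \<Rightarrow> real) \<Rightarrow> real" where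
  "path_product \<gamma> \<omega> = (\<Prod>j\<le>length \<gamma>. \<omega> (take j \<gamma>))"

lemma cascade_eq_path_product: "cascade n t \<omega> = path_product (prefix_of t n) \<omega>"
  by (simp add: cascade_def path_product_def take_prefix_of)

lemma path_product_snoc: "path_product (\<gamma> @ [i]) \<omega> = path_product \<gamma> \<omega> * \<omega> (\<gamma> @ [i])"
  by (simp add: path_product_def)

lemma path_product_nonneg: "\<omega> \<in> space (cascade_space b) \<Longrightarrow> \<gamma> \<in> tree_words b \<Longrightarrow> 0 \<le> path_product \<gamma> \<omega>"
  unfolding path_product_def by (intro prod_nonneg) (auto intro: cascade_space_nonneg take_tree_words)

lemma path_product_relabel: "tree_involution b \<sigma> \<Longrightarrow> path_product \<gamma> (\<omega> \<circ> \<sigma>) = path_product (\<sigma> \<gamma>) \<omega>"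
  by (simp add: path_product_def tree_involutionD)

lemma measurable_path_product:
  "(\<And>j. take j \<gamma> \<in> K) \<Longrightarrow> path_product \<gamma> \<in> borel_measurable (coord_algebra b K)"
  unfolding path_product_def by (intro borel_measurable_prod measurable_coordinate) auto

lemma measurable_path_product_path: "path_product \<gamma> \<in> borel_measurable (path_algebra b \<gamma>)"
proof -
  have "take j \<gamma> \<in> {take j \<gamma> | j. j \<le> length \<gamma>}" for j
    by (cases "j \<le> length \<gamma>") (auto intro: exI[of _ j] exI[of _ "length \<gamma>"])
  then show ?thesis
    unfolding path_algebra_def by (rule measurable_path_product)
qed

lemma measurable_path_product_filtration:
  "\<gamma> \<in> tree_words b \<Longrightarrow> length \<gamma> \<le> n \<Longrightarrow> path_product \<gamma> \<in> borel_measurable (cascade_filtration b n)"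
  unfolding cascade_filtration_def by (rule measurable_path_product) (auto intro: take_tree_words)

context nonempty_cascade
begin

lemma nn_integral_offspring_law:
  assumes d: "\<delta> \<in> tree_words b" "\<delta> \<noteq> []" and w: "\<omega> \<in> \<Omega>"
  shows "(\<integral>\<^sup>+y. ennreal y \<partial>offspring_law \<delta> \<omega>) = 1"
proof -
  have s: "space (offspring_law \<delta> \<omega>) = {0..}"
    using sets_eq_imp_space_eq[OF offspring_law_space(2)[OF d w]] by (simp add: space_restrict_space)
  have "(\<lambda>j\<in>{..<length \<delta>}. \<omega> (take j \<delta>)) \<in> space (PiM {..<length \<delta>} (\<lambda>_. nonneg_borel))"
    using d(1) w by (auto simp: space_PiM space_restrict_space intro!: cascade_space_nonneg take_tree_words)
  then have m: "has_bochner_integral (offspring_law \<delta> \<omega>) (\<lambda>y. y) 1"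
    unfolding offspring_law_def using d(2) by (intro kernel_mean) (cases \<delta>, auto)
  then have "(\<integral>\<^sup>+y. ennreal y \<partial>offspring_law \<delta> \<omega>) = ennreal (\<integral>y. y \<partial>offspring_law \<delta> \<omega>)"
    by (intro nn_integral_eq_integral AE_I2) (auto simp: s dest: integrable.intros)
  with m show ?thesis by (simp add: has_bochner_integral_iff)
qed

text \<open>
  The conditional law tested against a nonnegative weight from the past, which need not be bounded
  or integrable. The formulation with extended nonnegative integrals avoids integrability
  conditions as long as integrability of the cascade is not known.
\<close>

lemma nn_integral_cond_law:
  assumes d: "\<delta> \<in> generation b (Suc n)" and A: "A \<in> sets nonneg_borel" and f: "f \<in> borel_measurable (\<F> n)"
  shows "(\<integral>\<^sup>+\<omega>. f \<omega> * indicator A (\<omega> \<delta>) \<partial>P) = (\<integral>\<^sup>+\<omega>. f \<omega> * emeasure (offspring_law \<delta> \<omega>) A \<partial>P)"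
proof -
  interpret F: sigma_finite_subalgebra P "\<F> n" by (rule sigma_finite_subalgebraI[OF subalgebra_P_filtration])
  have dw: "\<delta> \<in> tree_words b" "\<delta> \<noteq> []" using d by (auto simp: generation_def)
  let ?g = "\<lambda>\<omega>. measure (offspring_law \<delta> \<omega>) A"
  have gF: "?g \<in> borel_measurable (\<F> n)"
    unfolding cascade_filtration_def using d A
    by (intro measurable_measure_offspring_law) (auto simp: generation_def intro: take_tree_words)
  then have [measurable]: "?g \<in> borel_measurable P" by (rule measurable_P_of_filtration)
  have [measurable]: "(\<lambda>\<omega>. indicator A (\<omega> \<delta>) :: real) \<in> borel_measurable P"
    "(\<lambda>\<omega>. indicator A (\<omega> \<delta>) :: ennreal) \<in> borel_measurable P"
    by (rule measurable_compose[OF measurable_coordinate_P[OF dw(1)] borel_measurable_indicator[OF A]])+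
  have iA: "integrable P (\<lambda>\<omega>. indicator A (\<omega> \<delta>) :: real)"
    by (rule integrable_const_bound[where B = 1], rule AE_I2) (simp add: indicator_def, measurable)
  have ig: "integrable P ?g"
    by (rule integrable_const_bound[where B = 1])
      (auto simp: space_P intro!: AE_I2 prob_space.prob_le_1 offspring_law_space dw)
  have "AE \<omega> in P. ennreal (?g \<omega>) = nn_cond_exp P (\<F> n) (\<lambda>\<omega>. indicator A (\<omega> \<delta>)) \<omega>"
  proof (rule F.nn_cond_exp_charact)
    fix B assume B: "B \<in> sets (\<F> n)"
    then have BP: "B \<in> sets P" using subalgebra_P_filtration by (auto simp: subalgebra_def)
    have nn: "(\<integral>\<^sup>+\<omega>\<in>B. ennreal (h \<omega>) \<partial>P) = ennreal (\<integral>\<omega>\<in>B. h \<omega> \<partial>P)"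
      if "integrable P h" "\<And>\<omega>. 0 \<le> h \<omega>" for h
      using that integrable_mult_indicator[OF BP that(1)] unfolding set_lebesgue_integral_def
      by (subst nn_integral_eq_integral[symmetric]) (auto intro!: nn_integral_cong simp: indicator_def)
    have "(\<integral>\<omega>\<in>B. indicator A (\<omega> \<delta>) \<partial>P) = (\<integral>\<omega>\<in>B. real_cond_exp P (\<F> n) (\<lambda>\<omega>. indicator A (\<omega> \<delta>)) \<omega> \<partial>P)"
      by (rule F.real_cond_exp_intA[OF iA B])
    also have "\<dots> = (\<integral>\<omega>\<in>B. ?g \<omega> \<partial>P)"
      using cond_law_word[OF d A] BP by (intro set_lebesgue_integral_cong_AE) auto
    finally show "(\<integral>\<^sup>+\<omega>\<in>B. indicator A (\<omega> \<delta>) \<partial>P) = (\<integral>\<^sup>+\<omega>\<in>B. ennreal (?g \<omega>) \<partial>P)"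
      using nn[OF iA] nn[OF ig] by (simp add: ennreal_indicator)
  qed (use gF in auto)
  then have "(\<integral>\<^sup>+\<omega>. f \<omega> * ennreal (?g \<omega>) \<partial>P) = (\<integral>\<^sup>+\<omega>. f \<omega> * nn_cond_exp P (\<F> n) (\<lambda>\<omega>. indicator A (\<omega> \<delta>)) \<omega> \<partial>P)"
    by (intro nn_integral_cong_AE) (auto elim!: eventually_mono)
  also have "\<dots> = (\<integral>\<^sup>+\<omega>. f \<omega> * indicator A (\<omega> \<delta>) \<partial>P)"
    by (rule F.nn_cond_exp_intg[OF f]) simp
  also have "(\<integral>\<^sup>+\<omega>. f \<omega> * ennreal (?g \<omega>) \<partial>P) = (\<integral>\<^sup>+\<omega>. f \<omega> * emeasure (offspring_law \<delta> \<omega>) A \<partial>P)"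
    using offspring_law_space(1)[OF dw]
    by (intro nn_integral_cong) (simp add: space_P finite_measure.emeasure_eq_measure prob_space_def)
  finally show ?thesis by simp
qed

text \<open>
  Weighting \<open>P\<close> by a function \<open>f\<close> of the past, the law of the new weight is the kernel averaged over
  the weighted past; all kernels have mean one.
\<close>

lemma nn_integral_child:
  assumes d: "\<delta> \<in> generation b (Suc n)" and f: "f \<in> borel_measurable (\<F> n)"
  shows "(\<integral>\<^sup>+\<omega>. f \<omega> * ennreal (\<omega> \<delta>) \<partial>P) = (\<integral>\<^sup>+\<omega>. f \<omega> \<partial>P)"
proof -
  have dw: "\<delta> \<in> tree_words b" "\<delta> \<noteq> []" using d by (auto simp: generation_def)
  have fP: "f \<in> borel_measurable P" by (rule measurable_P_of_filtration[OF f])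
  let ?D = "density P f"
  have c: "(\<lambda>\<omega>. \<omega> \<delta>) \<in> ?D \<rightarrow>\<^sub>M nonneg_borel" using measurable_coordinate_P[OF dw(1)] by simp
  have oP: "offspring_law \<delta> \<in> P \<rightarrow>\<^sub>M prob_algebra nonneg_borel"
    by (rule measurable_from_subalg[OF subalgebra_P_coord[OF order_refl] measurable_offspring_law])
      (use dw in \<open>auto intro: take_tree_words\<close>)
  then have o: "offspring_law \<delta> \<in> ?D \<rightarrow>\<^sub>M subprob_algebra nonneg_borel"
    by (auto dest: measurable_prob_algebraD)
  have ne: "space ?D \<noteq> {}" using not_empty by simp
  \<comment> \<open>the disintegration of the joint law, stated for the weighted measure \<open>?D\<close>\<close>
  have "distr ?D nonneg_borel (\<lambda>\<omega>. \<omega> \<delta>) = ?D \<bind> offspring_law \<delta>"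
  proof (rule measure_eqI)
    show "sets (distr ?D nonneg_borel (\<lambda>\<omega>. \<omega> \<delta>)) = sets (?D \<bind> offspring_law \<delta>)"
      by (simp add: sets_bind_measurable[OF o ne])
    fix A assume "A \<in> sets (distr ?D nonneg_borel (\<lambda>\<omega>. \<omega> \<delta>))"
    then have A: "A \<in> sets nonneg_borel" by simp
    have "emeasure (distr ?D nonneg_borel (\<lambda>\<omega>. \<omega> \<delta>)) A = (\<integral>\<^sup>+\<omega>. indicator A (\<omega> \<delta>) \<partial>?D)"
      by (subst nn_integral_distr[OF c, symmetric]) (use A in simp_all)
    also have "\<dots> = (\<integral>\<^sup>+\<omega>. f \<omega> * indicator A (\<omega> \<delta>) \<partial>P)"
      using measurable_compose[OF measurable_coordinate_P[OF dw(1)] borel_measurable_indicator[OF A]]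
      by (intro nn_integral_density fP) auto
    also have "\<dots> = (\<integral>\<^sup>+\<omega>. f \<omega> * emeasure (offspring_law \<delta> \<omega>) A \<partial>P)" by (rule nn_integral_cond_law[OF d A f])
    also have "\<dots> = (\<integral>\<^sup>+\<omega>. emeasure (offspring_law \<delta> \<omega>) A \<partial>?D)"
      by (intro nn_integral_density[symmetric] fP
          measurable_compose[OF measurable_prob_algebraD[OF oP] measurable_emeasure_subprob_algebra[OF A]])
    also have "\<dots> = emeasure (?D \<bind> offspring_law \<delta>) A" by (rule emeasure_bind[OF ne o A, symmetric])
    finally show "emeasure (distr ?D nonneg_borel (\<lambda>\<omega>. \<omega> \<delta>)) A = emeasure (?D \<bind> offspring_law \<delta>) A" .
  qed
  note eq = this
  have id: "ennreal \<in> borel_measurable nonneg_borel" by (intro measurable_restrict_space1) simp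
  have cm: "(\<lambda>\<omega>. ennreal (\<omega> \<delta>)) \<in> borel_measurable P"
    using measurable_compose[OF measurable_coordinate_P[OF dw(1)] id] by simp
  have "(\<integral>\<^sup>+\<omega>. f \<omega> * ennreal (\<omega> \<delta>) \<partial>P) = (\<integral>\<^sup>+\<omega>. ennreal (\<omega> \<delta>) \<partial>?D)"
    by (rule nn_integral_density[symmetric]) (use fP cm in auto)
  also have "\<dots> = (\<integral>\<^sup>+y. ennreal y \<partial>distr ?D nonneg_borel (\<lambda>\<omega>. \<omega> \<delta>))"
    by (rule nn_integral_distr[OF c, symmetric]) (use id in simp)
  also have "\<dots> = (\<integral>\<^sup>+\<omega>. \<integral>\<^sup>+y. ennreal y \<partial>offspring_law \<delta> \<omega> \<partial>?D)"
    unfolding eq by (rule nn_integral_bind[OF id o])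
  also have "\<dots> = (\<integral>\<^sup>+\<omega>. 1 \<partial>?D)"
    by (intro nn_integral_cong) (simp add: nn_integral_offspring_law[OF dw] space_P)
  also have "\<dots> = (\<integral>\<^sup>+\<omega>. f \<omega> * 1 \<partial>P)" by (rule nn_integral_density) (use fP in auto)
  finally show ?thesis by simp
qed

lemma nn_integral_path_product:
  assumes w: "\<gamma> @ \<eta> \<in> tree_words b" and f: "f \<in> borel_measurable (\<F> (length \<gamma>))"
  shows "(\<integral>\<^sup>+\<omega>. f \<omega> * ennreal (path_product (\<gamma> @ \<eta>) \<omega>) \<partial>P) = (\<integral>\<^sup>+\<omega>. f \<omega> * ennreal (path_product \<gamma> \<omega>) \<partial>P)"
  using w
proof (induction \<eta> rule: rev_induct)
  case (snoc i \<eta>)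
  let ?n = "length (\<gamma> @ \<eta>)"
  have w: "\<gamma> @ \<eta> \<in> tree_words b" "(\<gamma> @ \<eta>) @ [i] \<in> tree_words b" using snoc.prems by (auto simp: append_tree_words)
  have "(\<integral>\<^sup>+\<omega>. f \<omega> * ennreal (path_product (\<gamma> @ \<eta> @ [i]) \<omega>) \<partial>P)
      = (\<integral>\<^sup>+\<omega>. (f \<omega> * ennreal (path_product (\<gamma> @ \<eta>) \<omega>)) * ennreal (\<omega> ((\<gamma> @ \<eta>) @ [i])) \<partial>P)"
  proof (rule nn_integral_cong)
    fix \<omega> assume "\<omega> \<in> space P"
    then have "0 \<le> path_product (\<gamma> @ \<eta>) \<omega>" "0 \<le> \<omega> ((\<gamma> @ \<eta>) @ [i])"
      using w by (auto simp: space_P intro: path_product_nonneg cascade_space_nonneg)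
    then show "f \<omega> * ennreal (path_product (\<gamma> @ \<eta> @ [i]) \<omega>)
        = (f \<omega> * ennreal (path_product (\<gamma> @ \<eta>) \<omega>)) * ennreal (\<omega> ((\<gamma> @ \<eta>) @ [i]))"
      using path_product_snoc[of "\<gamma> @ \<eta>" i \<omega>] by (simp add: ennreal_mult mult.assoc)
  qed
  also have "\<dots> = (\<integral>\<^sup>+\<omega>. f \<omega> * ennreal (path_product (\<gamma> @ \<eta>) \<omega>) \<partial>P)"
  proof (rule nn_integral_child)
    show "(\<gamma> @ \<eta>) @ [i] \<in> generation b (Suc ?n)" using w(2) by (simp add: generation_def)
    have "f \<in> borel_measurable (\<F> ?n)"
      by (rule measurable_from_subalg[OF subalgebra_filtration_mono f]) simp
    then show "(\<lambda>\<omega>. f \<omega> * ennreal (path_product (\<gamma> @ \<eta>) \<omega>)) \<in> borel_measurable (\<F> ?n)"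
      using measurable_path_product_filtration[OF w(1), of ?n] by (intro borel_measurable_times_ennreal) auto
  qed
  also have "\<dots> = (\<integral>\<^sup>+\<omega>. f \<omega> * ennreal (path_product \<gamma> \<omega>) \<partial>P)" by (rule snoc.IH[OF w(1)])
  finally show ?case .
qed simp

lemma Nil_tree_words [simp]: "[] \<in> tree_words b"
  by (simp add: tree_words_def)

lemma measurable_path_product_P: "\<gamma> \<in> tree_words b \<Longrightarrow> path_product \<gamma> \<in> borel_measurable P"
  by (rule measurable_P_of_filtration[OF measurable_path_product_filtration[OF _ order_refl]])

lemma integrable_path_product:
  assumes w: "\<gamma> \<in> tree_words b"
  shows "integrable P (path_product \<gamma>)"
proof (rule integrableI_nonneg)
  have sp0: "space p0 = {0..}" using sets_eq_imp_space_eq[OF sets_p0] by (simp add: space_restrict_space)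
  have id: "ennreal \<in> borel_measurable nonneg_borel" by (intro measurable_restrict_space1) simp
  have "(\<integral>\<^sup>+\<omega>. ennreal (path_product \<gamma> \<omega>) \<partial>P) = (\<integral>\<^sup>+\<omega>. ennreal (\<omega> []) \<partial>P)"
    using nn_integral_path_product[of "[]" \<gamma> "\<lambda>_. 1"] w by (simp add: path_product_def)
  also have "\<dots> = (\<integral>\<^sup>+x. ennreal x \<partial>p0)"
    unfolding law_root[symmetric] by (rule nn_integral_distr[symmetric]) (use measurable_coordinate_P id in auto)
  also have "\<dots> = ennreal (\<integral>x. x \<partial>p0)"
    by (intro nn_integral_eq_integral integrable_p0 AE_I2) (simp add: sp0)
  finally show "(\<integral>\<^sup>+\<omega>. ennreal (path_product \<gamma> \<omega>) \<partial>P) < \<infinity>" by simp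
  show "AE \<omega> in P. 0 \<le> path_product \<gamma> \<omega>"
    by (intro AE_I2) (simp add: space_P path_product_nonneg[OF _ w])
qed (rule measurable_path_product_P[OF w])

lemma real_cond_exp_path_product:
  assumes w: "\<gamma> @ \<eta> \<in> tree_words b"
  shows "AE \<omega> in P. real_cond_exp P (\<F> (length \<gamma>)) (path_product (\<gamma> @ \<eta>)) \<omega> = path_product \<gamma> \<omega>"
proof -
  interpret F: sigma_finite_subalgebra P "\<F> (length \<gamma>)" by (rule sigma_finite_subalgebraI[OF subalgebra_P_filtration])
  have w': "\<gamma> \<in> tree_words b" using w by (simp add: append_tree_words)
  show ?thesis
  proof (rule F.real_cond_exp_charact)
    fix B assume B: "B \<in> sets (\<F> (length \<gamma>))"
    then have BP: "B \<in> sets P" using subalgebra_P_filtration by (auto simp: subalgebra_def)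
    have nn: "(\<integral>\<omega>\<in>B. path_product \<delta> \<omega> \<partial>P) = enn2real (\<integral>\<^sup>+\<omega>. indicator B \<omega> * ennreal (path_product \<delta> \<omega>) \<partial>P)"
      if d: "\<delta> \<in> tree_words b" for \<delta>
    proof -
      have "(\<integral>\<omega>\<in>B. path_product \<delta> \<omega> \<partial>P) = enn2real (\<integral>\<^sup>+\<omega>. ennreal (indicator B \<omega> * path_product \<delta> \<omega>) \<partial>P)"
        unfolding set_lebesgue_integral_def using measurable_path_product_P[OF d] BP
        by (subst integral_eq_nn_integral) (auto simp: space_P path_product_nonneg[OF _ d] intro!: AE_I2)
      also have "(\<integral>\<^sup>+\<omega>. ennreal (indicator B \<omega> * path_product \<delta> \<omega>) \<partial>P)
          = (\<integral>\<^sup>+\<omega>. indicator B \<omega> * ennreal (path_product \<delta> \<omega>) \<partial>P)"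
        by (intro nn_integral_cong) (auto simp: indicator_def)
      finally show ?thesis .
    qed
    show "(\<integral>\<omega>\<in>B. path_product (\<gamma> @ \<eta>) \<omega> \<partial>P) = (\<integral>\<omega>\<in>B. path_product \<gamma> \<omega> \<partial>P)"
      using nn[OF w] nn[OF w'] nn_integral_path_product[OF w borel_measurable_indicator[OF B]] by simp
  qed (use w w' integrable_path_product measurable_path_product_filtration in auto)
qed

text \<open>
  The mass of \<open>\<Delta>\<^sub>\<gamma>\<close> under the cascade measure of generation \<open>|\<gamma>| + k\<close>, as an explicit sum over the
  descendants of \<open>\<gamma>\<close>. Counting generations from \<open>\<gamma>\<close> on makes the sum range over words of length \<open>k\<close>
  independently of \<open>\<gamma>\<close>, so that sibling masses correspond term by term.
\<close>

definition mass :: "nat list \<Rightarrow> nat \<Rightarrow> (nat list \<Rightarrow> real) \<Rightarrow> real" where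
  "mass \<gamma> k \<omega> = (\<Sum>\<eta>\<in>generation b k. path_product (\<gamma> @ \<eta>) \<omega> / real b ^ (length \<gamma> + k))"

lemma mass_eq_process_measure:
  assumes w: "\<gamma> \<in> tree_words b" and \<omega>: "\<omega> \<in> \<Omega>"
  shows "measure (process_measure b cascade (length \<gamma> + k) \<omega>) (cylinder b \<gamma>) = mass \<gamma> k \<omega>"
proof -
  have gw: "\<gamma> @ \<eta> \<in> tree_words b" "length \<eta> = k" if "\<eta> \<in> generation b k" for \<eta>
    using that w by (auto simp: generation_def append_tree_words)
  have "measure (process_measure b cascade (length \<gamma> + k) \<omega>) (cylinder b \<gamma>)
      = (\<Sum>\<eta>\<in>generation b k. path_product (\<gamma> @ \<eta>) \<omega> * measure (tree_measure b) (cylinder b (\<gamma> @ \<eta>)))"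
    using w \<omega> by (intro measure_process_measure_cylinder[where g = "\<lambda>\<delta>. path_product \<delta> \<omega>"] b_pos)
      (auto simp: cascade_eq_path_product generation_def intro: path_product_nonneg)
  also have "\<dots> = mass \<gamma> k \<omega>"
    unfolding mass_def by (intro sum.cong) (auto simp: measure_cylinder[OF b_pos] gw)
  finally show ?thesis .
qed

lemma mass_nonneg: "\<gamma> \<in> tree_words b \<Longrightarrow> \<omega> \<in> \<Omega> \<Longrightarrow> 0 \<le> mass \<gamma> k \<omega>"
  unfolding mass_def
  by (intro sum_nonneg divide_nonneg_nonneg path_product_nonneg) (auto simp: generation_def append_tree_words)

lemma measurable_mass:
  assumes "\<And>\<eta> j. \<eta> \<in> generation b k \<Longrightarrow> take j (\<gamma> @ \<eta>) \<in> K"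
  shows "mass \<gamma> k \<in> borel_measurable (coord_algebra b K)"
  unfolding mass_def
  by (intro borel_measurable_sum borel_measurable_divide borel_measurable_const measurable_path_product assms)

lemma measurable_mass_filtration:
  "\<gamma> \<in> tree_words b \<Longrightarrow> mass \<gamma> k \<in> borel_measurable (\<F> (length \<gamma> + k))"
  unfolding cascade_filtration_def
  by (rule measurable_mass) (auto simp: generation_def append_tree_words intro!: take_tree_words simp del: take_append)

text \<open>
  All \<open>b\<^sup>k\<close> descendants contribute equally, and the normalisation cancels their number.
\<close>

lemma nn_integral_mass:
  assumes w: "\<gamma> \<in> tree_words b" and f: "f \<in> borel_measurable (\<F> (length \<gamma>))"
  shows "(\<integral>\<^sup>+\<omega>. f \<omega> * ennreal (mass \<gamma> k \<omega>) \<partial>P) = (\<integral>\<^sup>+\<omega>. f \<omega> * ennreal (path_product \<gamma> \<omega> / real b ^ length \<gamma>) \<partial>P)"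
proof -
  have gw: "\<gamma> @ \<eta> \<in> tree_words b" if "\<eta> \<in> generation b k" for \<eta>
    using that w by (auto simp: generation_def append_tree_words)
  have fP [measurable]: "f \<in> borel_measurable P" by (rule measurable_P_of_filtration[OF f])
  have m: "(\<lambda>\<omega>. f \<omega> * ennreal (path_product \<delta> \<omega>)) \<in> borel_measurable P" if "\<delta> \<in> tree_words b" for \<delta>
    using measurable_path_product_P[OF that] by measurable
  have c: "0 \<le> 1 / real b ^ m" for m by simp
  have "(\<integral>\<^sup>+\<omega>. f \<omega> * ennreal (mass \<gamma> k \<omega>) \<partial>P)
      = (\<integral>\<^sup>+\<omega>. (\<Sum>\<eta>\<in>generation b k. ennreal (1 / real b ^ (length \<gamma> + k)) * (f \<omega> * ennreal (path_product (\<gamma> @ \<eta>) \<omega>))) \<partial>P)"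
  proof (rule nn_integral_cong)
    fix \<omega> assume "\<omega> \<in> space P"
    then have nn: "0 \<le> path_product (\<gamma> @ \<eta>) \<omega>" if "\<eta> \<in> generation b k" for \<eta>
      using that by (auto simp: space_P intro: path_product_nonneg gw)
    have "ennreal (mass \<gamma> k \<omega>) = (\<Sum>\<eta>\<in>generation b k. ennreal (1 / real b ^ (length \<gamma> + k) * path_product (\<gamma> @ \<eta>) \<omega>))"
      unfolding mass_def by (subst sum_ennreal) (auto intro!: divide_nonneg_nonneg nn)
    also have "\<dots> = (\<Sum>\<eta>\<in>generation b k. ennreal (1 / real b ^ (length \<gamma> + k)) * ennreal (path_product (\<gamma> @ \<eta>) \<omega>))"
      by (intro sum.cong refl ennreal_mult c nn)
    finally show "f \<omega> * ennreal (mass \<gamma> k \<omega>)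
        = (\<Sum>\<eta>\<in>generation b k. ennreal (1 / real b ^ (length \<gamma> + k)) * (f \<omega> * ennreal (path_product (\<gamma> @ \<eta>) \<omega>)))"
      by (simp add: sum_distrib_left mult.left_commute)
  qed
  also have "\<dots> = (\<Sum>\<eta>\<in>generation b k. ennreal (1 / real b ^ (length \<gamma> + k)) * (\<integral>\<^sup>+\<omega>. f \<omega> * ennreal (path_product (\<gamma> @ \<eta>) \<omega>) \<partial>P))"
    using m gw by (subst nn_integral_sum) (auto intro!: sum.cong nn_integral_cmult)
  also have "\<dots> = (\<Sum>\<eta>\<in>generation b k. ennreal (1 / real b ^ (length \<gamma> + k)) * (\<integral>\<^sup>+\<omega>. f \<omega> * ennreal (path_product \<gamma> \<omega>) \<partial>P))"
    by (intro sum.cong refl arg_cong2[where f = "(*)"] nn_integral_path_product gw f)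
  also have "\<dots> = (ennreal (real b ^ k) * ennreal (1 / real b ^ (length \<gamma> + k))) * (\<integral>\<^sup>+\<omega>. f \<omega> * ennreal (path_product \<gamma> \<omega>) \<partial>P)"
    by (simp add: card_generation mult.assoc ennreal_of_nat_eq_real_of_nat)
  also have "ennreal (real b ^ k) * ennreal (1 / real b ^ (length \<gamma> + k)) = ennreal (1 / real b ^ length \<gamma>)"
    using b_pos by (subst ennreal_mult[symmetric]) (auto simp: power_add)
  also have "ennreal (1 / real b ^ length \<gamma>) * (\<integral>\<^sup>+\<omega>. f \<omega> * ennreal (path_product \<gamma> \<omega>) \<partial>P)
      = (\<integral>\<^sup>+\<omega>. ennreal (1 / real b ^ length \<gamma>) * (f \<omega> * ennreal (path_product \<gamma> \<omega>)) \<partial>P)"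
    by (rule nn_integral_cmult[OF m[OF w], symmetric])
  also have "\<dots> = (\<integral>\<^sup>+\<omega>. f \<omega> * ennreal (path_product \<gamma> \<omega> / real b ^ length \<gamma>) \<partial>P)"
  proof (rule nn_integral_cong)
    fix \<omega> assume "\<omega> \<in> space P"
    then have "0 \<le> path_product \<gamma> \<omega>" by (simp add: space_P path_product_nonneg[OF _ w])
    then have "ennreal (path_product \<gamma> \<omega> / real b ^ length \<gamma>) = ennreal (1 / real b ^ length \<gamma>) * ennreal (path_product \<gamma> \<omega>)"
      by (subst ennreal_mult[symmetric]) auto
    then show "ennreal (1 / real b ^ length \<gamma>) * (f \<omega> * ennreal (path_product \<gamma> \<omega>)) = f \<omega> * ennreal (path_product \<gamma> \<omega> / real b ^ length \<gamma>)"
      by (simp add: mult.left_commute)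
  qed
  finally show ?thesis .
qed

end

section \<open>The mass of the limit measure\<close>

locale cascade_limit = nonempty_cascade +
  fixes \<Lambda> :: "(nat list \<Rightarrow> real) \<Rightarrow> (nat \<Rightarrow> nat) measure"
  assumes limit: "limit_measure b P cascade \<Lambda>"
begin

definition limit_mass :: "nat list \<Rightarrow> (nat list \<Rightarrow> real) \<Rightarrow> real" where
  "limit_mass \<gamma> \<omega> = measure (\<Lambda> \<omega>) (cylinder b \<gamma>)"

lemma random_measure_\<Lambda>: "random_measure b P \<Lambda>"
  using limit by (simp add: limit_measure_def)

lemma finite_\<Lambda>: "\<omega> \<in> \<Omega> \<Longrightarrow> finite_measure (\<Lambda> \<omega>)" and sets_\<Lambda>: "\<omega> \<in> \<Omega> \<Longrightarrow> sets (\<Lambda> \<omega>) = sets (tree_measure b)"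
  using random_measure_\<Lambda> by (auto simp: random_measure_def space_P)

lemma measurable_\<Lambda>: "A \<in> sets (tree_measure b) \<Longrightarrow> (\<lambda>\<omega>. measure (\<Lambda> \<omega>) A) \<in> borel_measurable P"
  using random_measure_\<Lambda> by (auto simp: random_measure_def)

lemma measurable_limit_mass: "limit_mass \<gamma> \<in> borel_measurable P"
  unfolding limit_mass_def by (rule measurable_\<Lambda>) simp

lemma limit_mass_nonneg: "0 \<le> limit_mass \<gamma> \<omega>"
  by (simp add: limit_mass_def)

lemma mass_tendsto_limit_mass:
  assumes w: "\<gamma> \<in> tree_words b"
  shows "AE \<omega> in P. (\<lambda>k. mass \<gamma> k \<omega>) \<longlonglongrightarrow> limit_mass \<gamma> \<omega>"
proof -
  have "AE \<omega> in P. weakly_converges b (\<lambda>n. process_measure b cascade n \<omega>) (\<Lambda> \<omega>)"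
    using limit by (simp add: limit_measure_def)
  moreover have "AE \<omega> in P. \<omega> \<in> \<Omega>" by (simp add: space_P[symmetric])
  ultimately show ?thesis
  proof eventually_elim
    case (elim \<omega>)
    from LIMSEQ_ignore_initial_segment[OF weakly_converges_imp_cylinder[OF elim(1), of \<gamma>], of "length \<gamma>"]
    show ?case by (simp add: limit_mass_def add.commute mass_eq_process_measure[OF w elim(2), symmetric])
  qed
qed

text \<open>
  Fatou's lemma. Mass can be lost in the limit, and the singular part accounts for this loss.
\<close>

lemma nn_integral_limit_mass_le:
  assumes w: "\<gamma> \<in> tree_words b" and B: "B \<in> sets (\<F> (length \<gamma>))"
  shows "(\<integral>\<^sup>+\<omega>. indicator B \<omega> * ennreal (limit_mass \<gamma> \<omega>) \<partial>P)
    \<le> (\<integral>\<^sup>+\<omega>. indicator B \<omega> * ennreal (path_product \<gamma> \<omega> / real b ^ length \<gamma>) \<partial>P)"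
proof -
  have [measurable]: "B \<in> sets P" using B subalgebra_P_filtration by (auto simp: subalgebra_def)
  have [measurable]: "mass \<gamma> k \<in> borel_measurable P" for k
    by (rule measurable_P_of_filtration[OF measurable_mass_filtration[OF w]])
  have "AE \<omega> in P. indicator B \<omega> * ennreal (limit_mass \<gamma> \<omega>) = liminf (\<lambda>k. indicator B \<omega> * ennreal (mass \<gamma> k \<omega>))"
    using mass_tendsto_limit_mass[OF w]
  proof eventually_elim
    case (elim \<omega>)
    then have "(\<lambda>k. indicator B \<omega> * ennreal (mass \<gamma> k \<omega>)) \<longlonglongrightarrow> indicator B \<omega> * ennreal (limit_mass \<gamma> \<omega>)"
      by (cases "\<omega> \<in> B") auto
    then show ?case by (intro lim_imp_Liminf[symmetric]) auto
  qed
  then have "(\<integral>\<^sup>+\<omega>. indicator B \<omega> * ennreal (limit_mass \<gamma> \<omega>) \<partial>P)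
      = (\<integral>\<^sup>+\<omega>. liminf (\<lambda>k. indicator B \<omega> * ennreal (mass \<gamma> k \<omega>)) \<partial>P)"
    by (rule nn_integral_cong_AE)
  also have "\<dots> \<le> liminf (\<lambda>k. \<integral>\<^sup>+\<omega>. indicator B \<omega> * ennreal (mass \<gamma> k \<omega>) \<partial>P)"
    by (rule nn_integral_liminf) measurable
  also have "\<dots> = (\<integral>\<^sup>+\<omega>. indicator B \<omega> * ennreal (path_product \<gamma> \<omega> / real b ^ length \<gamma>) \<partial>P)"
    unfolding nn_integral_mass[OF w borel_measurable_indicator[OF B]] by (simp add: Liminf_const)
  finally show ?thesis .
qed

lemma integrable_path_mass: "\<gamma> \<in> tree_words b \<Longrightarrow> integrable P (\<lambda>\<omega>. path_product \<gamma> \<omega> / real b ^ length \<gamma>)"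
  by (intro integrable_divide integrable_path_product)

lemma integrable_limit_mass:
  assumes w: "\<gamma> \<in> tree_words b"
  shows "integrable P (limit_mass \<gamma>)"
proof (rule integrableI_nonneg[OF measurable_limit_mass])
  have "(\<integral>\<^sup>+\<omega>. ennreal (limit_mass \<gamma> \<omega>) \<partial>P) = (\<integral>\<^sup>+\<omega>. indicator \<Omega> \<omega> * ennreal (limit_mass \<gamma> \<omega>) \<partial>P)"
    by (intro nn_integral_cong) (simp add: space_P)
  also have "\<dots> \<le> (\<integral>\<^sup>+\<omega>. indicator \<Omega> \<omega> * ennreal (path_product \<gamma> \<omega> / real b ^ length \<gamma>) \<partial>P)"
    by (rule nn_integral_limit_mass_le[OF w]) (metis sets.top space_filtration)
  also have "\<dots> = (\<integral>\<^sup>+\<omega>. ennreal (path_product \<gamma> \<omega> / real b ^ length \<gamma>) \<partial>P)"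
    by (intro nn_integral_cong) (simp add: space_P)
  also have "\<dots> < \<infinity>"
    using integrable_path_mass[OF w] path_product_nonneg[OF _ w]
    by (subst nn_integral_eq_integral) (auto simp: space_P)
  finally show "(\<integral>\<^sup>+\<omega>. ennreal (limit_mass \<gamma> \<omega>) \<partial>P) < \<infinity>" .
qed (simp add: limit_mass_nonneg)

text \<open>
  The integrated inequality is applied to the event on which the claim fails.
\<close>

lemma real_cond_exp_limit_mass_le:
  assumes w: "\<gamma> \<in> tree_words b"
  shows "AE \<omega> in P. real_cond_exp P (\<F> (length \<gamma>)) (limit_mass \<gamma>) \<omega> \<le> path_product \<gamma> \<omega> / real b ^ length \<gamma>"
proof -
  interpret F: sigma_finite_subalgebra P "\<F> (length \<gamma>)" by (rule sigma_finite_subalgebraI[OF subalgebra_P_filtration])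
  let ?E = "real_cond_exp P (\<F> (length \<gamma>)) (limit_mass \<gamma>)" and ?V = "\<lambda>\<omega>. path_product \<gamma> \<omega> / real b ^ length \<gamma>"
  note iL = integrable_limit_mass[OF w] and iV = integrable_path_mass[OF w]
  have [measurable]: "?V \<in> borel_measurable (\<F> (length \<gamma>))"
    using measurable_path_product_filtration[OF w order_refl] by measurable
  define B where "B = {\<omega> \<in> space (\<F> (length \<gamma>)). ?V \<omega> < ?E \<omega>}"
  have B: "B \<in> sets (\<F> (length \<gamma>))" unfolding B_def by measurable
  then have BP [measurable]: "B \<in> sets P" using subalgebra_P_filtration by (auto simp: subalgebra_def)
  have ind: "integrable P (\<lambda>\<omega>. indicator B \<omega> * f \<omega>)" if "integrable P f" for f :: "_ \<Rightarrow> real"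
    using integrable_mult_indicator[OF BP that] by simp
  have nn: "ennreal (\<integral>\<omega>. indicator B \<omega> * f \<omega> \<partial>P) = (\<integral>\<^sup>+\<omega>. indicator B \<omega> * ennreal (f \<omega>) \<partial>P)"
    if "integrable P f" "\<And>\<omega>. \<omega> \<in> \<Omega> \<Longrightarrow> 0 \<le> f \<omega>" for f
    using ind[OF that(1)] that(2)
    by (subst nn_integral_eq_integral[symmetric]) (auto simp: space_P indicator_def intro!: nn_integral_cong AE_I2)
  have "ennreal (\<integral>\<omega>. indicator B \<omega> * limit_mass \<gamma> \<omega> \<partial>P) \<le> ennreal (\<integral>\<omega>. indicator B \<omega> * ?V \<omega> \<partial>P)"
    using nn_integral_limit_mass_le[OF w B] path_product_nonneg[OF _ w]
    by (subst (1 2) nn) (auto simp: iL iV limit_mass_nonneg)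
  then have "(\<integral>\<omega>. indicator B \<omega> * limit_mass \<gamma> \<omega> \<partial>P) \<le> (\<integral>\<omega>. indicator B \<omega> * ?V \<omega> \<partial>P)"
  proof (subst (asm) ennreal_le_iff)
    show "0 \<le> (\<integral>\<omega>. indicator B \<omega> * ?V \<omega> \<partial>P)"
      by (intro integral_nonneg_AE AE_I2 mult_nonneg_nonneg divide_nonneg_nonneg path_product_nonneg[OF _ w])
        (simp_all add: space_P)
  qed
  moreover have "(\<integral>\<omega>. indicator B \<omega> * limit_mass \<gamma> \<omega> \<partial>P) = (\<integral>\<omega>. indicator B \<omega> * ?E \<omega> \<partial>P)"
    using F.real_cond_exp_intA[OF iL B] by (simp add: set_lebesgue_integral_def)
  moreover have "(\<integral>\<omega>. indicator B \<omega> * (?E \<omega> - ?V \<omega>) \<partial>P)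
      = (\<integral>\<omega>. indicator B \<omega> * ?E \<omega> \<partial>P) - (\<integral>\<omega>. indicator B \<omega> * ?V \<omega> \<partial>P)"
    using ind[OF F.real_cond_exp_int(1)[OF iL]] ind[OF iV] by (simp add: right_diff_distrib)
  moreover have "0 \<le> (\<integral>\<omega>. indicator B \<omega> * (?E \<omega> - ?V \<omega>) \<partial>P)"
    by (rule integral_nonneg_AE) (auto simp: B_def indicator_def)
  ultimately have "(\<integral>\<omega>. indicator B \<omega> * (?E \<omega> - ?V \<omega>) \<partial>P) = 0" by linarith
  moreover have "integrable P (\<lambda>\<omega>. indicator B \<omega> * (?E \<omega> - ?V \<omega>))"
    by (intro ind Bochner_Integration.integrable_diff F.real_cond_exp_int(1) iL iV)
  ultimately have "AE \<omega> in P. indicator B \<omega> * (?E \<omega> - ?V \<omega>) = 0"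
    by (subst (asm) integral_nonneg_eq_0_iff_AE) (auto simp: B_def indicator_def)
  moreover have "AE \<omega> in P. \<omega> \<in> \<Omega>" by (simp add: space_P[symmetric])
  ultimately show ?thesis
    by eventually_elim (auto simp: B_def indicator_def split: if_splits)
qed

end

text \<open>
  The words comparable with \<open>\<gamma>\<close> in the prefix order: its ancestors, itself and its descendants. The
  masses of \<open>\<Delta>\<^sub>\<gamma>\<close> depend on these weights only, and the lineage up to generation \<open>|\<gamma>|\<close> is the path to \<open>\<gamma>\<close>.
\<close>

definition lineage :: "nat \<Rightarrow> nat list \<Rightarrow> nat list set" where
  "lineage b \<gamma> = {w \<in> tree_words b. take (length \<gamma>) w = take (length w) \<gamma>}"

lemma lineage_subset: "lineage b \<gamma> \<subseteq> tree_words b"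
  by (auto simp: lineage_def)

lemma take_lineage:
  assumes "w \<in> lineage b \<gamma>"
  shows "take j w \<in> lineage b \<gamma>"
proof -
  have "take (length \<gamma>) (take j w) = take j (take (length w) \<gamma>)"
    using assms by (simp add: lineage_def take_take min.commute) (metis min.commute take_take)
  then show ?thesis using assms
    by (auto simp: lineage_def take_tree_words min.commute)
qed

lemma append_in_lineage: "\<gamma> @ \<eta> \<in> tree_words b \<Longrightarrow> \<gamma> @ \<eta> \<in> lineage b \<gamma>"
  by (simp add: lineage_def)

lemma lineage_upto: "\<gamma> \<in> tree_words b \<Longrightarrow> {w \<in> lineage b \<gamma>. length w \<le> length \<gamma>} = {take j \<gamma> | j. j \<le> length \<gamma>}"
proof safe
  fix w assume "w \<in> lineage b \<gamma>" "length w \<le> length \<gamma>"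
  then show "\<exists>j. w = take j \<gamma> \<and> j \<le> length \<gamma>"
    by (intro exI[of _ "length w"]) (simp add: lineage_def)
qed (auto simp: lineage_def take_tree_words)

context cascade_limit
begin

lemma mass_nonneg_AE: "\<gamma> \<in> tree_words b \<Longrightarrow> AE \<omega> in P. 0 \<le> mass \<gamma> k \<omega>"
  by (intro AE_I2) (simp add: space_P mass_nonneg)

lemma measurable_mass_P: "\<gamma> \<in> tree_words b \<Longrightarrow> mass \<gamma> k \<in> borel_measurable P"
  by (rule measurable_P_of_filtration[OF measurable_mass_filtration])

lemma integrable_truncated_mass:
  "\<gamma> \<in> tree_words b \<Longrightarrow> integrable P (\<lambda>\<omega>. min (real c) (mass \<gamma> k \<omega>))"
  by (rule integrable_const_bound[where B = "real c"])
    (use measurable_mass_P mass_nonneg in \<open>auto simp: space_P intro!: AE_I2\<close>)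

text \<open>
  The Markov property for the lineage of \<open>\<gamma>\<close>, applied to truncated finite-level masses.
\<close>

lemma limit_mass_cond_exp_path:
  assumes w: "\<gamma> \<in> tree_words b"
  shows "AE \<omega> in P. real_cond_exp P (\<F> (length \<gamma>)) (limit_mass \<gamma>) \<omega> = real_cond_exp P (path_algebra b \<gamma>) (limit_mass \<gamma>) \<omega>"
proof -
  have path: "path_algebra b \<gamma> = coord_algebra b {w \<in> lineage b \<gamma>. length w \<le> length \<gamma>}"
    by (simp add: path_algebra_def lineage_upto[OF w])
  have sub: "subalgebra P (path_algebra b \<gamma>)"
    unfolding path using lineage_subset by (intro subalgebra_P_coord) auto
  show ?thesis
  proof (rule real_cond_exp_eq_truncation_limit[OF subalgebra_P_filtration sub
        measurable_mass_P[OF w] integrable_limit_mass[OF w] mass_tendsto_limit_mass[OF w] mass_nonneg_AE[OF w]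
        measurable_mass_P[OF w] integrable_limit_mass[OF w] mass_tendsto_limit_mass[OF w] mass_nonneg_AE[OF w]])
    fix c k
    have "mass \<gamma> k \<in> borel_measurable (coord_algebra b {w \<in> lineage b \<gamma>. length w \<le> length \<gamma> + k})"
    proof (rule measurable_mass)
      fix \<eta> j assume "\<eta> \<in> generation b k"
      then have "\<gamma> @ \<eta> \<in> lineage b \<gamma>" "length (\<gamma> @ \<eta>) = length \<gamma> + k"
        using w by (auto simp: generation_def append_tree_words intro!: append_in_lineage)
      then show "take j (\<gamma> @ \<eta>) \<in> {w \<in> lineage b \<gamma>. length w \<le> length \<gamma> + k}"
        by (simp add: take_lineage del: take_append)
    qed
    then have "(\<lambda>\<omega>. min (real c) (mass \<gamma> k \<omega>)) \<in> borel_measurable (coord_algebra b {w \<in> lineage b \<gamma>. length w \<le> length \<gamma> + k})"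
      by measurable
    from markov_property[OF lineage_subset take_lineage this integrable_truncated_mass[OF w]]
    show "AE \<omega> in P. real_cond_exp P (\<F> (length \<gamma>)) (\<lambda>\<omega>. min (real c) (mass \<gamma> k \<omega>)) \<omega>
        = real_cond_exp P (path_algebra b \<gamma>) (\<lambda>\<omega>. min (real c) (mass \<gamma> k \<omega>)) \<omega>"
      unfolding path .
  qed
qed

text \<open>
  Swapping the two subtrees turns the finite-level masses of one sibling into those of the other
  and leaves the first \<open>|\<gamma>|\<close> generations unchanged.
\<close>

lemma limit_mass_siblings:
  assumes w: "\<gamma> \<in> tree_words b" and ij: "i < b" "j < b"
  shows "AE \<omega> in P. real_cond_exp P (\<F> (length \<gamma>)) (limit_mass (\<gamma> @ [i])) \<omega>
    = real_cond_exp P (\<F> (length \<gamma>)) (limit_mass (\<gamma> @ [j])) \<omega>"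
proof -
  let ?\<sigma> = "swap_subtrees \<gamma> i j"
  have \<sigma>: "tree_involution b ?\<sigma>" by (rule tree_involution_swap_subtrees[OF ij])
  have wi: "\<gamma> @ [i] \<in> tree_words b" and wj: "\<gamma> @ [j] \<in> tree_words b"
    using w ij by (auto simp: tree_words_def)
  have swap: "mass (\<gamma> @ [j]) k (\<omega> \<circ> ?\<sigma>) = mass (\<gamma> @ [i]) k \<omega>" for k \<omega>
    unfolding mass_def by (simp add: path_product_relabel[OF \<sigma>] swap_subtrees_child)
  show ?thesis
  proof (rule real_cond_exp_eq_truncation_limit[OF subalgebra_P_filtration subalgebra_P_filtration
        measurable_mass_P[OF wi] integrable_limit_mass[OF wi] mass_tendsto_limit_mass[OF wi] mass_nonneg_AE[OF wi]
        measurable_mass_P[OF wj] integrable_limit_mass[OF wj] mass_tendsto_limit_mass[OF wj] mass_nonneg_AE[OF wj]])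
    fix c k
    have "(\<lambda>\<omega>. min (real c) (mass (\<gamma> @ [j]) k \<omega>)) \<in> borel_measurable (\<F> (length (\<gamma> @ [j]) + k))"
      using measurable_mass_filtration[OF wj, of k] by measurable
    from real_cond_exp_relabel[OF \<sigma> swap_subtrees_short _ this integrable_truncated_mass[OF wj], of "length \<gamma>"]
    show "AE \<omega> in P. real_cond_exp P (\<F> (length \<gamma>)) (\<lambda>\<omega>. min (real c) (mass (\<gamma> @ [i]) k \<omega>)) \<omega>
        = real_cond_exp P (\<F> (length \<gamma>)) (\<lambda>\<omega>. min (real c) (mass (\<gamma> @ [j]) k \<omega>)) \<omega>"
      by (simp add: swap)
  qed
qed

lemma limit_mass_split:
  "\<gamma> \<in> tree_words b \<Longrightarrow> \<omega> \<in> \<Omega> \<Longrightarrow> limit_mass \<gamma> \<omega> = (\<Sum>\<eta>\<in>generation b k. limit_mass (\<gamma> @ \<eta>) \<omega>)"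
  unfolding limit_mass_def by (rule sum_cylinder_split[OF finite_\<Lambda> sets_\<Lambda>])

lemma limit_mass_split_cond_exp:
  assumes w: "\<gamma> \<in> tree_words b"
  shows "AE \<omega> in P. real_cond_exp P (\<F> n) (limit_mass \<gamma>) \<omega> = (\<Sum>\<eta>\<in>generation b k. real_cond_exp P (\<F> n) (limit_mass (\<gamma> @ \<eta>)) \<omega>)"
proof -
  interpret F: sigma_finite_subalgebra P "\<F> n" by (rule sigma_finite_subalgebraI[OF subalgebra_P_filtration])
  \<comment> \<open>extended by zero, so that every member of the family is integrable\<close>
  let ?f = "\<lambda>\<eta> \<omega>. if \<eta> \<in> generation b k then limit_mass (\<gamma> @ \<eta>) \<omega> else 0"
  have int: "integrable P (?f \<eta>)" for \<eta>
    using w by (cases "\<eta> \<in> generation b k") (auto simp: generation_def append_tree_words intro!: integrable_limit_mass)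
  have "AE \<omega> in P. real_cond_exp P (\<F> n) (limit_mass \<gamma>) \<omega> = real_cond_exp P (\<F> n) (\<lambda>\<omega>. \<Sum>\<eta>\<in>generation b k. ?f \<eta> \<omega>) \<omega>"
    using int by (intro F.real_cond_exp_cong AE_I2 measurable_limit_mass borel_measurable_sum)
      (auto simp: space_P measurable_limit_mass limit_mass_split[OF w, of _ k])
  moreover have "(\<Sum>\<eta>\<in>generation b k. real_cond_exp P (\<F> n) (?f \<eta>) \<omega>)
      = (\<Sum>\<eta>\<in>generation b k. real_cond_exp P (\<F> n) (limit_mass (\<gamma> @ \<eta>)) \<omega>)" for \<omega>
    by (intro sum.cong) auto
  moreover note F.real_cond_exp_sum[of ?f "generation b k", OF int]
  ultimately show ?thesis by (auto elim: eventually_elim2)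
qed

lemma generation_1: "generation b 1 = (\<lambda>i. [i]) ` {..<b}"
  by (auto simp: generation_def tree_words_def length_Suc_conv)

lemma limit_mass_child_cond_exp:
  assumes w: "\<gamma> \<in> tree_words b" and i: "i < b"
  shows "AE \<omega> in P. real_cond_exp P (\<F> (length \<gamma>)) (limit_mass (\<gamma> @ [i])) \<omega>
    = real_cond_exp P (\<F> (length \<gamma>)) (limit_mass \<gamma>) \<omega> / real b"
proof -
  let ?E = "\<lambda>i. real_cond_exp P (\<F> (length \<gamma>)) (limit_mass (\<gamma> @ [i]))"
  have children: "(\<Sum>\<eta>\<in>generation b 1. real_cond_exp P (\<F> (length \<gamma>)) (limit_mass (\<gamma> @ \<eta>)) \<omega>) = (\<Sum>j<b. ?E j \<omega>)" for \<omega>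
    unfolding generation_1 by (subst sum.reindex) (auto simp: inj_on_def)
  have "AE \<omega> in P. \<forall>j\<in>{..<b}. ?E i \<omega> = ?E j \<omega>"
    using limit_mass_siblings[OF w i] by (intro AE_finite_allI) auto
  with limit_mass_split_cond_exp[OF w, of "length \<gamma>" 1] show ?thesis
  proof eventually_elim
    case (elim \<omega>)
    have "(\<Sum>j<b. ?E j \<omega>) = (\<Sum>j<b. ?E i \<omega>)" using elim(2) by (intro sum.cong) auto
    with elim(1) b_pos show ?case by (simp only: children) simp
  qed
qed

text \<open>
  Each generation contributes a factor \<open>1/b\<close>, by the equality of siblings and the tower property.
\<close>

lemma limit_mass_descendant_cond_exp:
  assumes "\<gamma> @ \<eta> \<in> tree_words b"
  shows "AE \<omega> in P. real_cond_exp P (\<F> (length \<gamma>)) (limit_mass (\<gamma> @ \<eta>)) \<omega>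
    = real_cond_exp P (\<F> (length \<gamma>)) (limit_mass \<gamma>) \<omega> / real b ^ length \<eta>"
  using assms
proof (induction \<eta> rule: rev_induct)
  case (snoc i \<eta>)
  let ?n = "length \<gamma>" and ?m = "length (\<gamma> @ \<eta>)"
  have w: "\<gamma> @ \<eta> \<in> tree_words b" "i < b" "(\<gamma> @ \<eta>) @ [i] \<in> tree_words b"
    using snoc.prems by (auto simp: tree_words_def)
  interpret F: sigma_finite_subalgebra P "\<F> ?n" by (rule sigma_finite_subalgebraI[OF subalgebra_P_filtration])
  interpret F': sigma_finite_subalgebra P "\<F> ?m" by (rule sigma_finite_subalgebraI[OF subalgebra_P_filtration])
  have sub: "subalgebra (\<F> ?m) (\<F> ?n)" by (rule subalgebra_filtration_mono) simp
  let ?E' = "real_cond_exp P (\<F> ?m) (limit_mass (\<gamma> @ \<eta>))"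
  note iL = integrable_limit_mass[OF w(1)] and iL' = integrable_limit_mass[OF w(3)]
  have "AE \<omega> in P. real_cond_exp P (\<F> ?n) (real_cond_exp P (\<F> ?m) (limit_mass ((\<gamma> @ \<eta>) @ [i]))) \<omega>
      = real_cond_exp P (\<F> ?n) (\<lambda>\<omega>. ?E' \<omega> / real b) \<omega>"
    by (rule F.real_cond_exp_cong[OF limit_mass_child_cond_exp[OF w(1,2)]]) auto
  with F.real_cond_exp_nested_subalg[OF subalgebra_P_filtration sub iL']
    F.real_cond_exp_cdiv[OF F'.real_cond_exp_int(1)[OF iL], of "real b"]
    F.real_cond_exp_nested_subalg[OF subalgebra_P_filtration sub iL] snoc.IH[OF w(1)]
  show ?case by eventually_elim (simp add: mult.commute)
qed simp

lemma limit_mass_levy: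
  assumes w: "\<gamma> \<in> tree_words b"
  shows "AE \<omega> in P. (\<lambda>n. real_cond_exp P (\<F> n) (limit_mass \<gamma>) \<omega>) \<longlonglongrightarrow> limit_mass \<gamma> \<omega>"
proof (rule levy_upward[OF subalgebra_P_filtration filtration_mono integrable_limit_mass[OF w]])
  fix e :: real assume "0 < e"
  from L1_approximation_by_truncations[OF measurable_mass_P[OF w] integrable_limit_mass[OF w]
      mass_tendsto_limit_mass[OF w] mass_nonneg_AE[OF w] this]
  obtain c k where "(\<integral>\<omega>. \<bar>min (real c) (mass \<gamma> k \<omega>) - limit_mass \<gamma> \<omega>\<bar> \<partial>P) < e"
    "integrable P (\<lambda>\<omega>. min (real c) (mass \<gamma> k \<omega>))" by blast
  moreover have "(\<lambda>\<omega>. min (real c) (mass \<gamma> k \<omega>)) \<in> borel_measurable (\<F> (length \<gamma> + k))"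
    using measurable_mass_filtration[OF w, of k] by measurable
  ultimately show "\<exists>m Z. Z \<in> borel_measurable (\<F> m) \<and> integrable P Z \<and> (\<integral>\<omega>. \<bar>Z \<omega> - limit_mass \<gamma> \<omega>\<bar> \<partial>P) < e"
    by blast
qed

text \<open>
  The version of \<open>E[\<lambda>\<^sub>\<infinity>(\<Delta>\<^sub>\<gamma>) | \<F>\<^sub>|\<^sub>\<gamma>\<^sub>|]\<close> on which the decomposition is based. Conditioning on the path
  gives the measurability required of weights. Clipping changes it on a null set only; it makes
  both parts of the decomposition nonnegative everywhere and the regular part zero wherever the
  cascade is zero.
\<close>

definition expected_mass :: "nat list \<Rightarrow> (nat list \<Rightarrow> real) \<Rightarrow> real" where
  "expected_mass \<gamma> \<omega> = min (max (real_cond_exp P (path_algebra b \<gamma>) (limit_mass \<gamma>) \<omega>) 0) (path_product \<gamma> \<omega> / real b ^ length \<gamma>)"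

lemma measurable_expected_mass_path: "expected_mass \<gamma> \<in> borel_measurable (path_algebra b \<gamma>)"
proof -
  note [measurable] = measurable_path_product_path[of \<gamma> b]
  show ?thesis unfolding expected_mass_def by measurable
qed

lemma measurable_expected_mass:
  assumes "\<gamma> \<in> tree_words b" "length \<gamma> \<le> n"
  shows "expected_mass \<gamma> \<in> borel_measurable (\<F> n)"
proof (rule measurable_from_subalg[OF _ measurable_expected_mass_path])
  show "subalgebra (\<F> n) (path_algebra b \<gamma>)"
    unfolding path_algebra_def cascade_filtration_def using assms
    by (intro subalgebra_coord_algebra_mono) (auto intro: take_tree_words)
qed

lemma expected_mass_bounds:
  assumes "\<gamma> \<in> tree_words b" "\<omega> \<in> \<Omega>"
  shows "0 \<le> expected_mass \<gamma> \<omega>" "expected_mass \<gamma> \<omega> \<le> path_product \<gamma> \<omega> / real b ^ length \<gamma>"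
  using path_product_nonneg[OF assms(2,1)] by (auto simp: expected_mass_def)

lemma expected_mass_zero: "path_product \<gamma> \<omega> = 0 \<Longrightarrow> expected_mass \<gamma> \<omega> = 0"
  by (simp add: expected_mass_def)

lemma expected_mass_version:
  assumes w: "\<gamma> \<in> tree_words b"
  shows "AE \<omega> in P. real_cond_exp P (\<F> (length \<gamma>)) (limit_mass \<gamma>) \<omega> = expected_mass \<gamma> \<omega>"
proof -
  interpret F: sigma_finite_subalgebra P "\<F> (length \<gamma>)" by (rule sigma_finite_subalgebraI[OF subalgebra_P_filtration])
  have "AE \<omega> in P. 0 \<le> real_cond_exp P (\<F> (length \<gamma>)) (limit_mass \<gamma>) \<omega>"
    by (rule F.real_cond_exp_pos) (simp_all add: limit_mass_nonneg measurable_limit_mass)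
  with limit_mass_cond_exp_path[OF w] real_cond_exp_limit_mass_le[OF w] show ?thesis
    by eventually_elim (simp add: expected_mass_def)
qed

lemma integrable_expected_mass: "\<gamma> \<in> tree_words b \<Longrightarrow> integrable P (expected_mass \<gamma>)"
  by (rule Bochner_Integration.integrable_bound[OF integrable_path_mass])
    (use measurable_P_of_filtration[OF measurable_expected_mass[OF _ order_refl]] expected_mass_bounds path_product_nonneg
      in \<open>auto simp: space_P intro!: AE_I2\<close>)

end

section \<open>The Kahane decomposition\<close>

lemma positive_T_martingale_diff:
  assumes P: "prob_space P" and sub: "\<And>n. subalgebra P (cascade_filtration b n)"
    and Q: "positive_T_martingale b P Q" and R: "positive_T_martingale b P R"
    and le: "\<And>n t \<omega>. t \<in> tree_boundary b \<Longrightarrow> \<omega> \<in> space P \<Longrightarrow> R n t \<omega> \<le> Q n t \<omega>"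
  shows "positive_T_martingale b P (\<lambda>n t \<omega>. Q n t \<omega> - R n t \<omega>)"
proof -
  interpret prob_space P by fact
  have mart: "AE \<omega> in P. real_cond_exp P (cascade_filtration b n) (\<lambda>\<omega>. Q (Suc n) t \<omega> - R (Suc n) t \<omega>) \<omega> = Q n t \<omega> - R n t \<omega>"
    if t: "t \<in> tree_boundary b" for t n
  proof -
    interpret F: sigma_finite_subalgebra P "cascade_filtration b n" by (rule sigma_finite_subalgebraI[OF sub])
    have i: "integrable P (Q (Suc n) t)" "integrable P (R (Suc n) t)"
      and m: "AE \<omega> in P. real_cond_exp P (cascade_filtration b n) (Q (Suc n) t) \<omega> = Q n t \<omega>"
      "AE \<omega> in P. real_cond_exp P (cascade_filtration b n) (R (Suc n) t) \<omega> = R n t \<omega>"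
      using Q R t by (auto simp: positive_T_martingale_def)
    from F.real_cond_exp_diff[OF i] m show ?thesis by eventually_elim simp
  qed
  have "AE \<omega> in P. \<forall>n. (\<lambda>t. Q n t \<omega>) \<in> borel_measurable (tree_measure b)"
    "AE \<omega> in P. \<forall>n. (\<lambda>t. R n t \<omega>) \<in> borel_measurable (tree_measure b)"
    using Q R by (auto simp: positive_T_martingale_def)
  then have "AE \<omega> in P. \<forall>n. (\<lambda>t. Q n t \<omega> - R n t \<omega>) \<in> borel_measurable (tree_measure b)"
    by eventually_elim (intro allI borel_measurable_diff, auto)
  with mart Q R le show ?thesis
    by (auto simp: positive_T_martingale_def intro!: borel_measurable_diff)
qed

context cascade_limit
begin

lemma measure_cylinder_word: "\<gamma> \<in> tree_words b \<Longrightarrow> measure (tree_measure b) (cylinder b \<gamma>) = 1 / real b ^ length \<gamma>"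
  by (rule measure_cylinder[OF b_pos])

lemma prefix_snoc: "t \<in> tree_boundary b \<Longrightarrow> prefix_of t (Suc n) = prefix_of t n @ [t n] \<and> t n < b"
  by (simp add: prefix_of_def tree_boundary_def)

lemma cascade_T_martingale: "positive_T_martingale b P cascade"
  unfolding positive_T_martingale_def
proof (intro conjI ballI allI)
  fix n t assume t: "t \<in> tree_boundary b"
  note w = prefix_of_in_tree_words[OF t]
  have c: "cascade n t = path_product (prefix_of t n)" for n by (simp add: fun_eq_iff cascade_eq_path_product)
  show "0 \<le> cascade n t \<omega>" if "\<omega> \<in> space P" for \<omega>
    using that by (simp add: c space_P path_product_nonneg[OF _ w])
  show "cascade n t \<in> borel_measurable (\<F> n)" unfolding c by (rule measurable_path_product_filtration[OF w]) simp
  show "integrable P (cascade n t)" unfolding c by (rule integrable_path_product[OF w])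
  show "AE \<omega> in P. real_cond_exp P (\<F> n) (cascade (Suc n) t) \<omega> = cascade n t \<omega>"
    using real_cond_exp_path_product[of "prefix_of t n" "[t n]"] w[of "Suc n"] prefix_snoc[OF t, of n]
    by (simp add: c)
next
  show "AE \<omega> in P. \<forall>n. (\<lambda>t. cascade n t \<omega>) \<in> borel_measurable (tree_measure b)"
    using prefix_dependent_measurable[of "\<lambda>\<gamma>. path_product \<gamma> _"] by (simp add: cascade_eq_path_product)
qed

abbreviation regular :: tree_process where "regular \<equiv> kahane_regular b expected_mass"
abbreviation singular :: tree_process where "singular \<equiv> kahane_singular b expected_mass"

lemma regular_eq:
  assumes "t \<in> tree_boundary b"
  shows "regular n t \<omega> = expected_mass (prefix_of t n) \<omega> * real b ^ n"
  using measure_cylinder_word[OF prefix_of_in_tree_words[OF assms, of n]] by (simp add: kahane_regular_def)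

lemma regular_bounds:
  assumes t: "t \<in> tree_boundary b" and \<omega>: "\<omega> \<in> \<Omega>"
  shows "0 \<le> regular n t \<omega>" "regular n t \<omega> \<le> cascade n t \<omega>"
proof -
  note m = expected_mass_bounds[OF prefix_of_in_tree_words[OF t, of n] \<omega>]
  then show "0 \<le> regular n t \<omega>" by (simp add: regular_eq[OF t])
  show "regular n t \<omega> \<le> cascade n t \<omega>"
    using m(2) b_pos by (simp add: regular_eq[OF t] cascade_eq_path_product field_simps)
qed

lemma regular_T_martingale: "positive_T_martingale b P regular"
  unfolding positive_T_martingale_def
proof (intro conjI ballI allI)
  fix n t assume t: "t \<in> tree_boundary b"
  note w = prefix_of_in_tree_words[OF t]
  let ?\<gamma> = "prefix_of t n" and ?\<delta> = "prefix_of t (Suc n)"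
  have r: "regular n t = (\<lambda>\<omega>. real b ^ n * expected_mass (prefix_of t n) \<omega>)" for n
    by (simp add: fun_eq_iff regular_eq[OF t])
  interpret F: sigma_finite_subalgebra P "\<F> n" by (rule sigma_finite_subalgebraI[OF subalgebra_P_filtration])
  show "0 \<le> regular n t \<omega>" if "\<omega> \<in> space P" for \<omega> using regular_bounds(1)[OF t] that by (simp add: space_P)
  have m: "expected_mass ?\<gamma> \<in> borel_measurable (\<F> n)" by (rule measurable_expected_mass[OF w]) simp
  then show "regular n t \<in> borel_measurable (\<F> n)" unfolding r by measurable
  show "integrable P (regular n t)" unfolding r by (intro integrable_mult_right integrable_expected_mass w)
  have \<delta>: "?\<delta> = ?\<gamma> @ [t n]" "t n < b" using prefix_snoc[OF t] by auto
  have iL: "integrable P (limit_mass ?\<delta>)" by (rule integrable_limit_mass[OF w])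
  have "AE \<omega> in P. real_cond_exp P (\<F> n) (real_cond_exp P (\<F> (Suc n)) (limit_mass ?\<delta>)) \<omega>
      = real_cond_exp P (\<F> n) (expected_mass ?\<delta>) \<omega>"
    using expected_mass_version[OF w, of "Suc n"] borel_measurable_integrable[OF integrable_expected_mass[OF w]]
    by (intro F.real_cond_exp_cong) auto
  with F.real_cond_exp_cmult[OF integrable_expected_mass[OF w], of "real b ^ Suc n" "Suc n"]
    F.real_cond_exp_nested_subalg[OF subalgebra_P_filtration subalgebra_filtration_mono iL, of "Suc n"]
    limit_mass_child_cond_exp[OF w \<delta>(2), of n, unfolded length_prefix_of, folded \<delta>(1)]
    expected_mass_version[OF w, of n, unfolded length_prefix_of]
  show "AE \<omega> in P. real_cond_exp P (\<F> n) (regular (Suc n) t) \<omega> = regular n t \<omega>"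
    unfolding r using b_pos by (auto elim!: eventually_elim2)
next
  show "AE \<omega> in P. \<forall>n. (\<lambda>t. regular n t \<omega>) \<in> borel_measurable (tree_measure b)"
    using prefix_dependent_measurable[of "\<lambda>\<gamma>. expected_mass \<gamma> _ / measure (tree_measure b) (cylinder b \<gamma>)"]
    by (simp add: kahane_regular_def)
qed

lemma singular_T_martingale: "positive_T_martingale b P singular"
proof -
  have "singular = (\<lambda>n t \<omega>. cascade n t \<omega> - regular n t \<omega>)" by (simp add: fun_eq_iff kahane_singular_def)
  moreover have "positive_T_martingale b P (\<lambda>n t \<omega>. cascade n t \<omega> - regular n t \<omega>)"
    by (rule positive_T_martingale_diff[OF prob_P subalgebra_P_filtration cascade_T_martingale regular_T_martingale])
      (simp add: regular_bounds space_P)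
  ultimately show ?thesis by simp
qed

lemma regular_process_measure:
  assumes \<omega>: "\<omega> \<in> \<Omega>"
  shows "finite_measure (process_measure b regular n \<omega>)"
    and "A \<in> sets (tree_measure b) \<Longrightarrow> measure (process_measure b regular n \<omega>) A
      = (\<Sum>\<gamma>\<in>generation b n. expected_mass \<gamma> \<omega> * real b ^ n * measure (tree_measure b) (A \<inter> cylinder b \<gamma>))"
    and "\<gamma> \<in> tree_words b \<Longrightarrow> measure (process_measure b regular (length \<gamma> + k) \<omega>) (cylinder b \<gamma>)
      = (\<Sum>\<eta>\<in>generation b k. expected_mass (\<gamma> @ \<eta>) \<omega>)"
proof -
  have nn: "0 \<le> expected_mass \<gamma> \<omega> * real b ^ n" if "\<gamma> \<in> generation b n" for n \<gamma>
    using that generation_subset[of b n] by (auto intro!: mult_nonneg_nonneg expected_mass_bounds(1)[OF _ \<omega>])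
  show "finite_measure (process_measure b regular n \<omega>)"
    by (rule measure_process_measure(1)[where A = "{}" and g = "\<lambda>\<gamma>. expected_mass \<gamma> \<omega> * real b ^ n"])
      (auto simp: b_pos regular_eq nn)
  show "measure (process_measure b regular n \<omega>) A
      = (\<Sum>\<gamma>\<in>generation b n. expected_mass \<gamma> \<omega> * real b ^ n * measure (tree_measure b) (A \<inter> cylinder b \<gamma>))"
    if "A \<in> sets (tree_measure b)"
    by (rule measure_process_measure(2)[where g = "\<lambda>\<gamma>. expected_mass \<gamma> \<omega> * real b ^ n"])
      (auto simp: b_pos regular_eq nn that)
  assume w: "\<gamma> \<in> tree_words b"
  have "measure (process_measure b regular (length \<gamma> + k) \<omega>) (cylinder b \<gamma>)
      = (\<Sum>\<eta>\<in>generation b k. (expected_mass (\<gamma> @ \<eta>) \<omega> * real b ^ (length \<gamma> + k)) * measure (tree_measure b) (cylinder b (\<gamma> @ \<eta>)))"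
    by (rule measure_process_measure_cylinder[where g = "\<lambda>\<delta>. expected_mass \<delta> \<omega> * real b ^ (length \<gamma> + k)"])
      (auto simp: b_pos regular_eq nn w)
  also have "\<dots> = (\<Sum>\<eta>\<in>generation b k. expected_mass (\<gamma> @ \<eta>) \<omega>)"
    using w b_pos by (intro sum.cong) (auto simp: measure_cylinder_word append_tree_words generation_def)
  finally show "measure (process_measure b regular (length \<gamma> + k) \<omega>) (cylinder b \<gamma>)
      = (\<Sum>\<eta>\<in>generation b k. expected_mass (\<gamma> @ \<eta>) \<omega>)" .
qed

text \<open>
  In generation \<open>|\<gamma>| + k\<close> the regular part gives \<open>\<Delta>\<^sub>\<gamma>\<close> the sum of the expected masses of the
  descendants, which is the conditional expectation of the whole mass.
\<close>

lemma regular_mass_version: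
  assumes w: "\<gamma> \<in> tree_words b"
  shows "AE \<omega> in P. (\<Sum>\<eta>\<in>generation b k. expected_mass (\<gamma> @ \<eta>) \<omega>) = real_cond_exp P (\<F> (length \<gamma> + k)) (limit_mass \<gamma>) \<omega>"
proof -
  have "AE \<omega> in P. real_cond_exp P (\<F> (length \<gamma> + k)) (limit_mass (\<gamma> @ \<eta>)) \<omega> = expected_mass (\<gamma> @ \<eta>) \<omega>"
    if "\<eta> \<in> generation b k" for \<eta>
    using that w expected_mass_version[of "\<gamma> @ \<eta>"] by (simp add: generation_def append_tree_words)
  then have "AE \<omega> in P. \<forall>\<eta>\<in>generation b k. real_cond_exp P (\<F> (length \<gamma> + k)) (limit_mass (\<gamma> @ \<eta>)) \<omega> = expected_mass (\<gamma> @ \<eta>) \<omega>"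
    by (intro AE_finite_allI) auto
  with limit_mass_split_cond_exp[OF w, of "length \<gamma> + k" k] show ?thesis
    by eventually_elim simp
qed

lemma regular_mass_tendsto:
  "AE \<omega> in P. \<forall>\<gamma>\<in>tree_words b. (\<lambda>k. \<Sum>\<eta>\<in>generation b k. expected_mass (\<gamma> @ \<eta>) \<omega>) \<longlonglongrightarrow> limit_mass \<gamma> \<omega>"
proof -
  have "AE \<omega> in P. (\<lambda>k. \<Sum>\<eta>\<in>generation b k. expected_mass (\<gamma> @ \<eta>) \<omega>) \<longlonglongrightarrow> limit_mass \<gamma> \<omega>"
    if w: "\<gamma> \<in> tree_words b" for \<gamma>
  proof -
    have "AE \<omega> in P. \<forall>k. (\<Sum>\<eta>\<in>generation b k. expected_mass (\<gamma> @ \<eta>) \<omega>) = real_cond_exp P (\<F> (length \<gamma> + k)) (limit_mass \<gamma>) \<omega>"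
      unfolding AE_all_countable using regular_mass_version[OF w] by auto
    with limit_mass_levy[OF w] show ?thesis
    proof eventually_elim
      case (elim \<omega>)
      from LIMSEQ_ignore_initial_segment[OF elim(1), of "length \<gamma>"] show ?case
        by (simp add: elim(2) add.commute)
    qed
  qed
  then show ?thesis by (subst AE_ball_countable) auto
qed

lemma sets_process_measure [simp]: "sets (process_measure b Q n \<omega>) = sets (tree_measure b)"
  by (simp add: process_measure_def)

lemma regular_limit: "limit_measure b P regular \<Lambda>"
  unfolding limit_measure_def
proof (intro conjI random_measure_\<Lambda>)
  have "AE \<omega> in P. \<omega> \<in> \<Omega>" by (simp add: space_P[symmetric])
  with regular_mass_tendsto show "AE \<omega> in P. weakly_converges b (\<lambda>n. process_measure b regular n \<omega>) (\<Lambda> \<omega>)"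
  proof eventually_elim
    case (elim \<omega>)
    show ?case
    proof (rule weakly_convergesI[OF b_pos regular_process_measure(1)[OF elim(2)] sets_process_measure
          finite_\<Lambda>[OF elim(2)] sets_\<Lambda>[OF elim(2)]])
      fix \<gamma> assume w: "\<gamma> \<in> tree_words b"
      have "(\<lambda>k. measure (process_measure b regular (k + length \<gamma>) \<omega>) (cylinder b \<gamma>)) \<longlonglongrightarrow> measure (\<Lambda> \<omega>) (cylinder b \<gamma>)"
        using elim(1) w regular_process_measure(3)[OF elim(2) w] by (simp add: add.commute limit_mass_def)
      then show "(\<lambda>n. measure (process_measure b regular n \<omega>) (cylinder b \<gamma>)) \<longlonglongrightarrow> measure (\<Lambda> \<omega>) (cylinder b \<gamma>)"
        by (rule LIMSEQ_offset)
    qed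
  qed
qed

lemma singular_process_measure:
  assumes \<omega>: "\<omega> \<in> \<Omega>"
  shows "finite_measure (process_measure b singular n \<omega>)"
    and "\<gamma> \<in> tree_words b \<Longrightarrow> measure (process_measure b singular (length \<gamma> + k) \<omega>) (cylinder b \<gamma>)
      = mass \<gamma> k \<omega> - (\<Sum>\<eta>\<in>generation b k. expected_mass (\<gamma> @ \<eta>) \<omega>)"
proof -
  let ?g = "\<lambda>n \<delta>. path_product \<delta> \<omega> - expected_mass \<delta> \<omega> * real b ^ n"
  have eq: "singular n t \<omega> = ?g n (prefix_of t n)" if "t \<in> tree_boundary b" for n t
    using that by (simp add: kahane_singular_def regular_eq cascade_eq_path_product)
  have nn: "0 \<le> ?g n \<gamma>" if "\<gamma> \<in> generation b n" for n \<gamma>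
    using that expected_mass_bounds(2)[OF _ \<omega>, of \<gamma>] b_pos by (auto simp: generation_def field_simps)
  show "finite_measure (process_measure b singular n \<omega>)"
    by (rule measure_process_measure(1)[where A = "{}" and g = "?g n"]) (use nn in \<open>auto simp: b_pos eq\<close>)
  assume w: "\<gamma> \<in> tree_words b"
  have "measure (process_measure b singular (length \<gamma> + k) \<omega>) (cylinder b \<gamma>)
      = (\<Sum>\<eta>\<in>generation b k. ?g (length \<gamma> + k) (\<gamma> @ \<eta>) * measure (tree_measure b) (cylinder b (\<gamma> @ \<eta>)))"
    by (rule measure_process_measure_cylinder[where g = "?g (length \<gamma> + k)"])
      (use nn in \<open>auto simp: b_pos eq w\<close>)
  also have "\<dots> = (\<Sum>\<eta>\<in>generation b k. path_product (\<gamma> @ \<eta>) \<omega> / real b ^ (length \<gamma> + k) - expected_mass (\<gamma> @ \<eta>) \<omega>)"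
    using w b_pos by (intro sum.cong) (auto simp: measure_cylinder_word append_tree_words generation_def field_simps)
  finally show "measure (process_measure b singular (length \<gamma> + k) \<omega>) (cylinder b \<gamma>)
      = mass \<gamma> k \<omega> - (\<Sum>\<eta>\<in>generation b k. expected_mass (\<gamma> @ \<eta>) \<omega>)"
    by (simp add: mass_def sum_subtractf)
qed

lemma singular_limit: "limit_measure b P singular (\<lambda>_. null_measure (tree_measure b))"
  unfolding limit_measure_def
proof
  have fin: "finite_measure (null_measure (tree_measure b))" by (rule finite_measureI) simp
  then show "random_measure b P (\<lambda>_. null_measure (tree_measure b))"
    by (auto simp: random_measure_def measure_def)
  have "AE \<omega> in P. \<forall>\<gamma>\<in>tree_words b. (\<lambda>k. mass \<gamma> k \<omega>) \<longlonglongrightarrow> limit_mass \<gamma> \<omega>"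
    using mass_tendsto_limit_mass by (subst AE_ball_countable) auto
  moreover have "AE \<omega> in P. \<omega> \<in> \<Omega>" by (simp add: space_P[symmetric])
  moreover note regular_mass_tendsto
  ultimately show "AE \<omega> in P. weakly_converges b (\<lambda>n. process_measure b singular n \<omega>) (null_measure (tree_measure b))"
  proof eventually_elim
    case (elim \<omega>)
    show ?case
    proof (rule weakly_convergesI[OF b_pos singular_process_measure(1)[OF elim(2)] sets_process_measure fin])
      fix \<gamma> assume w: "\<gamma> \<in> tree_words b"
      have "(\<lambda>k. mass \<gamma> k \<omega> - (\<Sum>\<eta>\<in>generation b k. expected_mass (\<gamma> @ \<eta>) \<omega>)) \<longlonglongrightarrow> limit_mass \<gamma> \<omega> - limit_mass \<gamma> \<omega>"
        using elim(1,3) w by (intro tendsto_diff) auto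
      then have "(\<lambda>k. measure (process_measure b singular (k + length \<gamma>) \<omega>) (cylinder b \<gamma>)) \<longlonglongrightarrow> 0"
        using singular_process_measure(2)[OF elim(2) w] by (simp add: add.commute)
      then have "(\<lambda>n. measure (process_measure b singular n \<omega>) (cylinder b \<gamma>)) \<longlonglongrightarrow> 0"
        by (rule LIMSEQ_offset)
      then show "(\<lambda>n. measure (process_measure b singular n \<omega>) (cylinder b \<gamma>)) \<longlonglongrightarrow> measure (null_measure (tree_measure b)) (cylinder b \<gamma>)"
        by (simp add: measure_def)
    qed simp
  qed
qed

lemma tree_boundary_cylinder: "cylinder b [] = space (tree_measure b)"
  by (auto simp: mem_cylinder_iff space_tree_measure)

lemma integrable_random_measure_\<Lambda>: "integrable_random_measure P (tree_measure b) \<Lambda>"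
  unfolding integrable_random_measure_def
  using finite_\<Lambda> sets_\<Lambda> measurable_\<Lambda> integrable_limit_mass[of "[]"]
  by (simp add: space_P limit_mass_def[abs_def] tree_boundary_cylinder)

lemma regular_process_measure_measurable:
  assumes A: "A \<in> sets (tree_measure b)"
  shows "(\<lambda>\<omega>. measure (process_measure b regular n \<omega>) A) \<in> borel_measurable (\<F> n)"
    and "integrable P (\<lambda>\<omega>. measure (process_measure b regular n \<omega>) A)"
proof -
  let ?S = "\<lambda>\<omega>. \<Sum>\<gamma>\<in>generation b n. expected_mass \<gamma> \<omega> * real b ^ n * measure (tree_measure b) (A \<inter> cylinder b \<gamma>)"
  have gw: "\<gamma> \<in> tree_words b" "length \<gamma> = n" if "\<gamma> \<in> generation b n" for \<gamma> using that by (auto simp: generation_def)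
  have "?S \<in> borel_measurable (\<F> n)"
    by (intro borel_measurable_sum borel_measurable_times borel_measurable_const measurable_expected_mass) (auto simp: gw)
  then show "(\<lambda>\<omega>. measure (process_measure b regular n \<omega>) A) \<in> borel_measurable (\<F> n)"
    by (subst measurable_cong[where g = ?S]) (auto simp: regular_process_measure(2)[OF _ A])
  have "integrable P ?S"
    by (intro Bochner_Integration.integrable_sum integrable_mult_left integrable_expected_mass) (auto simp: gw)
  then show "integrable P (\<lambda>\<omega>. measure (process_measure b regular n \<omega>) A)"
    by (subst Bochner_Integration.integrable_cong[where g = ?S]) (auto simp: space_P regular_process_measure(2)[OF _ A])
qed

lemma integrable_random_measure_regular: "integrable_random_measure P (tree_measure b) (process_measure b regular n)"
  unfolding integrable_random_measure_def
  using regular_process_measure(1) regular_process_measure_measurable(2)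
    measurable_P_of_filtration[OF regular_process_measure_measurable(1)]
  by (auto simp: space_P)

text \<open>
  Within a cylinder of generation \<open>|\<gamma>|\<close> the regular part spreads its mass uniformly.
\<close>

lemma regular_process_measure_deep_cylinder:
  assumes w: "\<gamma> @ \<eta> \<in> tree_words b" and \<omega>: "\<omega> \<in> \<Omega>"
  shows "measure (process_measure b regular (length \<gamma>) \<omega>) (cylinder b (\<gamma> @ \<eta>)) = expected_mass \<gamma> \<omega> / real b ^ length \<eta>"
proof -
  have g: "\<gamma> \<in> generation b (length \<gamma>)" using w by (simp add: generation_def append_tree_words)
  have "cylinder b (\<gamma> @ \<eta>) \<inter> cylinder b \<delta> = (if \<delta> = \<gamma> then cylinder b (\<gamma> @ \<eta>) else {})" if "\<delta> \<in> generation b (length \<gamma>)" for \<delta>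
    using cylinder_append_subset[of b \<gamma> \<eta>] cylinder_Int_same_generation[OF that g] by auto
  then have "measure (process_measure b regular (length \<gamma>) \<omega>) (cylinder b (\<gamma> @ \<eta>))
      = (\<Sum>\<delta>\<in>generation b (length \<gamma>). if \<delta> = \<gamma> then expected_mass \<gamma> \<omega> * real b ^ length \<gamma> * measure (tree_measure b) (cylinder b (\<gamma> @ \<eta>)) else 0)"
    unfolding regular_process_measure(2)[OF \<omega> sets_cylinder] by (intro sum.cong) auto
  also have "\<dots> = expected_mass \<gamma> \<omega> / real b ^ length \<eta>"
    using g w b_pos by (simp add: measure_cylinder_word power_add)
  finally show ?thesis .
qed

text \<open>
  On cylinders of length at least \<open>n\<close> both sides are the expected mass of the prefix of length \<open>n\<close>,
  divided by \<open>b\<close> once for each further letter. For the whole boundary both are sums over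
  generation \<open>n\<close>.
\<close>

lemma regular_cond_exp:
  assumes A: "A \<in> sets (tree_measure b)"
  shows "AE \<omega> in P. real_cond_exp P (\<F> n) (\<lambda>\<omega>. measure (\<Lambda> \<omega>) A) \<omega> = measure (process_measure b regular n \<omega>) A"
proof -
  interpret F: sigma_finite_subalgebra P "\<F> n" by (rule sigma_finite_subalgebraI[OF subalgebra_P_filtration])
  let ?R = "process_measure b regular n"
  let ?E = "insert {} {cylinder b \<delta> | \<delta>. \<delta> \<in> tree_words b \<and> n \<le> length \<delta>}"
  have R: "AE \<omega> in P. real_cond_exp P (\<F> n) (\<lambda>\<omega>. measure (?R \<omega>) A) \<omega> = measure (?R \<omega>) A"
    if "A \<in> sets (tree_measure b)" for A
    by (intro F.real_cond_exp_F_meas regular_process_measure_measurable that)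
  have eq: "AE \<omega> in P. real_cond_exp P (\<F> n) (\<lambda>\<omega>. measure (\<Lambda> \<omega>) A) \<omega> = real_cond_exp P (\<F> n) (\<lambda>\<omega>. measure (?R \<omega>) A) \<omega>"
    if "A \<in> insert (space (tree_measure b)) ?E" for A
    using that
  proof (elim insertE)
    assume A: "A = space (tree_measure b)"
    have "(\<lambda>\<omega>. measure (\<Lambda> \<omega>) A) = limit_mass []"
      by (simp add: fun_eq_iff limit_mass_def A tree_boundary_cylinder)
    moreover have "measure (?R \<omega>) A = (\<Sum>\<eta>\<in>generation b n. expected_mass ([] @ \<eta>) \<omega>)" if "\<omega> \<in> \<Omega>" for \<omega>
      using regular_process_measure(3)[OF that, of "[]" n] by (simp add: A tree_boundary_cylinder)
    moreover have "AE \<omega> in P. \<omega> \<in> \<Omega>" by (simp add: space_P[symmetric])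
    moreover have "A \<in> sets (tree_measure b)" using A by auto
    ultimately show ?thesis
      using regular_mass_version[of "[]" n] R[of A] by (auto elim!: eventually_elim2)
  next
    assume "A \<in> {cylinder b \<delta> | \<delta>. \<delta> \<in> tree_words b \<and> n \<le> length \<delta>}"
    then obtain \<delta> where \<delta>: "A = cylinder b \<delta>" "\<delta> \<in> tree_words b" "n \<le> length \<delta>" by blast
    let ?\<gamma> = "take n \<delta>" and ?\<eta> = "drop n \<delta>"
    have w: "?\<gamma> @ ?\<eta> \<in> tree_words b" "?\<gamma> \<in> tree_words b" and len: "length ?\<gamma> = n" using \<delta> take_tree_words by auto
    have "(\<lambda>\<omega>. measure (\<Lambda> \<omega>) A) = limit_mass \<delta>" by (simp add: fun_eq_iff limit_mass_def \<delta>)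
    moreover have "AE \<omega> in P. measure (?R \<omega>) A = expected_mass ?\<gamma> \<omega> / real b ^ length ?\<eta>"
      using regular_process_measure_deep_cylinder[OF w(1)] len \<delta>(1) by (intro AE_I2) (simp add: space_P)
    moreover have "A \<in> sets (tree_measure b)" using \<delta> by auto
    ultimately show ?thesis
      using limit_mass_descendant_cond_exp[OF w(1)] expected_mass_version[OF w(2)] R[of A] len
      by (auto elim!: eventually_elim2)
  qed simp
  have "AE \<omega> in P. real_cond_exp P (\<F> n) (\<lambda>\<omega>. measure (\<Lambda> \<omega>) A) \<omega> = real_cond_exp P (\<F> n) (\<lambda>\<omega>. measure (?R \<omega>) A) \<omega>"
  proof (rule random_measure_cond_exp_eqI[OF subalgebra_P_filtration integrable_random_measure_\<Lambda> integrable_random_measure_regular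
        Int_stable_cylinder _ _ eq A])
    show "sets (tree_measure b) = sigma_sets (space (tree_measure b)) ?E"
      unfolding space_tree_measure by (rule sigma_sets_cylinder)
    show "?E \<subseteq> Pow (space (tree_measure b))" by (auto simp: cylinder_def space_tree_measure)
  qed
  with R[OF A] show ?thesis by eventually_elim simp
qed

theorem kahane_decomposition_cascade: "kahane_decomposition b P cascade regular singular"
  unfolding kahane_decomposition_def
proof (intro conjI ballI allI regular_T_martingale singular_T_martingale singular_limit)
  show "cascade n t \<omega> = regular n t \<omega> + singular n t \<omega>" for n t \<omega> by (simp add: kahane_singular_def)
  show "\<exists>\<Lambda>'. limit_measure b P regular \<Lambda>' \<and>
      (\<forall>A\<in>sets (tree_measure b). integrable P (\<lambda>\<omega>. measure (\<Lambda>' \<omega>) A) \<and>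
        (\<forall>n. AE \<omega> in P. real_cond_exp P (\<F> n) (\<lambda>\<omega>. measure (\<Lambda>' \<omega>) A) \<omega> = measure (process_measure b regular n \<omega>) A))"
    using regular_limit regular_cond_exp integrable_random_measure_event[OF integrable_random_measure_\<Lambda>] by blast
qed

section \<open>The weights\<close>

definition weight :: "nat list \<Rightarrow> (nat list \<Rightarrow> real) \<Rightarrow> real" where
  "weight \<gamma> \<omega> = (if path_product \<gamma> \<omega> = 0 then 0
     else expected_mass \<gamma> \<omega> / measure (tree_measure b) (cylinder b \<gamma>) / path_product \<gamma> \<omega>)"

text \<open>
  The equality is pointwise, without exceptional set: where the cascade vanishes, clipping has made
  the regular part vanish too.
\<close>

lemma weighted_cascade_weight: "weighted_cascade weight = regular"
proof (intro ext)
  fix n t \<omega>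
  have "weighted_cascade weight n t \<omega> = path_product (prefix_of t n) \<omega> * weight (prefix_of t n) \<omega>"
    using cascade_eq_path_product[of n t \<omega>] by (simp add: weighted_cascade_def cascade_def)
  then show "weighted_cascade weight n t \<omega> = regular n t \<omega>"
    by (simp add: weight_def kahane_regular_def expected_mass_zero)
qed

lemma weighted_cascade_complement: "weighted_cascade (complement_weights weight) = singular"
proof (intro ext)
  fix n t \<omega>
  have "weighted_cascade (complement_weights weight) n t \<omega> = cascade n t \<omega> - weighted_cascade weight n t \<omega>"
    by (simp add: weighted_cascade_def cascade_def complement_weights_def right_diff_distrib)
  then show "weighted_cascade (complement_weights weight) n t \<omega> = singular n t \<omega>"
    by (simp add: weighted_cascade_weight kahane_singular_def)
qed

lemma weight_bounds:
  assumes w: "\<gamma> \<in> tree_words b" and \<omega>: "\<omega> \<in> \<Omega>"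
  shows "0 \<le> weight \<gamma> \<omega>" "weight \<gamma> \<omega> \<le> 1"
  using expected_mass_bounds[OF w \<omega>] path_product_nonneg[OF \<omega> w] b_pos
  by (auto simp: weight_def measure_cylinder_word[OF w] field_simps)

lemma measurable_weight: "weight \<gamma> \<in> borel_measurable (path_algebra b \<gamma>)"
proof -
  note [measurable] = measurable_path_product_path[of \<gamma> b]
  note [measurable] = measurable_expected_mass_path[of \<gamma>]
  show ?thesis unfolding weight_def by measurable
qed

lemma weight_decomposition_weight: "weight_decomposition b P weight"
  unfolding weight_decomposition_def weight_system_def weighted_cascade_weight weighted_cascade_complement
  using regular_T_martingale singular_T_martingale weight_bounds measurable_weight
  by (auto simp: space_P complement_weights_def[abs_def])

end

theorem theorem2p5:
  fixes b :: nat
    and p0 :: "real measure"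
    and q :: "nat \<Rightarrow> (nat \<Rightarrow> real) \<Rightarrow> real measure"
    and P :: "(nat list \<Rightarrow> real) measure"
    and \<Lambda> :: "(nat list \<Rightarrow> real) \<Rightarrow> (nat \<Rightarrow> nat) measure"
  assumes "2 \<le> b"
    and "cascade_generator b p0 q P"
    and "limit_measure b P cascade \<Lambda>"
  shows "\<exists>Y F.
    (\<forall>\<gamma>\<in>tree_words b. cond_exp_version P (cascade_filtration b (length \<gamma>))
        (\<lambda>\<omega>. measure (\<Lambda> \<omega>) (cylinder b \<gamma>)) (Y \<gamma>)) \<and>
    kahane_decomposition b P cascade (kahane_regular b Y) (kahane_singular b Y) \<and>
    (\<forall>t\<in>tree_boundary b. \<forall>n. \<forall>\<omega>\<in>space P.
       F (prefix_of t n) \<omega> =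
         (if cascade n t \<omega> = 0 then 0 else kahane_regular b Y n t \<omega> / cascade n t \<omega>)) \<and>
    weight_decomposition b P F \<and>
    (\<forall>t\<in>tree_boundary b. \<forall>n.
       (AE \<omega> in P. weighted_cascade F n t \<omega> = kahane_regular b Y n t \<omega>) \<and>
       (AE \<omega> in P. weighted_cascade (complement_weights F) n t \<omega> = kahane_singular b Y n t \<omega>))"
proof -
  interpret cascade_generator b p0 q P by fact
  interpret cascade_limit b p0 q P \<Lambda>
    by unfold_locales (use assms in auto)
  show ?thesis
  proof (intro exI conjI ballI allI)
    fix \<gamma> assume "\<gamma> \<in> tree_words b"
    then show "cond_exp_version P (cascade_filtration b (length \<gamma>)) (\<lambda>\<omega>. measure (\<Lambda> \<omega>) (cylinder b \<gamma>)) (expected_mass \<gamma>)"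
      using integrable_limit_mass expected_mass_version measurable_expected_mass
      by (simp add: cond_exp_version_def limit_mass_def[abs_def])
  next
    show "kahane_decomposition b P cascade regular singular" by (rule kahane_decomposition_cascade)
    show "weight_decomposition b P weight" by (rule weight_decomposition_weight)
    fix t n
    show "weight (prefix_of t n) \<omega> = (if cascade n t \<omega> = 0 then 0 else regular n t \<omega> / cascade n t \<omega>)" for \<omega>
      by (simp add: weight_def cascade_eq_path_product kahane_regular_def)
    show "AE \<omega> in P. weighted_cascade weight n t \<omega> = regular n t \<omega>"
      by (simp add: weighted_cascade_weight)
    show "AE \<omega> in P. weighted_cascade (complement_weights weight) n t \<omega> = singular n t \<omega>"
      by (simp add: weighted_cascade_complement)
  qed
qed

end
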